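(* Let $n\ge3$, let $A(\mathcal D_n)$ be the $n$-th Artin–Tits group of type $\mathcal D$ with standard generators $\delta_1,\dots,\delta_n$, and let $F_n$ be the free group with basis $x_1,\dots,x_n$. The representation $\iota:A(\mathcal D_n)\to\mathrm{Aut}(F_n)$ given by $$\iota(\delta_1):\ x_1\mapsto x_1,\quad x_j\mapsto x_jx_1^{-1}\ (j\ne1,n),\quad x_n\mapsto x_1x_nx_1^{-1};$$ $$\iota(\delta_2):\ x_1\mapsto x_1,\quad x_j\mapsto x_1^{-1}x_j\ (j\ne1,n),\quad x_n\mapsto x_n;$$ and, for $3\le i\le n$, $$\iota(\delta_i):\ x_{i-2}\mapsto x_{i-1},\quad x_{i-1}\mapsto x_{i-1}x_{i-2}^{-1}x_{i-1},\quad x_j\mapsto x_j\ (j\ne i-2,i-1),$$ is well defined and faithful (i.e. injective).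
   Context: $A(\mathcal D_n)$ is the group with generators $\delta_1,\dots,\delta_n$ and relations given by the Coxeter graph of type $\mathcal D_n$, whose edges are $\{\delta_1,\delta_3\}$, $\{\delta_2,\delta_3\}$ and $\{\delta_i,\delta_{i+1}\}$ for $3\le i\le n-1$: $\delta_i\delta_j\delta_i=\delta_j\delta_i\delta_j$ if $\delta_i,\delta_j$ are joined by an edge, and $\delta_i\delta_j=\delta_j\delta_i$ otherwise. Automorphisms are composed as functions, $(\alpha\beta)(x)=\alpha(\beta(x))$. *)

theory Defs
  imports "HOL-Algebra.Bij"
begin

section \<open>Groups given by generators and relations\<close>

text \<open>
  A word is a list of letters \<open>(s, e)\<close>, where \<open>(s, True)\<close> stands for the generator \<open>s\<close> and
  \<open>(s, False)\<close> for its formal inverse. A relation \<open>u = v\<close> is a pair of words \<open>(u, v)\<close>.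
\<close>

type_synonym 'a word = "('a \<times> bool) list"

definition words :: "'a set \<Rightarrow> 'a word set"
  where "words S = lists (S \<times> UNIV)"

inductive pres_eq :: "'a set \<Rightarrow> ('a word \<times> 'a word) set \<Rightarrow> 'a word \<Rightarrow> 'a word \<Rightarrow> bool"
  for S :: "'a set" and R :: "('a word \<times> 'a word) set"
  where
    refl: "w \<in> words S \<Longrightarrow> pres_eq S R w w"
  | sym: "pres_eq S R u v \<Longrightarrow> pres_eq S R v u"
  | trans: "pres_eq S R u v \<Longrightarrow> pres_eq S R v w \<Longrightarrow> pres_eq S R u w"
  | cong: "pres_eq S R u v \<Longrightarrow> a \<in> words S \<Longrightarrow> b \<in> words S \<Longrightarrow> pres_eq S R (a @ u @ b) (a @ v @ b)"
  | cancel: "s \<in> S \<Longrightarrow> pres_eq S R [(s, e), (s, \<not> e)] []"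
  | relation: "(u, v) \<in> R \<Longrightarrow> u \<in> words S \<Longrightarrow> v \<in> words S \<Longrightarrow> pres_eq S R u v"

definition word_class :: "'a set \<Rightarrow> ('a word \<times> 'a word) set \<Rightarrow> 'a word \<Rightarrow> 'a word set"
  where "word_class S R w = {v. pres_eq S R w v}"

definition presented_group :: "'a set \<Rightarrow> ('a word \<times> 'a word) set \<Rightarrow> 'a word set monoid"
  where "presented_group S R =
    \<lparr>carrier = word_class S R ` words S,
     mult = (\<lambda>X Y. {w. \<exists>u\<in>X. \<exists>v\<in>Y. pres_eq S R (u @ v) w}),
     one = word_class S R []\<rparr>"

definition pres_gen :: "'a set \<Rightarrow> ('a word \<times> 'a word) set \<Rightarrow> 'a \<Rightarrow> 'a word set"
  where "pres_gen S R s = word_class S R [(s, True)]"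

lemma pres_eq_words: "pres_eq S R u v \<Longrightarrow> u \<in> words S \<and> v \<in> words S"
  by (induction rule: pres_eq.induct) (auto simp: words_def)

lemma word_class_eq_iff:
  "u \<in> words S \<Longrightarrow> word_class S R u = word_class S R v \<longleftrightarrow> pres_eq S R u v"
  unfolding word_class_def by (blast intro: pres_eq.intros)

lemma mult_word_class:
  assumes "u \<in> words S" "v \<in> words S"
  shows "word_class S R u \<otimes>\<^bsub>presented_group S R\<^esub> word_class S R v = word_class S R (u @ v)"
proof -
  have "pres_eq S R (u @ v) (u' @ v')" if "pres_eq S R u u'" "pres_eq S R v v'" for u' v'
  proof (rule pres_eq.trans)
    show "pres_eq S R (u @ v) (u' @ v)"
      using pres_eq.cong[OF that(1), of "[]" v] assms by (simp add: words_def)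
    show "pres_eq S R (u' @ v) (u' @ v')"
      using pres_eq.cong[OF that(2), of u' "[]"] pres_eq_words[OF that(1)] by (simp add: words_def)
  qed
  then show ?thesis
    using assms unfolding presented_group_def word_class_def
    by (auto intro: pres_eq.refl pres_eq.trans)
qed

lemma group_presented_group: "group (presented_group S R)"
proof (rule groupI)
  let ?G = "presented_group S R"
  have car: "carrier ?G = word_class S R ` words S" and one: "\<one>\<^bsub>?G\<^esub> = word_class S R []"
    by (simp_all add: presented_group_def)
  have nil: "[] \<in> words S" and app: "\<And>u v. u \<in> words S \<Longrightarrow> v \<in> words S \<Longrightarrow> u @ v \<in> words S"
    by (auto simp: words_def)
  show "\<one>\<^bsub>?G\<^esub> \<in> carrier ?G" using car one nil by simp
  show "x \<otimes>\<^bsub>?G\<^esub> y \<in> carrier ?G" if "x \<in> carrier ?G" "y \<in> carrier ?G" for x y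
    using that app unfolding car by (auto simp: mult_word_class)
  show "x \<otimes>\<^bsub>?G\<^esub> y \<otimes>\<^bsub>?G\<^esub> z = x \<otimes>\<^bsub>?G\<^esub> (y \<otimes>\<^bsub>?G\<^esub> z)"
    if "x \<in> carrier ?G" "y \<in> carrier ?G" "z \<in> carrier ?G" for x y z
    using that app unfolding car by (auto simp: mult_word_class)
  show "\<one>\<^bsub>?G\<^esub> \<otimes>\<^bsub>?G\<^esub> x = x" if "x \<in> carrier ?G" for x
    using that nil unfolding car one by (auto simp: mult_word_class)
  have "\<exists>v\<in>words S. pres_eq S R (v @ u) []" if "u \<in> words S" for u
    using that
  proof (induction u)
    case Nil
    then show ?case using nil pres_eq.refl by fastforce
  next
    case (Cons a u)
    obtain s e where a: "a = (s, e)" by (cases a)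
    have s: "s \<in> S" and u: "u \<in> words S" using Cons.prems by (auto simp: a words_def)
    then obtain v where v: "v \<in> words S" "pres_eq S R (v @ u) []" using Cons.IH by blast
    have "pres_eq S R (v @ [(s, \<not> e), (s, e)] @ u) (v @ [] @ u)"
      using pres_eq.cong[OF pres_eq.cancel[OF s, of R "\<not> e"] v(1) u] by simp
    then have "pres_eq S R ((v @ [(s, \<not> e)]) @ a # u) []"
      using v(2) by (auto simp: a intro: pres_eq.trans)
    moreover have "v @ [(s, \<not> e)] \<in> words S" using v(1) s by (simp add: words_def)
    ultimately show ?case by blast
  qed
  then show "\<exists>y\<in>carrier ?G. y \<otimes>\<^bsub>?G\<^esub> x = \<one>\<^bsub>?G\<^esub>" if "x \<in> carrier ?G" for x
    using that app unfolding car one by (auto simp: mult_word_class word_class_eq_iff)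
qed


section \<open>The free group of rank n\<close>

definition free_group :: "nat \<Rightarrow> nat word set monoid"
  where "free_group n = presented_group {1..n} {}"

definition free_gen :: "nat \<Rightarrow> nat \<Rightarrow> nat word set"
  where "free_gen n = pres_gen {1..n} {}"


section \<open>The Artin--Tits group of type D\<close>

definition D_edges :: "nat \<Rightarrow> nat set set"
  where "D_edges n = {{1, 3}, {2, 3}} \<union> {{i, i + 1} | i. 3 \<le> i \<and> i + 1 \<le> n}"

definition artin_D_relations :: "nat \<Rightarrow> (nat word \<times> nat word) set"
  where "artin_D_relations n =
    {([(i, True), (j, True), (i, True)], [(j, True), (i, True), (j, True)]) | i j.
       i \<in> {1..n} \<and> j \<in> {1..n} \<and> {i, j} \<in> D_edges n} \<union>
    {([(i, True), (j, True)], [(j, True), (i, True)]) | i j.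
       i \<in> {1..n} \<and> j \<in> {1..n} \<and> {i, j} \<notin> D_edges n}"

definition artin_D :: "nat \<Rightarrow> nat word set monoid"
  where "artin_D n = presented_group {1..n} (artin_D_relations n)"

definition artin_D_gen :: "nat \<Rightarrow> nat \<Rightarrow> nat word set"
  where "artin_D_gen n = pres_gen {1..n} (artin_D_relations n)"


section \<open>The representation by automorphisms of the free group\<close>

text \<open>The image of the basis element \<open>x\<^sub>j\<close> under the automorphism assigned to \<open>\<delta>\<^sub>i\<close>.\<close>

definition iota_image :: "nat \<Rightarrow> nat \<Rightarrow> nat \<Rightarrow> nat word set"
  where "iota_image n i j =
    (let F = free_group n; x = free_gen n in
     if i = 1 then
       (if j = 1 then x 1
        else if j = n then x 1 \<otimes>\<^bsub>F\<^esub> x n \<otimes>\<^bsub>F\<^esub> inv\<^bsub>F\<^esub> x 1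
        else x j \<otimes>\<^bsub>F\<^esub> inv\<^bsub>F\<^esub> x 1)
     else if i = 2 then
       (if j = 1 then x 1
        else if j = n then x n
        else inv\<^bsub>F\<^esub> x 1 \<otimes>\<^bsub>F\<^esub> x j)
     else
       (if j = i - 2 then x (i - 1)
        else if j = i - 1 then x (i - 1) \<otimes>\<^bsub>F\<^esub> inv\<^bsub>F\<^esub> x (i - 2) \<otimes>\<^bsub>F\<^esub> x (i - 1)
        else x j))"

text \<open>
  Multiplication in \<^const>\<open>AutoGroup\<close> is \<open>(\<alpha>\<beta>)(x) = \<alpha>(\<beta>(x))\<close>. Extensionality fixes the irrelevant
  values of \<open>\<iota>\<close> outside the group, so that \<open>\<iota>\<close> can be unique.
\<close>

definition is_iota :: "nat \<Rightarrow> (nat word set \<Rightarrow> nat word set \<Rightarrow> nat word set) \<Rightarrow> bool"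
  where "is_iota n \<iota> \<longleftrightarrow>
    \<iota> \<in> hom (artin_D n) (AutoGroup (free_group n)) \<and>
    \<iota> \<in> extensional (carrier (artin_D n)) \<and>
    (\<forall>i\<in>{1..n}. \<forall>j\<in>{1..n}. \<iota> (artin_D_gen n i) (free_gen n j) = iota_image n i j)"

end

theory Submission
  imports Defs "HOL-Library.Product_Plus" "HOL-Algebra.Coset"
begin

text \<open>
  The elements \<open>a\<^sub>1 = \<delta>\<^sub>1 \<delta>\<^sub>2\<^sup>-\<^sup>1\<close> and \<open>a\<^bsub>j+1\<^esub> = \<delta>\<^bsub>j+2\<^esub> a\<^sub>j \<delta>\<^bsub>j+2\<^esub>\<^sup>-\<^sup>1\<close> act as conjugation by \<open>x\<^sub>1, \<dots>, x\<^bsub>n-1\<^esub>\<close>, and the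
  subgroup they generate is normalised by \<open>\<delta>\<^sub>2, \<dots>, \<delta>\<^sub>n\<close>. So every element is a product \<open>w \<beta>\<close> of a word
  \<open>w\<close> in the \<open>a\<^sub>j\<close> and a braid \<open>\<beta>\<close> in \<open>\<delta>\<^sub>2, \<dots>, \<delta>\<^sub>n\<close>. Braids fix \<open>x\<^sub>n\<close>, so an element of the kernel has a
  \<open>w\<close> which commutes with \<open>x\<^sub>n\<close> and is therefore trivial. The map \<open>x\<^sub>j \<mapsto> y\<^sub>1 y\<^bsub>j+1\<^esub>\<close> turns the action of
  \<open>\<beta>\<close> on \<open>x\<^sub>1, \<dots>, x\<^bsub>n-1\<^esub>\<close> into the Hurwitz action on the factorisation of \<open>y\<^sub>1 \<cdots> y\<^sub>n\<close> into reflections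
  in the universal Coxeter group with generators \<open>y\<^sub>i\<close>.

  The Hurwitz action is free by peak reduction for the total length of the reflections: every
  elementary move changes it, and two shortening moves which overlap are joined below the peak by
  the hexagon of the braid relation. The one exceptional configuration is excluded by a planarity
  invariant, a cyclic order of the group which comes from its action on the projective line by
  half-turns of the hyperbolic plane.
\<close>

subsection \<open>The universal Coxeter group\<close>

text \<open>The free group is given by a presentation, so nontriviality in it has to be detected by
  a homomorphism to a group with explicit normal forms. The universal Coxeter group serves for this:
  its elements are lists without equal neighbours, and the products \<open>y_1 y_(j+1)\<close> with
  \<open>j < n\<close> form a basis of the even-length subgroup on \<open>n\<close> generators. The
  entries of a tuple there are involutions, which turns the formulas of the representation into
  moves on tuples. Peak reduction is run not on tuples but on pairs of a tuple and a group element,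
  where each move also multiplies the second component by the corresponding generator. The braid
  relations in the target group close the hexagons in both components, and uniqueness of the minimum
  then says directly that a word fixing the base tuple evaluates to the identity. The exceptional
  peak is a triple whose middle reflection separates both neighbours from the base vertex, so that
  both moves conjugate by it and both shorten. Arbitrary tuples of reflections do contain such
  triples; hence an invariant of the orbit of the base tuple is unavoidable.\<close>

fun push :: "nat \<Rightarrow> nat list \<Rightarrow> nat list" where
  "push i [] = [i]"
| "push i (j # w) = (if i = j then w else i # j # w)"

lemma distinct_adj_push: "distinct_adj w \<Longrightarrow> distinct_adj (push i w)"
  by (cases w) (auto dest: distinct_adj_ConsD)

lemma push_push: "distinct_adj w \<Longrightarrow> push i (push i w) = w"
  by (cases w rule: remdups_adj.cases) auto

lemma distinct_adj_foldr_push: "distinct_adj w \<Longrightarrow> distinct_adj (foldr push u w)"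
  by (induction u) (auto simp: distinct_adj_push)

lemma foldr_push_push: "distinct_adj w \<Longrightarrow> foldr push (push i v) w = push i (foldr push v w)"
  by (cases v) (auto simp: push_push distinct_adj_foldr_push)

text \<open>Words act on reduced lists by \<open>push\<close>, and each \<open>push i\<close> is an
  involution there. Cancelling a pair of equal letters in \<open>u\<close> therefore leaves its
  action unchanged, which yields associativity without a confluence argument for reductions.\<close>

lemma foldr_push_assoc:
  "distinct_adj w \<Longrightarrow> foldr push (foldr push u v) w = foldr push u (foldr push v w)"
  by (induction u) (auto simp: foldr_push_push)

lemma foldr_push_reduced: "distinct_adj (u @ w) \<Longrightarrow> foldr push u w = u @ w"
proof (induction u)
  case (Cons i u)
  then show ?case by (cases "u @ w") auto
qed simp

text \<open>The free product of groups of order two, one for every natural number. Letters beyond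
  \<open>n\<close> stay available; the letter \<open>Suc n\<close> will detect commutation with
  \<open>x n\<close>.\<close>

typedef ucox = "{w :: nat list. distinct_adj w}"
  morphisms letters Abs_ucox
  by (rule exI[of _ "[]"]) simp

lemma distinct_adj_letters [simp]: "distinct_adj (letters x)"
  using letters[of x] by simp

instantiation ucox :: monoid_mult
begin

definition one_ucox :: ucox where "1 = Abs_ucox []"

definition times_ucox :: "ucox \<Rightarrow> ucox \<Rightarrow> ucox"
  where "x * y = Abs_ucox (foldr push (letters x) (letters y))"

instance
proof
  have m: "letters (x * y) = foldr push (letters x) (letters y)" for x y
    by (simp add: times_ucox_def Abs_ucox_inverse distinct_adj_foldr_push)
  have o: "letters 1 = []" by (simp add: one_ucox_def Abs_ucox_inverse)
  fix x y z :: ucox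
  show "x * y * z = x * (y * z)" by (simp add: letters_inject[symmetric] m foldr_push_assoc)
  show "1 * x = x" by (simp add: letters_inject[symmetric] m o)
  show "x * 1 = x" by (simp add: letters_inject[symmetric] m o foldr_push_reduced)
qed

end

lemma letters_times: "letters (x * y) = foldr push (letters x) (letters y)"
  by (simp add: times_ucox_def Abs_ucox_inverse distinct_adj_foldr_push)

lemma letters_one [simp]: "letters 1 = []"
  by (simp add: one_ucox_def Abs_ucox_inverse)

definition invo :: "nat \<Rightarrow> ucox" where "invo i = Abs_ucox [i]"

lemma letters_invo [simp]: "letters (invo i) = [i]"
  by (simp add: invo_def Abs_ucox_inverse)

lemma letters_invo_times: "letters (invo i * x) = push i (letters x)"
  by (simp add: letters_times)

lemma invo_invo [simp]: "invo i * invo i = 1"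
  by (simp add: letters_inject[symmetric] letters_invo_times)

lemma invo_invo_times [simp]: "invo i * (invo i * x) = x"
  by (simp add: mult.assoc[symmetric])

definition elem :: "nat list \<Rightarrow> ucox" where "elem u = prod_list (map invo u)"

lemma elem_simps [simp]:
  "elem [] = 1" "elem (i # u) = invo i * elem u" "elem (u @ v) = elem u * elem v"
  by (auto simp: elem_def)

lemma letters_elem_foldr: "letters (elem u) = foldr push u []"
  by (induction u) (auto simp: letters_invo_times)

lemma letters_elem: "distinct_adj u \<Longrightarrow> letters (elem u) = u"
  using foldr_push_reduced[of u "[]"] by (simp add: letters_elem_foldr)

lemma elem_letters [simp]: "elem (letters x) = x"
  by (simp add: letters_inject[symmetric] letters_elem)

lemma elem_rev_elem: "elem (rev u) * elem u = 1"
  by (induction u) (auto simp: mult.assoc)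

lemma elem_elem_rev: "elem u * elem (rev u) = 1"
  using elem_rev_elem[of "rev u"] by simp

definition len :: "ucox \<Rightarrow> nat" where "len x = length (letters x)"

lemma len_elem: "distinct_adj u \<Longrightarrow> len (elem u) = length u"
  by (simp add: len_def letters_elem)

lemma len_elem_le: "len (elem u) \<le> length u"
proof -
  have "length (push i w) \<le> Suc (length w)" for i w by (cases w) auto
  then have "length (foldr push u []) \<le> length u"
    by (induction u) (auto intro: le_trans)
  then show ?thesis by (simp add: len_def letters_elem_foldr)
qed


subsection \<open>An invariant cyclic order\<close>

fun det :: "int \<times> int \<Rightarrow> int \<times> int \<Rightarrow> int" where
  "det (p, q) (r, s) = p * s - q * r"

text \<open>Every vector enters two of the three factors, so the sign depends only on the lines
  spanned: it is the cyclic order of three points of the projective line.\<close>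

definition orient :: "int \<times> int \<Rightarrow> int \<times> int \<Rightarrow> int \<times> int \<Rightarrow> int"
  where "orient u v w = det u v * det v w * det w u"

text \<open>The matrix of the half-turn of the hyperbolic plane which exchanges the interval
  \<open>(2i - 1, 2i + 1)\<close> of the boundary line with its complement.\<close>
fun half_turn :: "nat \<Rightarrow> int \<times> int \<Rightarrow> int \<times> int" where
  "half_turn i (p, q) = (2 * int i * p - (4 * int i * int i + 1) * q, p - 2 * int i * q)"

text \<open>With \<open>(p, q)\<close> read as the point \<open>p / q\<close>, this is the orbit of
  infinity, a point in none of the intervals.\<close>

definition vec :: "nat list \<Rightarrow> int \<times> int" where "vec u = foldr half_turn u (1, 0)"

lemma vec_simps [simp]: "vec [] = (1, 0)" "vec (i # u) = half_turn i (vec u)"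
  by (auto simp: vec_def)

lemma half_turn_half_turn: "half_turn i (half_turn i v) = - v"
  by (cases v) (simp add: algebra_simps)

lemma det_half_turn: "det (half_turn i u) (half_turn i v) = det u v"
  by (cases u; cases v) (simp add: algebra_simps)

lemma det_uminus [simp]: "det (- u) v = - det u v" "det u (- v) = - det u v"
  by (cases u; cases v; simp)+

lemma det_swap: "det u v = - det v u"
  by (cases u; cases v) simp

text \<open>The sign appears when two equal letters cancel, since a half-turn squares to minus the
  identity matrix.\<close>

lemma vec_push: "vec (push i w) = half_turn i (vec w) \<or> vec (push i w) = - half_turn i (vec w)"
  by (cases w) (auto simp: half_turn_half_turn)

definition cyc :: "ucox \<Rightarrow> ucox \<Rightarrow> ucox \<Rightarrow> bool"
  where "cyc x y z \<longleftrightarrow> orient (vec (letters x)) (vec (letters y)) (vec (letters z)) > 0"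

lemma orient_uminus [simp]:
  "orient (- u) v w = orient u v w" "orient u (- v) w = orient u v w" "orient u v (- w) = orient u v w"
  by (simp_all add: orient_def)

lemma cyc_invo_times: "cyc (invo i * x) (invo i * y) (invo i * z) = cyc x y z"
proof -
  have "orient (vec (push i u)) (vec (push i v)) (vec (push i w)) = orient (vec u) (vec v) (vec w)"
    for u v w
    using vec_push[of i u] vec_push[of i v] vec_push[of i w]
    by (elim disjE) (simp_all add: orient_def det_half_turn)
  then show ?thesis by (simp add: cyc_def letters_invo_times)
qed

lemma cyc_times: "cyc (g * x) (g * y) (g * z) = cyc x y z"
proof -
  have "cyc (elem u * x) (elem u * y) (elem u * z) = cyc x y z" for u
    by (induction u) (simp_all add: mult.assoc cyc_invo_times)
  from this[of "letters g"] show ?thesis by simp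
qed

lemma cyc_rotate: "cyc x y z \<Longrightarrow> cyc y z x"
  by (simp add: cyc_def orient_def algebra_simps)

lemma cyc_asym: "cyc x y z \<Longrightarrow> \<not> cyc x z y"
proof -
  have "orient u w v = - orient u v w" for u v w
    using det_swap[of u w] det_swap[of w v] det_swap[of v u] by (simp add: orient_def)
  from this[of "vec (letters x)" "vec (letters z)" "vec (letters y)"]
  show "cyc x y z \<Longrightarrow> \<not> cyc x z y" by (simp add: cyc_def)
qed

text \<open>With \<open>cyc_rotate\<close> and \<open>cyc_asym\<close> this makes \<open>cyc\<close>
  a partial cyclic order, invariant under left translation by \<open>cyc_times\<close>.\<close>

lemma cyc_trans:
  assumes "cyc o' u v" "cyc o' v w"
  shows "cyc o' u w" "cyc u v w"
proof -
  define A B C D E G where d: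
    "A = det (vec (letters o')) (vec (letters u))" "B = det (vec (letters o')) (vec (letters v))"
    "C = det (vec (letters o')) (vec (letters w))" "D = det (vec (letters u)) (vec (letters v))"
    "E = det (vec (letters v)) (vec (letters w))" "G = det (vec (letters u)) (vec (letters w))"
  \<comment> \<open>The three-term Pluecker relation for four vectors in the plane. After
    multiplication with the square of \<open>B\<close> it expresses each wanted product by squares
    times the two products known to be negative.\<close>
  have pl: "B * G = A * E + C * D"
    unfolding d by (cases "vec (letters o')"; cases "vec (letters u)"; cases "vec (letters v)"; cases "vec (letters w)")
       (simp add: algebra_simps)
  have 1: "A * D * B < 0" "B * E * C < 0"
    using assms det_swap[of "vec (letters v)" "vec (letters o')"] det_swap[of "vec (letters w)" "vec (letters o')"]
    by (simp_all add: cyc_def orient_def d)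
  then have nz: "A \<noteq> 0" "B \<noteq> 0" "C \<noteq> 0" "D \<noteq> 0" "E \<noteq> 0" by auto
  have neg: "x\<^sup>2 * y + z\<^sup>2 * t < 0" if "x \<noteq> 0" "z \<noteq> 0" "y < 0" "t < 0" for x y z t :: int
    using mult_pos_neg[of "x\<^sup>2" y] mult_pos_neg[of "z\<^sup>2" t] that by simp
  have "B\<^sup>2 * (A * G * C) = A * B * C * (B * G)" by (simp add: power2_eq_square)
  also have "\<dots> = A\<^sup>2 * (B * E * C) + C\<^sup>2 * (A * D * B)" unfolding pl by (simp add: power2_eq_square algebra_simps)
  also have "\<dots> < 0" by (intro neg nz 1)
  finally have a: "A * G * C < 0" using nz by (simp add: mult_less_0_iff)
  have "B\<^sup>2 * (D * E * G) = B * D * E * (B * G)" by (simp add: power2_eq_square)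
  also have "\<dots> = E\<^sup>2 * (A * D * B) + D\<^sup>2 * (B * E * C)" unfolding pl by (simp add: power2_eq_square algebra_simps)
  also have "\<dots> < 0" by (intro neg nz 1)
  finally have b: "D * E * G < 0" using nz by (simp add: mult_less_0_iff)
  show "cyc o' u w" "cyc u v w"
    using a b det_swap[of "vec (letters w)" "vec (letters o')"] det_swap[of "vec (letters w)" "vec (letters u)"]
    by (simp_all add: cyc_def orient_def d)
qed

definition starts :: "nat \<Rightarrow> ucox \<Rightarrow> bool"
  where "starts i x \<longleftrightarrow> letters x \<noteq> [] \<and> hd (letters x) = i"

text \<open>The inequality on \<open>p\<close> and \<open>q\<close> says whether
  \<open>p / q\<close> lies in the interval \<open>(2i - 1, 2i + 1)\<close>. The half-turn
  \<open>j\<close> maps the outside of its own interval into it, and intervals of different letters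
  are disjoint, so the first letter of a reduced word decides where the orbit point lies.\<close>

lemma ping_pong:
  assumes "distinct_adj u" "vec u = (p, q)"
  shows "if u \<noteq> [] \<and> hd u = i then \<bar>p - 2 * int i * q\<bar> < \<bar>q\<bar> else \<bar>q\<bar> < \<bar>p - 2 * int i * q\<bar>"
  using assms
proof (induction u arbitrary: p q i)
  case (Cons j u)
  obtain p' q' where v: "vec u = (p', q')" by force
  have "distinct_adj u" "\<not> (u \<noteq> [] \<and> hd u = j)"
    using Cons.prems(1) by (auto simp: distinct_adj_Cons)
  then have "\<bar>q'\<bar> < \<bar>p' - 2 * int j * q'\<bar>" using Cons.IH[of p' q' j] v by presburger
  moreover have "p - 2 * int j * q = - q'" "q = p' - 2 * int j * q'"
    using Cons.prems(2) v by (auto simp: algebra_simps)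
  ultimately have lt: "\<bar>p - 2 * int j * q\<bar> < \<bar>q\<bar>" by simp
  show ?case
  proof (cases "j = i")
    case False
    \<comment> \<open>The centres \<open>2i\<close> and \<open>2j\<close> are at least two apart, so
      distance below one from the second means distance above one from the first.\<close>
    then have "1 \<le> \<bar>int i - int j\<bar>" by simp
    then have "\<bar>q\<bar> \<le> \<bar>int i - int j\<bar> * \<bar>q\<bar>"
      using mult_right_mono[of 1 "\<bar>int i - int j\<bar>" "\<bar>q\<bar>"] by simp
    moreover have "\<bar>2 * int i * q - 2 * int j * q\<bar> = 2 * (\<bar>int i - int j\<bar> * \<bar>q\<bar>)"
    proof -
      have "2 * int i * q - 2 * int j * q = 2 * ((int i - int j) * q)" by (simp add: algebra_simps)
      then show ?thesis by (simp only: abs_mult abs_numeral)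
    qed
    ultimately have "2 * \<bar>q\<bar> \<le> \<bar>2 * int i * q - 2 * int j * q\<bar>" by simp
    then show ?thesis using lt False by simp
  qed (use lt in simp)
qed simp

text \<open>Two points of an interval cannot separate two points of its complement on a circle; here
  the interval is the one which belongs to the letter \<open>i\<close>.\<close>

lemma not_interlaced:
  assumes "\<not> starts i x" "starts i y" "\<not> starts i z" "starts i t"
  shows "\<not> (cyc x y z \<and> cyc x z t)"
proof -
  \<comment> \<open>This shear moves the centre of the interval to zero and preserves determinants;
    membership becomes a comparison of the absolute values of the two coordinates.\<close>
  define sh :: "int \<times> int \<Rightarrow> int \<times> int" where "sh = (\<lambda>(p, q). (p - 2 * int i * q, q))"
  have det_sh: "det u v = det (sh u) (sh v)" for u v
    by (cases u; cases v) (simp add: sh_def algebra_simps)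
  have far: "\<exists>p q. sh (vec (letters x)) = (p, q) \<and> \<bar>q\<bar> < \<bar>p\<bar>" if "\<not> starts i x" for x
    using that ping_pong[of "letters x" _ _ i]
    by (cases "vec (letters x)") (auto simp: sh_def starts_def split: if_splits)
  have near: "\<exists>p q. sh (vec (letters x)) = (p, q) \<and> \<bar>p\<bar> < \<bar>q\<bar>" if "starts i x" for x
    using that ping_pong[of "letters x" _ _ i]
    by (cases "vec (letters x)") (auto simp: sh_def starts_def split: if_splits)
  obtain p1 q1 p2 q2 p3 q3 p4 q4 where v:
    "sh (vec (letters x)) = (p1, q1)" "\<bar>q1\<bar> < \<bar>p1\<bar>" "sh (vec (letters y)) = (p2, q2)" "\<bar>p2\<bar> < \<bar>q2\<bar>"
    "sh (vec (letters z)) = (p3, q3)" "\<bar>q3\<bar> < \<bar>p3\<bar>" "sh (vec (letters t)) = (p4, q4)" "\<bar>p4\<bar> < \<bar>q4\<bar>"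
    using far[OF assms(1)] near[OF assms(2)] far[OF assms(3)] near[OF assms(4)] by blast
  \<comment> \<open>The product of the two dominant coordinates decides the sign of the
    determinant.\<close>
  have signed_gen: "sgn (a * c - b * d) = sgn a * sgn c" if "\<bar>b\<bar> < \<bar>a\<bar>" "\<bar>d\<bar> < \<bar>c\<bar>" for a b c d :: int
  proof -
    have "\<bar>b * d\<bar> < \<bar>a * c\<bar>" using that by (simp add: abs_mult mult_strict_mono)
    then show ?thesis unfolding sgn_mult[symmetric] by (auto simp: sgn_if abs_if split: if_splits)
  qed
  have sg': "sgn (b * d - a * c) = - (sgn a * sgn c)" if "\<bar>b\<bar> < \<bar>a\<bar>" "\<bar>d\<bar> < \<bar>c\<bar>" for a b c d :: int
    using signed_gen[OF that] sgn_minus[of "a * c - b * d"] by simp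
  have s: "sgn (p1 * q2 - q1 * p2) = sgn p1 * sgn q2" "sgn (p2 * q3 - q2 * p3) = - (sgn q2 * sgn p3)"
    "sgn (p3 * q4 - q3 * p4) = sgn p3 * sgn q4" "sgn (p4 * q1 - q4 * p1) = - (sgn q4 * sgn p1)"
    by (intro signed_gen sg' v)+
  have nz: "sgn q2 * sgn q2 = 1" "sgn q4 * sgn q4 = 1" using v by (auto simp: sgn_if)
  show ?thesis
  proof
    assume c: "cyc x y z \<and> cyc x z t"
    define Z where "Z = sgn (p3 * q1 - q3 * p1)"
    have Z': "sgn (p1 * q3 - q1 * p3) = - Z"
      using sgn_minus[of "p3 * q1 - q3 * p1"] by (simp add: Z_def algebra_simps)
    have "0 < (p1 * q2 - q1 * p2) * (p2 * q3 - q2 * p3) * (p3 * q1 - q3 * p1)"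
      using c unfolding cyc_def orient_def
        det_sh[of "vec (letters x)" "vec (letters y)"] det_sh[of "vec (letters y)" "vec (letters z)"]
        det_sh[of "vec (letters z)" "vec (letters x)"] v by simp
    then have "sgn p1 * sgn q2 * - (sgn q2 * sgn p3) * Z = 1"
      unfolding Z_def s[symmetric] by (simp add: sgn_mult[symmetric])
    moreover have "0 < (p1 * q3 - q1 * p3) * (p3 * q4 - q3 * p4) * (p4 * q1 - q4 * p1)"
      using c unfolding cyc_def orient_def
        det_sh[of "vec (letters x)" "vec (letters z)"] det_sh[of "vec (letters z)" "vec (letters t)"]
        det_sh[of "vec (letters t)" "vec (letters x)"] v by simp
    then have "- Z * (sgn p3 * sgn q4) * - (sgn q4 * sgn p1) = 1"
      unfolding Z'[symmetric] s[symmetric] by (simp add: sgn_mult[symmetric])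
    ultimately have "(sgn q2 * sgn q2) * (sgn p1 * sgn p3 * Z) = - 1"
      "(sgn q4 * sgn q4) * (sgn p1 * sgn p3 * Z) = 1"
      by (simp_all only: ac_simps mult_minus_left mult_minus_right minus_minus)
    then show False unfolding nz by simp
  qed
qed

subsection \<open>Reflections\<close>

text \<open>For \<open>h = u @ [i]\<close> this spells the conjugate of the generator
  \<open>i\<close> by \<open>u\<close>. In the Cayley tree \<open>h\<close> is the path from the
  base vertex across the edge which the reflection inverts.\<close>

definition palindrome :: "nat list \<Rightarrow> nat list" where "palindrome h = h @ rev (butlast h)"

definition reflection :: "nat list \<Rightarrow> ucox" where "reflection h = elem (palindrome h)"

lemma palindrome_snoc: "palindrome (u @ [i]) = u @ [i] @ rev u"
  by (simp add: palindrome_def)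

lemma rev_palindrome: "rev (palindrome h) = palindrome h"
  by (cases h rule: rev_cases) (simp_all add: palindrome_def)

lemma length_palindrome: "length (palindrome h) = 2 * length h - 1"
  by (simp add: palindrome_def)

lemma palindrome_eq_Nil [simp]: "palindrome h = [] \<longleftrightarrow> h = []"
  by (auto simp: palindrome_def)

lemma hd_palindrome: "h \<noteq> [] \<Longrightarrow> hd (palindrome h) = hd h"
  by (simp add: palindrome_def)

lemma last_palindrome: "h \<noteq> [] \<Longrightarrow> last (palindrome h) = hd h"
  by (metis hd_palindrome hd_rev rev_palindrome)

lemma palindrome_append: "v \<noteq> [] \<Longrightarrow> palindrome (h @ v) = h @ palindrome v @ rev h"
  by (simp add: palindrome_def butlast_append)

lemma distinct_adj_palindrome: "distinct_adj h \<Longrightarrow> distinct_adj (palindrome h)"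
  by (cases h rule: rev_cases) (auto simp: palindrome_snoc distinct_adj_append_iff distinct_adj_Cons hd_rev palindrome_def[of "[]"])

lemma reflection_reflection: "reflection h * reflection h = 1"
  using elem_elem_rev[of "palindrome h"] by (simp add: reflection_def rev_palindrome)

lemma elem_rev_elem_times: "elem (rev u) * (elem u * x) = x"
  by (simp add: elem_rev_elem mult.assoc[symmetric])

lemma reflection_append: "v \<noteq> [] \<Longrightarrow> reflection (h @ v) = elem h * reflection v * elem (rev h)"
  by (simp add: reflection_def palindrome_append mult.assoc)

text \<open>A reflection exchanges the two ends of its edge. The length estimates for conjugates
  rest on this cancellation of one letter.\<close>

lemma reflection_times_elem: "h \<noteq> [] \<Longrightarrow> reflection h * elem h = elem (butlast h)"
  by (cases h rule: rev_cases) (simp_all add: reflection_def palindrome_snoc mult.assoc elem_rev_elem_times)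

lemma elem_rev_times_reflection: "h \<noteq> [] \<Longrightarrow> elem (rev h) * reflection h = elem (rev (butlast h))"
  by (cases h rule: rev_cases) (simp_all add: reflection_def palindrome_snoc mult.assoc elem_rev_elem_times)

lemma len_reflection: "distinct_adj h \<Longrightarrow> len (reflection h) = 2 * length h - 1"
  by (simp add: reflection_def len_elem distinct_adj_palindrome length_palindrome)

lemma reflection_inject:
  assumes "distinct_adj h" "h \<noteq> []" "distinct_adj k" "k \<noteq> []" "reflection h = reflection k"
  shows "h = k"
proof -
  have eq: "palindrome h = palindrome k"
    using assms letters_elem[OF distinct_adj_palindrome] by (metis reflection_def)
  have "length h = length k"
    using arg_cong[OF eq, of length] assms by (cases h; cases k; simp add: length_palindrome)
  with eq show ?thesis by (simp add: palindrome_def)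
qed

definition is_reflection :: "ucox \<Rightarrow> bool"
  where "is_reflection r \<longleftrightarrow> (\<exists>h. h \<noteq> [] \<and> distinct_adj h \<and> r = reflection h)"

lemma is_reflection_involution: "is_reflection r \<Longrightarrow> r * r = 1"
  by (auto simp: is_reflection_def reflection_reflection)

lemma is_reflection_invo: "is_reflection (invo i)"
  unfolding is_reflection_def by (rule exI[of _ "[i]"]) (simp add: reflection_def palindrome_def)

lemma is_reflection_conj_invo:
  assumes "is_reflection r"
  shows "is_reflection (invo i * r * invo i)"
proof -
  obtain h where h: "h \<noteq> []" "distinct_adj h" "r = reflection h" using assms by (auto simp: is_reflection_def)
  have mc: "reflection (i # v) = invo i * reflection v * invo i" if "v \<noteq> []" for v i
    using reflection_append[OF that, of "[i]"] by simp
  consider "hd h \<noteq> i" | "h = [i]" | v where "h = i # v" "v \<noteq> []"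
    using h(1) by (cases h) auto
  then show ?thesis
  proof cases
    case 1
    then have "distinct_adj (i # h)" using h by (simp add: distinct_adj_Cons)
    then show ?thesis using mc[OF h(1)] h(3) unfolding is_reflection_def by (metis list.distinct(1))
  next
    case 2
    then show ?thesis using assms h by (simp add: reflection_def palindrome_def)
  next
    case 3
    then show ?thesis using mc[OF 3(2), of i] h
      by (auto simp: is_reflection_def mult.assoc intro: exI[of _ v] dest: distinct_adj_ConsD)
  qed
qed

lemma is_reflection_conj:
  assumes "is_reflection a" "is_reflection r"
  shows "is_reflection (a * r * a)"
proof -
  have "is_reflection (elem u * r * elem (rev u))" for u
  proof (induction u)
    case (Cons i u)
    then show ?case using is_reflection_conj_invo[OF Cons, of i] by (simp add: mult.assoc)
  qed (use assms in simp)
  moreover obtain h where "a = reflection h" using assms by (auto simp: is_reflection_def)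
  ultimately show ?thesis by (metis reflection_def rev_palindrome)
qed

text \<open>A reflection is an edge of the Cayley tree; \<open>below a b\<close> means that the edge of \<open>a\<close>
  separates the edge of \<open>b\<close> from the base vertex.\<close>
definition below :: "ucox \<Rightarrow> ucox \<Rightarrow> bool"
  where "below a b \<longleftrightarrow>
    (\<exists>h v. h \<noteq> [] \<and> v \<noteq> [] \<and> distinct_adj (h @ v) \<and> a = reflection h \<and> b = reflection (h @ v))"

text \<open>Conjugation by \<open>a\<close> folds the path to \<open>b\<close> back across the edge
  of \<open>a\<close>: the last letter of \<open>h\<close> disappears on both sides of the
  palindrome.\<close>

lemma below_imp_shorter:
  assumes "below a b"
  shows "len (a * b * a) < len b"
proof -
  obtain h v where h: "h \<noteq> []" "v \<noteq> []" "distinct_adj (h @ v)" "a = reflection h" "b = reflection (h @ v)"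
    using assms by (auto simp: below_def)
  have "a * b * a = (reflection h * elem h) * reflection v * (elem (rev h) * reflection h)"
    using h by (simp add: reflection_append mult.assoc)
  also have "\<dots> = elem (butlast h @ palindrome v @ rev (butlast h))"
    using h by (simp add: reflection_times_elem elem_rev_times_reflection reflection_def[of v] mult.assoc)
  finally have "len (a * b * a) \<le> length (butlast h @ palindrome v @ rev (butlast h))"
    by (metis len_elem_le)
  also have "\<dots> < 2 * length (h @ v) - 1"
    using h by (cases h; cases v) (auto simp: length_palindrome)
  also have "\<dots> = len b" using h by (simp add: len_reflection)
  finally show ?thesis .
qed

text \<open>The two conjugations delete letters at different places of the path to \<open>c\<close>.
  In a hexagon this bounds the corner opposite to the peak.\<close>

lemma below_below_imp_shorter:
  assumes "below a b" "below b c"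
  shows "len (a * (b * c * b) * a) < len c"
proof -
  obtain h v where h: "h \<noteq> []" "v \<noteq> []" "distinct_adj (h @ v)" "a = reflection h" "b = reflection (h @ v)"
    using assms by (auto simp: below_def)
  obtain k w where k: "k \<noteq> []" "w \<noteq> []" "distinct_adj (k @ w)" "b = reflection k" "c = reflection (k @ w)"
    using assms by (auto simp: below_def)
  have hk: "k = h @ v" using reflection_inject[of k "h @ v"] h k by auto
  have "a * (b * c * b) * a = a * ((reflection k * elem k) * reflection w * (elem (rev k) * reflection k)) * a"
    using k by (simp add: reflection_append mult.assoc)
  also have "\<dots> = a * (elem (butlast k) * reflection w * elem (rev (butlast k))) * a"
    using k by (simp add: reflection_times_elem elem_rev_times_reflection)
  also have "butlast k = h @ butlast v" using h hk by (simp add: butlast_append)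
  also have "a * (elem (h @ butlast v) * reflection w * elem (rev (h @ butlast v))) * a
    = (reflection h * elem h) * elem (butlast v) * reflection w * elem (rev (butlast v)) * (elem (rev h) * reflection h)"
    using h by (simp add: mult.assoc)
  also have "\<dots> = elem (butlast h @ butlast v @ palindrome w @ rev (butlast v) @ rev (butlast h))"
    using h by (simp add: reflection_times_elem elem_rev_times_reflection reflection_def[of w] mult.assoc)
  finally have "len (a * (b * c * b) * a)
    \<le> length (butlast h @ butlast v @ palindrome w @ rev (butlast v) @ rev (butlast h))"
    by (metis len_elem_le)
  also have "\<dots> < 2 * length (k @ w) - 1"
    using h k hk by (cases h; cases v; cases w) (auto simp: length_palindrome)
  also have "\<dots> = len c" using k by (simp add: len_reflection)
  finally show ?thesis .
qed

lemma common_prefix_split: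
  "\<exists>m s t. h = m @ s \<and> k = m @ t \<and> (s = [] \<or> t = [] \<or> hd s \<noteq> hd t)"
proof (induction h arbitrary: k)
  case (Cons i h)
  show ?case
  proof (cases "k \<noteq> [] \<and> hd k = i")
    case True
    then obtain k' where k: "k = i # k'" by (cases k) auto
    obtain m s t where "h = m @ s" "k' = m @ t" "s = [] \<or> t = [] \<or> hd s \<noteq> hd t"
      using Cons.IH by blast
    then show ?thesis unfolding k by (intro exI[of _ "i # m"] exI[of _ s] exI[of _ t]) simp
  qed (auto intro: exI[of _ "[]"])
qed simp

text \<open>Beyond their longest common prefix \<open>m\<close> the two paths diverge, or the path
  to \<open>b\<close> has ended. In both cases the conjugate has a reduced word which contains
  \<open>palindrome s\<close> twice, where \<open>s\<close> is the nonempty rest of the path to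
  \<open>a\<close>.\<close>

lemma not_below_imp_longer:
  assumes "is_reflection a" "is_reflection b" "a \<noteq> b" "\<not> below a b"
  shows "len b < len (a * b * a)"
proof -
  obtain h k where h: "h \<noteq> []" "distinct_adj h" "a = reflection h" and k: "k \<noteq> []" "distinct_adj k" "b = reflection k"
    using assms(1,2) by (auto simp: is_reflection_def)
  obtain m s t where mst: "h = m @ s" "k = m @ t" "s = [] \<or> t = [] \<or> hd s \<noteq> hd t"
    using common_prefix_split by blast
  have s: "s \<noteq> []" using assms(3,4) h k mst by (auto simp: below_def)
  have a: "a = elem m * reflection s * elem (rev m)" using h mst s by (simp add: reflection_append)
  have ms: "distinct_adj (m @ palindrome s)" "distinct_adj (palindrome s @ rev m)"
    using distinct_adj_palindrome[OF h(2)] s unfolding mst by (auto simp: palindrome_append distinct_adj_append_iff)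
  \<comment> \<open>Here \<open>z\<close> is what remains of \<open>b\<close> between the two copies
    of \<open>palindrome s\<close>: a single letter if \<open>b\<close> lies on the path to
    \<open>a\<close>, and \<open>palindrome t\<close> otherwise.\<close>
  have "\<exists>z. a * b * a = elem (m @ palindrome s @ z @ palindrome s @ rev m) \<and>
     distinct_adj (m @ palindrome s @ z @ palindrome s @ rev m) \<and> 2 * length k - 1 \<le> 2 * length m + length z"
  proof (cases "t = []")
    case True
    define l where "l = last m"
    have m: "m = butlast m @ [l]" using k True mst by (simp add: l_def)
    have "elem (rev m) * reflection m * elem m = elem (rev (butlast m)) * elem m"
      using k(1) mst(2) True by (simp add: elem_rev_times_reflection)
    also have "\<dots> = elem (rev (butlast m)) * elem (butlast m @ [l])" using m by simp
    also have "\<dots> = invo l" by (simp add: elem_rev_elem_times)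
    finally have c: "elem (rev m) * reflection m * elem m = invo l" .
    have "a * b * a = elem m * reflection s * (elem (rev m) * reflection m * elem m) * reflection s * elem (rev m)"
      unfolding a using k mst True by (simp add: mult.assoc)
    then have "a * b * a = elem (m @ palindrome s @ [l] @ palindrome s @ rev m)"
      unfolding c by (simp add: reflection_def mult.assoc)
    moreover have "last m \<noteq> hd s" using h(2) mst(1) s k(1) mst(2) True by (auto simp: distinct_adj_append_iff)
    then have "distinct_adj (m @ palindrome s @ [l] @ palindrome s @ rev m)"
      using ms s by (auto simp: distinct_adj_append_iff distinct_adj_Cons hd_palindrome last_palindrome l_def)
    ultimately show ?thesis using mst True by (intro exI[of _ "[l]"]) simp
  next
    case False
    have "b = elem m * reflection t * elem (rev m)" using k mst False by (simp add: reflection_append)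
    then have "a * b * a = elem (m @ palindrome s @ palindrome t @ palindrome s @ rev m)"
      unfolding a by (simp add: reflection_def mult.assoc elem_rev_elem_times)
    moreover have "distinct_adj (palindrome t)" using k mst by (auto intro: distinct_adj_palindrome)
    then have "distinct_adj (m @ palindrome s @ palindrome t @ palindrome s @ rev m)"
      using ms s False mst(3) by (auto simp: distinct_adj_append_iff hd_palindrome last_palindrome)
    ultimately show ?thesis using mst False
      by (intro exI[of _ "palindrome t"]) (cases t; simp add: length_palindrome)
  qed
  then obtain z where z: "a * b * a = elem (m @ palindrome s @ z @ palindrome s @ rev m)"
    "distinct_adj (m @ palindrome s @ z @ palindrome s @ rev m)" "2 * length k - 1 \<le> 2 * length m + length z"
    by blast
  have "len b = 2 * length k - 1" using k by (simp add: len_reflection)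
  also have "\<dots> < length (m @ palindrome s @ z @ palindrome s @ rev m)"
    using z(3) s by (cases s) (simp_all add: length_palindrome)
  also have "\<dots> = len (a * b * a)" using z by (metis len_elem)
  finally show ?thesis .
qed

lemma below_or_longer:
  assumes "is_reflection a" "is_reflection b" "a \<noteq> b"
  shows "len (a * b * a) \<noteq> len b" "len (a * b * a) < len b \<Longrightarrow> below a b"
  using not_below_imp_longer[OF assms] below_imp_shorter[of a b] by fastforce+

text \<open>Both edges lie on the path to \<open>b\<close>, and prefixes of one word are linearly
  ordered.\<close>

lemma below_comparable:
  assumes "below a b" "below c b" "a \<noteq> c"
  shows "below a c \<or> below c a"
proof -
  obtain h v where h: "h \<noteq> []" "v \<noteq> []" "distinct_adj (h @ v)" "a = reflection h" "b = reflection (h @ v)"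
    using assms by (auto simp: below_def)
  obtain k w where k: "k \<noteq> []" "w \<noteq> []" "distinct_adj (k @ w)" "c = reflection k" "b = reflection (k @ w)"
    using assms by (auto simp: below_def)
  have "h @ v = k @ w" using reflection_inject[of "h @ v" "k @ w"] h k by auto
  then consider u where "h = k @ u" | u where "k = h @ u"
    by (auto simp: append_eq_append_conv2)
  then show ?thesis
  proof cases
    case 1
    then have "u \<noteq> []" using assms(3) h k by auto
    then show ?thesis using 1 h k unfolding below_def by (metis distinct_adj_appendD1)
  next
    case 2
    then have "u \<noteq> []" using assms(3) h k by auto
    then show ?thesis using 2 h k unfolding below_def by (metis distinct_adj_appendD1)
  qed
qed

text \<open>Excludes the only kind of peak which no hexagon resolves.\<close>
lemma cyc_imp_not_below_both:
  assumes "cyc 1 b (b * a)" "cyc 1 (b * a) c"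
  shows "\<not> (below b a \<and> below b c)"
proof
  assume "below b a \<and> below b c"
  then obtain h w k v where h: "h \<noteq> []" "w \<noteq> []" "distinct_adj (h @ w)" "b = reflection h" "a = reflection (h @ w)"
    and k: "k \<noteq> []" "v \<noteq> []" "distinct_adj (k @ v)" "b = reflection k" "c = reflection (k @ v)"
    by (auto simp: below_def)
  have "k = h" using reflection_inject[of k h] h k by auto
  obtain u j where u: "h = u @ [j]" using h by (cases h rule: rev_cases) auto
  \<comment> \<open>Translation by \<open>g\<close> moves the edge of \<open>b\<close> to the edge
    labelled \<open>j\<close> at the base vertex. The images of \<open>1\<close> and
    \<open>b * a\<close> lie on one side of it, those of \<open>b\<close> and \<open>c\<close> on
    the other.\<close>
  define g where "g = elem (rev u)"
  have hd_letters: "starts i (elem z) \<longleftrightarrow> z \<noteq> [] \<and> hd z = i" if "distinct_adj z" for z i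
    by (simp add: starts_def letters_elem that)
  have hw: "distinct_adj (u @ [j] @ palindrome w @ [j] @ rev u)"
    using distinct_adj_palindrome[OF h(3)] unfolding palindrome_append[OF h(2)] u by simp
  have hv: "distinct_adj (u @ [j] @ palindrome v @ [j] @ rev u)"
    using distinct_adj_palindrome[OF k(3)] unfolding palindrome_append[OF k(2)] \<open>k = h\<close> u by simp
  have d: "distinct_adj ([j] @ rev u)" "distinct_adj (palindrome w @ [j] @ rev u)" "hd (palindrome w) \<noteq> j"
    "distinct_adj ([j] @ palindrome v @ [j] @ rev u)"
    using distinct_adj_appendD2[of "u @ [j] @ palindrome w" "[j] @ rev u"]
      distinct_adj_appendD2[of "u @ [j]" "palindrome w @ [j] @ rev u"]
      distinct_adj_appendD2[of u "j # palindrome w @ [j] @ rev u"] distinct_adj_appendD2[of u] hw hv h(2)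
    by (auto simp: distinct_adj_Cons)
  have "\<not> starts j (g * 1)"
    using hw by (auto simp: g_def hd_letters distinct_adj_append_iff distinct_adj_Cons)
  moreover have "g * b = elem ([j] @ rev u)"
    using h u by (simp add: g_def reflection_def palindrome_snoc elem_rev_elem_times)
  then have "starts j (g * b)"
    by (simp only: hd_letters[OF d(1)]) simp
  moreover have "g * (b * a) = elem (palindrome w @ [j] @ rev u)"
    unfolding h(4) h(5) reflection_append[OF h(2)] unfolding u reflection_def palindrome_snoc
    by (simp add: g_def mult.assoc elem_rev_elem_times)
  then have "\<not> starts j (g * (b * a))"
    using d(3) h(2) by (simp only: hd_letters[OF d(2)]) simp
  moreover have "g * c = elem ([j] @ palindrome v @ [j] @ rev u)"
    unfolding k(5) reflection_append[OF k(2)] unfolding \<open>k = h\<close> u reflection_def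
    by (simp add: g_def mult.assoc elem_rev_elem_times)
  then have "starts j (g * c)"
    by (simp only: hd_letters[OF d(4)]) simp
  moreover have "cyc (g * 1) (g * b) (g * (b * a))" "cyc (g * 1) (g * (b * a)) (g * c)"
    using assms by (simp_all only: cyc_times)
  ultimately show False using not_interlaced by blast
qed

subsection \<open>Peak reduction\<close>

text \<open>A form of Newman's lemma for undirected graphs with a height: the branches of a peak may
  be joined by any path which stays strictly below the peak, not only by descending ones. Induction
  on the height shows that the local minimum reached by descent is unique, and then it is the same
  at both ends of every edge.\<close>

lemma peak_reduction:
  fixes m :: "'a \<Rightarrow> nat"
  assumes ne: "\<And>x y. E x y \<Longrightarrow> m x \<noteq> m y"
    and loc: "\<And>x y z. E x y \<Longrightarrow> E x z \<Longrightarrow> m y < m x \<Longrightarrow> m z < m x \<Longrightarrow>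
      (\<lambda>u v. E u v \<and> m u < m x \<and> m v < m x)\<^sup>*\<^sup>* y z"
    and sym: "\<And>x y. E x y \<Longrightarrow> E y x"
    and path: "E\<^sup>*\<^sup>* x y" and minx: "\<And>z. E x z \<Longrightarrow> m x < m z" and miny: "\<And>z. E y z \<Longrightarrow> m y < m z"
  shows "x = y"
proof -
  define R where "R u v \<longleftrightarrow> E u v \<and> m v < m u" for u v
  define nf where "nf u h \<longleftrightarrow> R\<^sup>*\<^sup>* u h \<and> (\<forall>z. \<not> R h z)" for u h
  have up: "nf u h" if "R u v" "nf v h" for u v h
    using that by (auto simp: nf_def intro: converse_rtranclp_into_rtranclp)
  have ex: "\<exists>h. nf u h" for u
  proof (induction "m u" arbitrary: u rule: less_induct)
    case less
    show ?case
    proof (cases "\<exists>z. R u z")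
      case True
      then obtain z where z: "R u z" by blast
      then obtain h where "nf z h" using less by (auto simp: R_def)
      then show ?thesis using up[OF z] by blast
    qed (auto simp: nf_def)
  qed
  \<comment> \<open>Down an edge the minimum is inherited because the upper end has no other one; up
    an edge, because descent may start with that edge.\<close>
  have step: "nf v h" if e: "E u v" and h: "nf u h" and u: "\<And>h'. nf u h' \<Longrightarrow> h' = h" for u v h
  proof (cases "m v < m u")
    case True
    obtain h' where "nf v h'" using ex by blast
    then show ?thesis using up[of u v h'] u True e by (auto simp: R_def)
  next
    case False
    then have "R v u" using e ne[OF e] sym by (auto simp: R_def)
    then show ?thesis using up h by blast
  qed
  have uniq: "h = h'" if "nf u h" "nf u h'" for u h h'
    using that
  proof (induction "m u" arbitrary: u h h' rule: less_induct)
    case less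
    consider "\<forall>z. \<not> R u z" | y z where "R u y" "nf y h" "R u z" "nf z h'"
      using less.prems unfolding nf_def by (metis converse_rtranclpE)
    then show ?case
    proof cases
      case 1
      have "a = u" if "nf u a" for a
        using that 1 unfolding nf_def by (metis converse_rtranclpE)
      then show ?thesis using less.prems by blast
    next
      case 2
      have "(\<lambda>a b. E a b \<and> m a < m u \<and> m b < m u)\<^sup>*\<^sup>* y z"
        using loc 2 by (auto simp: R_def)
      then have "nf z h"
      proof induction
        case (step a b)
        then show ?case using \<open>\<And>u v h. E u v \<Longrightarrow> nf u h \<Longrightarrow> (\<And>h'. nf u h' \<Longrightarrow> h' = h) \<Longrightarrow> nf v h\<close>
            less.hyps by metis
      qed (use 2 in simp)
      then show ?thesis using less.hyps[of z] 2 by (auto simp: R_def)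
    qed
  qed
  have "nf y h" if "nf x h" for h
    using path
  proof induction
    case (step a b)
    then show ?case
      using \<open>\<And>u v h. E u v \<Longrightarrow> nf u h \<Longrightarrow> (\<And>h'. nf u h' \<Longrightarrow> h' = h) \<Longrightarrow> nf v h\<close> uniq by metis
  qed (use that in simp)
  moreover have "nf x x" "nf y y"
    using minx miny by (fastforce simp: nf_def R_def)+
  ultimately show ?thesis using uniq by blast
qed


subsection \<open>The Hurwitz action on tuples of reflections\<close>

text \<open>An elementary braid or its inverse. On involutions both preserve the product of the two
  entries, and conjugation needs no formal inverse.\<close>

definition move :: "bool \<Rightarrow> nat \<Rightarrow> (nat \<Rightarrow> ucox) \<Rightarrow> nat \<Rightarrow> ucox" where
  "move e k T =
    (if e then T(k := T (Suc k), Suc k := T (Suc k) * T k * T (Suc k))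
     else T(k := T k * T (Suc k) * T k, Suc k := T k))"

primrec partial_prod :: "(nat \<Rightarrow> ucox) \<Rightarrow> nat \<Rightarrow> ucox" where
  "partial_prod T 0 = 1"
| "partial_prod T (Suc k) = partial_prod T k * T (Suc k)"

text \<open>The cyclic order of the partial products expresses that the arcs in the punctured disc
  which represent the reflections are disjoint.\<close>
definition noncrossing :: "nat \<Rightarrow> (nat \<Rightarrow> ucox) \<Rightarrow> bool" where
  "noncrossing n T \<longleftrightarrow> (\<forall>i\<in>{1..n}. is_reflection (T i)) \<and>
    (\<forall>k\<in>{1..<n}. cyc 1 (partial_prod T (Suc k)) (partial_prod T k))"

text \<open>Translating the hypothesis by \<open>a\<close> and by \<open>b * a\<close> gives the
  first two claims. Transitivity and a further translation give the next two, which locate the new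
  partial product of either move.\<close>

lemma cyc_pair:
  assumes "cyc 1 (a * b) a" "a * a = 1" "b * b = 1"
  shows "cyc 1 a b" "cyc 1 b (b * a)" "cyc 1 (a * b) b" "cyc 1 (a * b) (a * b * a)" "a \<noteq> b"
proof -
  have aa: "a * (a * x) = x" and bb: "b * (b * x) = x" for x
    using assms by (simp_all add: mult.assoc[symmetric])
  have "cyc a b 1" using assms(1) cyc_times[of a 1 "a * b" a] by (simp add: aa assms)
  then show 1: "cyc 1 a b" by (blast intro: cyc_rotate)
  have "cyc (b * a) 1 b"
    using assms(1) cyc_times[of "b * a" 1 "a * b" a] by (simp add: aa bb assms mult.assoc)
  then show 2: "cyc 1 b (b * a)" by (blast intro: cyc_rotate)
  show "cyc 1 (a * b) b" using cyc_trans(1)[OF assms(1) 1] .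
  have "cyc a b (b * a)" using cyc_trans(2)[OF 1 2] .
  then show "cyc 1 (a * b) (a * b * a)"
    using cyc_times[of a a b "b * a"] by (simp add: assms mult.assoc)
  show "a \<noteq> b"
    using 1 cyc_rotate[OF 1] cyc_asym by metis
qed

lemma noncrossing_cyc: "noncrossing n T \<Longrightarrow> k \<noteq> 0 \<Longrightarrow> k < n \<Longrightarrow> cyc 1 (partial_prod T (Suc k)) (partial_prod T k)"
  by (auto simp: noncrossing_def)

text \<open>Transitivity extends the condition on neighbouring partial products to a gap of two.
  Seen from the partial product at \<open>j\<close> instead of from \<open>1\<close>, it can be
  translated back into a statement on entries of the tuple.\<close>

lemma partial_prod_chain:
  assumes "noncrossing n T" "Suc j < n"
  shows "cyc (partial_prod T j) (partial_prod T (Suc (Suc j))) (partial_prod T (Suc j))"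
    "j \<noteq> 0 \<Longrightarrow> cyc 1 (partial_prod T (Suc (Suc j))) (partial_prod T j)"
proof -
  note c = noncrossing_cyc[OF assms(1)]
  have 1: "cyc 1 (partial_prod T (Suc (Suc j))) (partial_prod T (Suc j))" using c[of "Suc j"] assms by simp
  show "j \<noteq> 0 \<Longrightarrow> cyc 1 (partial_prod T (Suc (Suc j))) (partial_prod T j)"
    using cyc_trans(1)[OF 1 c[of j]] assms by simp
  show "cyc (partial_prod T j) (partial_prod T (Suc (Suc j))) (partial_prod T (Suc j))"
  \<comment> \<open>The partial product at \<open>0\<close> is the base point \<open>1\<close> of
    the order itself, so transitivity is used only for larger \<open>j\<close>.\<close>
  proof (cases "j = 0")
    case False
    then have "cyc (partial_prod T (Suc (Suc j))) (partial_prod T (Suc j)) (partial_prod T j)"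
      using cyc_trans(2)[OF 1 c[of j]] assms by simp
    then show ?thesis by (blast intro: cyc_rotate)
  qed (use 1 in simp)
qed

lemma noncrossing_pair:
  assumes "noncrossing n T" "Suc j < n"
  shows "cyc 1 (T (Suc j) * T (Suc (Suc j))) (T (Suc j))"
  using partial_prod_chain(1)[OF assms] cyc_times[of "partial_prod T j" 1]
  by (simp add: mult.assoc)

lemma noncrossing_triple:
  assumes "noncrossing n T" "Suc (Suc j) < n"
  shows "cyc 1 (T (Suc j) * T (Suc (Suc j)) * T (Suc (Suc (Suc j)))) (T (Suc j) * T (Suc (Suc j)))"
proof -
  let ?V = "partial_prod T"
  have "cyc (?V j) (?V (Suc (Suc (Suc j)))) (?V (Suc (Suc j)))"
  proof (cases "j = 0")
    case False
    have "cyc 1 (?V (Suc (Suc (Suc j)))) (?V (Suc (Suc j)))"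
      using noncrossing_cyc[OF assms(1)] assms(2) by blast
    moreover have "cyc 1 (?V (Suc (Suc j))) (?V j)" using partial_prod_chain(2)[of n T j] assms False by simp
    ultimately have "cyc (?V (Suc (Suc (Suc j)))) (?V (Suc (Suc j))) (?V j)" by (rule cyc_trans(2))
    then show ?thesis by (blast intro: cyc_rotate)
  qed (use noncrossing_cyc[OF assms(1), of "Suc (Suc j)"] assms(2) in simp)
  then show ?thesis using cyc_times[of "?V j" 1] by (simp add: mult.assoc)
qed

lemma noncrossing_involution: "noncrossing n T \<Longrightarrow> i \<in> {1..n} \<Longrightarrow> T i * T i = 1"
  by (auto simp: noncrossing_def intro: is_reflection_involution)

text \<open>Both moves preserve the product of the two entries, so only the partial product between
  them can change.\<close>

lemma partial_prod_move:
  assumes "T (Suc j) * T (Suc j) = 1" "T (Suc (Suc j)) * T (Suc (Suc j)) = 1"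
  shows "partial_prod (move e (Suc j) T) i = (if i = Suc j then partial_prod T j * move e (Suc j) T (Suc j) else partial_prod T i)"
proof -
  let ?M = "move e (Suc j) T"
  have low: "partial_prod ?M i = partial_prod T i" if "i \<le> j" for i
    using that by (induction i) (auto simp: move_def)
  have inv: "T (Suc j) * (T (Suc j) * x) = x" "T (Suc (Suc j)) * (T (Suc (Suc j)) * x) = x" for x
    using assms by (simp_all add: mult.assoc[symmetric])
  have mid: "?M (Suc j) * ?M (Suc (Suc j)) = T (Suc j) * T (Suc (Suc j))"
    by (auto simp: move_def mult.assoc inv assms)
  have other: "?M (Suc (Suc (Suc (j + d)))) = T (Suc (Suc (Suc (j + d))))" for d
    by (simp add: move_def)
  have high: "partial_prod ?M (Suc (Suc j) + d) = partial_prod T (Suc (Suc j) + d)" for d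
    by (induction d) (simp_all add: low[of j] mid mult.assoc other)
  show ?thesis
  proof (cases "i \<le> j \<or> i = Suc j")
    case False
    then have "Suc (Suc j) \<le> i" by simp
    then obtain d where "i = Suc (Suc j) + d" by (auto simp: le_iff_add)
    then show ?thesis using high[of d] by simp
  qed (use low in auto)
qed

text \<open>The one partial product which changes stays, by \<open>cyc_pair\<close>, between its two
  neighbours in the cyclic order.\<close>

lemma noncrossing_move:
  assumes "noncrossing n T" "k \<in> {1..<n}"
  shows "noncrossing n (move e k T)"
proof -
  obtain j where j: "k = Suc j" "Suc j < n" using assms(2) by (cases k) auto
  let ?a = "T (Suc j)" and ?b = "T (Suc (Suc j))" and ?V = "partial_prod T" and ?M = "move e k T"
  have inv: "?a * ?a = 1" "?b * ?b = 1"
    using noncrossing_involution[OF assms(1)] j by auto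
  have reflection: "is_reflection ?a" "is_reflection ?b" using assms j by (auto simp: noncrossing_def)
  have "is_reflection (?M i)" if "i \<in> {1..n}" for i
    using that assms j reflection by (auto simp: move_def noncrossing_def is_reflection_conj)
  moreover have "cyc 1 (partial_prod ?M (Suc i)) (partial_prod ?M i)" if i: "i \<in> {1..<n}" for i
  proof -
    have "cyc 1 (?a * ?b) (?M k)"
      using cyc_pair[OF noncrossing_pair[OF assms(1) j(2)] inv] j by (auto simp: move_def)
    then have c: "cyc (?V j) (?V (Suc (Suc j))) (?V j * ?M k)"
      using cyc_times[of "?V j" 1 "?a * ?b" "?M k"] by (simp add: mult.assoc)
    have c': "cyc 1 (?V j * ?M k) (?V j)" "cyc 1 (?V (Suc (Suc j))) (?V j * ?M k)" if "j \<noteq> 0"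
    proof -
      have "cyc (?V j) 1 (?V (Suc (Suc j)))"
        using partial_prod_chain(2)[OF assms(1) j(2) that] by (blast intro: cyc_rotate)
      from cyc_trans[OF this c] show "cyc 1 (?V j * ?M k) (?V j)" "cyc 1 (?V (Suc (Suc j))) (?V j * ?M k)"
        by (blast intro: cyc_rotate)+
    qed
    have v: "partial_prod ?M i = (if i = Suc j then ?V j * ?M k else ?V i)" for i
      using partial_prod_move[OF inv] j by simp
    consider "i = Suc j" | "Suc i = Suc j" | "i \<noteq> Suc j" "Suc i \<noteq> Suc j" by blast
    then show ?thesis
    proof cases
      case 1
      then show ?thesis using v[of i] v[of "Suc i"] c c' by (cases "j = 0") auto
    next
      case 2
      then show ?thesis using v[of i] v[of "Suc i"] c' i by auto
    next
      case 3
      then show ?thesis using v[of i] v[of "Suc i"] assms(1) i by (simp add: noncrossing_def)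
    qed
  qed
  ultimately show ?thesis by (simp add: noncrossing_def)
qed

lemma noncrossing_invo: "noncrossing n invo"
proof -
  have V: "partial_prod invo k = elem [1..<Suc k]" for k by (induction k) auto
  have "cyc 1 (partial_prod invo (Suc k)) (partial_prod invo k)" if "1 \<le> k" for k
  proof -
    \<comment> \<open>The inverse of the partial product at \<open>k\<close>. After translation by
      it the three points are one in \<open>(2k - 1, 2k + 1)\<close>, the point
      \<open>2k + 2\<close> and infinity.\<close>
    let ?g = "elem (rev [1..<Suc k])"
    obtain p q where pq: "vec (rev [1..<Suc k]) = (p, q)" by force
    have d: "distinct_adj (rev [1..<Suc k])"
      by (intro distinct_adj_rev[THEN iffD2]) (auto simp: distinct_adj_conv_nth nth_upt simp del: upt_Suc)
    have "\<bar>p - 2 * int k * q\<bar> < \<bar>q\<bar>"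
      using ping_pong[OF d pq, of k] that by simp
    then have "\<bar>q * (p - 2 * int k * q)\<bar> < q * q"
      by (metis abs_ge_zero abs_mult abs_mult_self_eq abs_not_less_zero mult_strict_left_mono zero_less_abs_iff abs_0 less_irrefl)
    then have "0 < q * (2 * (int k + 1) * q - p)"
      by (simp add: algebra_simps abs_if split: if_splits)
    then have "cyc ?g (invo (Suc k)) 1"
      unfolding cyc_def letters_elem[OF d] pq by (simp add: orient_def algebra_simps)
    then have "cyc 1 ?g (invo (Suc k))" by (blast intro: cyc_rotate)
    then have "cyc (elem [1..<Suc k] * 1) (elem [1..<Suc k] * ?g) (elem [1..<Suc k] * invo (Suc k))"
      by (simp only: cyc_times)
    then have "cyc (partial_prod invo k) 1 (partial_prod invo (Suc k))"
      by (simp only: V[symmetric] partial_prod.simps(2) mult_1_right) (simp only: V elem_elem_rev)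
    then show ?thesis by (blast intro: cyc_rotate)
  qed
  then show ?thesis by (simp add: noncrossing_def is_reflection_invo)
qed

section \<open>Total length as the height of a tuple\<close>

definition total_len :: "nat \<Rightarrow> (nat \<Rightarrow> ucox) \<Rightarrow> nat"
  where "total_len n T = (\<Sum>i\<in>{1..n}. len (T i))"

definition upd3 :: "(nat \<Rightarrow> ucox) \<Rightarrow> nat \<Rightarrow> ucox \<Rightarrow> ucox \<Rightarrow> ucox \<Rightarrow> nat \<Rightarrow> ucox"
  where "upd3 T k x y z = T(k := x, Suc k := y, Suc (Suc k) := z)"

lemma upd3_self: "upd3 T k (T k) (T (Suc k)) (T (Suc (Suc k))) = T"
  by (simp add: upd3_def)

lemma move_upd3:
  "move True k (upd3 T k x y z) = upd3 T k y (y * x * y) z"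
  "move False k (upd3 T k x y z) = upd3 T k (x * y * x) x z"
  "move True (Suc k) (upd3 T k x y z) = upd3 T k x z (z * y * z)"
  "move False (Suc k) (upd3 T k x y z) = upd3 T k x (y * z * y) y"
  by (auto simp: move_def upd3_def fun_eq_iff)

text \<open>Lengths are added on both sides because subtraction of natural numbers
  truncates.\<close>

lemma total_len_fun_upd:
  "i \<in> {1..n} \<Longrightarrow> total_len n (T(i := x)) + len (T i) = total_len n T + len x"
  by (simp add: total_len_def sum.remove[of "{1..n}" i] sum.remove[of "{Suc 0..n}" i])

lemma total_len_upd3:
  assumes "1 \<le> k" "Suc (Suc k) \<le> n"
  shows "total_len n (upd3 T k x y z) + len (T k) + len (T (Suc k)) + len (T (Suc (Suc k)))
    = total_len n T + len x + len y + len z"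
  using total_len_fun_upd[of k n T x] total_len_fun_upd[of "Suc k" n "T(k := x)" y]
    total_len_fun_upd[of "Suc (Suc k)" n "T(k := x, Suc k := y)" z] assms
  by (simp add: upd3_def)

lemma total_len_move:
  assumes "k \<in> {1..<n}"
  shows "total_len n (move e k T) + len (T k) + len (T (Suc k))
    = total_len n T + len (move e k T k) + len (move e k T (Suc k))"
  using total_len_fun_upd[of k n T "move e k T k"]
    total_len_fun_upd[of "Suc k" n "T(k := move e k T k)" "move e k T (Suc k)"] assms
  by (auto simp: move_def)

lemma below_trans:
  assumes "below a b" "below b c"
  shows "below a c"
proof -
  obtain h v where h: "h \<noteq> []" "v \<noteq> []" "distinct_adj (h @ v)" "a = reflection h" "b = reflection (h @ v)"
    using assms by (auto simp: below_def)
  obtain k w where k: "k \<noteq> []" "w \<noteq> []" "distinct_adj (k @ w)" "b = reflection k" "c = reflection (k @ w)"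
    using assms by (auto simp: below_def)
  have "k = h @ v" using reflection_inject[of k "h @ v"] h k by auto
  then have "h \<noteq> [] \<and> v @ w \<noteq> [] \<and> distinct_adj (h @ v @ w) \<and> a = reflection h \<and> c = reflection (h @ v @ w)"
    using h k by simp
  then show ?thesis unfolding below_def by blast
qed

lemma move_commute: "Suc k < l \<Longrightarrow> move e k (move f l T) = move f l (move e k T)"
  by (auto simp: move_def fun_eq_iff)

lemma move_inverse:
  assumes "T k * T k = 1" "T (Suc k) * T (Suc k) = 1"
  shows "move (\<not> e) k (move e k T) = T"
proof -
  have "T k * (T k * x) = x" "T (Suc k) * (T (Suc k) * x) = x" for x
    using assms by (simp_all add: mult.assoc[symmetric])
  then show ?thesis using assms by (cases e) (auto simp: move_def fun_eq_iff mult.assoc)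
qed

text \<open>One of the two entries is merely shifted, so the total length changes as the length of a
  single conjugated reflection does.\<close>

lemma total_len_move_iff:
  assumes "noncrossing n T" "k \<in> {1..<n}"
  shows "total_len n (move e k T) \<noteq> total_len n T"
    and "total_len n (move e k T) < total_len n T \<Longrightarrow>
      (if e then below (T (Suc k)) (T k) else below (T k) (T (Suc k)))"
proof -
  obtain j where j: "k = Suc j" "Suc j < n" using assms(2) by (cases k) auto
  have m: "is_reflection (T k)" "is_reflection (T (Suc k))" using assms by (auto simp: noncrossing_def)
  have ne: "T k \<noteq> T (Suc k)"
    using cyc_pair(5)[OF noncrossing_pair[OF assms(1) j(2)]] noncrossing_involution[OF assms(1)] j by auto
  show "total_len n (move e k T) \<noteq> total_len n T"
    using total_len_move[OF assms(2), of e T] below_or_longer(1)[OF m ne]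
      below_or_longer(1)[OF m(2,1) ne[symmetric]]
    by (auto simp: move_def split: if_splits)
  show "if e then below (T (Suc k)) (T k) else below (T k) (T (Suc k))"
    if "total_len n (move e k T) < total_len n T"
    using that total_len_move[OF assms(2), of e T] below_or_longer(2)[OF m ne]
      below_or_longer(2)[OF m(2,1) ne[symmetric]]
    by (auto simp: move_def split: if_splits)
qed

subsection \<open>Freeness of the Hurwitz action\<close>

lemma (in group) inv_cancel:
  assumes "x \<in> carrier G" "y \<in> carrier G"
  shows "inv x \<otimes> (x \<otimes> y) = y" "x \<otimes> (inv x \<otimes> y) = y"
  using assms by (simp_all add: m_assoc[symmetric])

lemma (in group) commute_inv:
  assumes "x \<in> carrier G" "y \<in> carrier G" "x \<otimes> y = y \<otimes> x"
  shows "x \<otimes> inv y = inv y \<otimes> x"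
proof -
  have "inv y \<otimes> (x \<otimes> y) \<otimes> inv y = inv y \<otimes> (y \<otimes> x) \<otimes> inv y" using assms by simp
  then show ?thesis using assms(1,2) by (simp add: m_assoc inv_cancel)
qed

lemma (in group) braid_inv:
  assumes "x \<in> carrier G" "y \<in> carrier G" "x \<otimes> y \<otimes> x = y \<otimes> x \<otimes> y"
  shows "y \<otimes> inv x \<otimes> inv y = inv x \<otimes> inv y \<otimes> x" "inv x \<otimes> y \<otimes> x = y \<otimes> x \<otimes> inv y"
    "inv x \<otimes> inv y \<otimes> inv x = inv y \<otimes> inv x \<otimes> inv y"
proof -
  show 1: "inv x \<otimes> y \<otimes> x = y \<otimes> x \<otimes> inv y"
  proof -
    have "inv x \<otimes> (x \<otimes> y \<otimes> x) \<otimes> inv y = inv x \<otimes> (y \<otimes> x \<otimes> y) \<otimes> inv y" using assms by simp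
    then show ?thesis using assms(1,2) by (simp add: m_assoc inv_cancel)
  qed
  show "y \<otimes> inv x \<otimes> inv y = inv x \<otimes> inv y \<otimes> x"
    using arg_cong[OF 1, of "\<lambda>z. inv z"] assms(1,2) by (simp add: m_assoc inv_mult_group)
  show "inv x \<otimes> inv y \<otimes> inv x = inv y \<otimes> inv x \<otimes> inv y"
    using arg_cong[OF assms(3), of "\<lambda>z. inv z"] assms(1,2) by (simp add: m_assoc inv_mult_group)
qed

fun move_along :: "(bool \<times> nat) list \<Rightarrow> (nat \<Rightarrow> ucox) \<Rightarrow> nat \<Rightarrow> ucox" where
  "move_along [] T = T"
| "move_along ((e, k) # w) T = move_along w (move e k T)"

locale braid_images = group G for G (structure) +
  fixes n :: nat and s :: "nat \<Rightarrow> 'a"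
  assumes s_closed: "k \<in> {1..<n} \<Longrightarrow> s k \<in> carrier G"
    and s_braid: "1 \<le> k \<Longrightarrow> Suc k < n \<Longrightarrow> s k \<otimes> s (Suc k) \<otimes> s k = s (Suc k) \<otimes> s k \<otimes> s (Suc k)"
    and s_commute: "1 \<le> k \<Longrightarrow> Suc k < l \<Longrightarrow> l < n \<Longrightarrow> s k \<otimes> s l = s l \<otimes> s k"
begin

definition signed_gen :: "bool \<Rightarrow> nat \<Rightarrow> 'a" where "signed_gen e k = (if e then s k else inv (s k))"

text \<open>Moves act from the right: the second component collects the generators in the order of
  the moves, so a path remembers the value of the word that produced it.\<close>

definition edge :: "(nat \<Rightarrow> ucox) \<times> 'a \<Rightarrow> (nat \<Rightarrow> ucox) \<times> 'a \<Rightarrow> bool" where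
  "edge x y \<longleftrightarrow> noncrossing n (fst x) \<and> snd x \<in> carrier G \<and>
    (\<exists>e. \<exists>k\<in>{1..<n}. y = (move e k (fst x), snd x \<otimes> signed_gen e k))"

abbreviation level :: "(nat \<Rightarrow> ucox) \<times> 'a \<Rightarrow> nat" where "level x \<equiv> total_len n (fst x)"

abbreviation edge_below :: "nat \<Rightarrow> (nat \<Rightarrow> ucox) \<times> 'a \<Rightarrow> (nat \<Rightarrow> ucox) \<times> 'a \<Rightarrow> bool"
  where "edge_below b u v \<equiv> edge u v \<and> level u < b \<and> level v < b"

lemma signed_gen_closed: "k \<in> {1..<n} \<Longrightarrow> signed_gen e k \<in> carrier G"
  by (simp add: signed_gen_def s_closed)

lemma signed_gen_inverse: "k \<in> {1..<n} \<Longrightarrow> g \<in> carrier G \<Longrightarrow> g \<otimes> signed_gen e k \<otimes> signed_gen (\<not> e) k = g"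
  by (simp add: signed_gen_def s_closed m_assoc)

lemma edge_move:
  "noncrossing n V \<Longrightarrow> v \<in> carrier G \<Longrightarrow> k \<in> {1..<n} \<Longrightarrow> edge (V, v) (move e k V, v \<otimes> signed_gen e k)"
  by (force simp: edge_def)

lemma edge_sym:
  assumes "edge x y"
  shows "edge y x"
proof -
  obtain e k where k: "k \<in> {1..<n}" "noncrossing n (fst x)" "snd x \<in> carrier G"
    "y = (move e k (fst x), snd x \<otimes> signed_gen e k)"
    using assms unfolding edge_def by blast
  have "move (\<not> e) k (move e k (fst x)) = fst x"
    using k by (intro move_inverse noncrossing_involution[OF k(2)]) auto
  then have "x = (move (\<not> e) k (fst y), snd y \<otimes> signed_gen (\<not> e) k)"
    using k signed_gen_inverse[OF k(1,3)] by (simp add: prod_eq_iff)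
  moreover have "edge y (move (\<not> e) k (fst y), snd y \<otimes> signed_gen (\<not> e) k)"
    using edge_move[of "fst y" "snd y" k "\<not> e"] k noncrossing_move[OF k(2,1)] signed_gen_closed[OF k(1)] by simp
  ultimately show ?thesis by simp
qed

lemma edge_level: "edge x y \<Longrightarrow> level x \<noteq> level y"
  using total_len_move_iff(1) by (fastforce simp: edge_def)

text \<open>The lower part of a hexagon: two edges from either end to a common corner, at which both
  the tuples and the group elements have to agree.\<close>

lemma join2:
  assumes "noncrossing n T" "noncrossing n U" "g \<in> carrier G" "h \<in> carrier G"
    and "{k1, k2, l1, l2} \<subseteq> {1..<n}"
    and "total_len n T < b" "total_len n (move e1 k1 T) < b" "total_len n (move e2 k2 (move e1 k1 T)) < b"
    and "total_len n U < b" "total_len n (move f1 l1 U) < b"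
    and "move e2 k2 (move e1 k1 T) = move f2 l2 (move f1 l1 U)"
    and "g \<otimes> signed_gen e1 k1 \<otimes> signed_gen e2 k2 = h \<otimes> signed_gen f1 l1 \<otimes> signed_gen f2 l2"
  shows "(edge_below b)\<^sup>*\<^sup>* (T, g) (U, h)"
proof -
  let ?T1 = "(move e1 k1 T, g \<otimes> signed_gen e1 k1)" and ?U1 = "(move f1 l1 U, h \<otimes> signed_gen f1 l1)"
  let ?T2 = "(move e2 k2 (move e1 k1 T), g \<otimes> signed_gen e1 k1 \<otimes> signed_gen e2 k2)"
  have gd: "noncrossing n (move e1 k1 T)" "noncrossing n (move f1 l1 U)" "g \<otimes> signed_gen e1 k1 \<in> carrier G" "h \<otimes> signed_gen f1 l1 \<in> carrier G"
    using assms by (simp_all add: noncrossing_move signed_gen_closed)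
  have 1: "edge_below b (T, g) ?T1" using edge_move[of T g k1 e1] assms by simp
  have 2: "edge_below b ?T1 ?T2" using edge_move[OF gd(1,3), of k2 e2] assms by simp
  have 3: "edge_below b ?T2 ?U1"
    using edge_sym[OF edge_move[OF gd(2,4), of l2 f2]] assms by simp
  have 4: "edge_below b ?U1 (U, h)" using edge_sym[OF edge_move[of U h l1 f1]] assms by simp
  note r = r_into_rtranclp[of "edge_below b"]
  show ?thesis
    by (rule rtranclp_trans[OF rtranclp_trans[OF rtranclp_trans[OF r[OF 1] r[OF 2]] r[OF 3]] r[OF 4]])
qed

text \<open>The signs \<open>e\<close> and \<open>f\<close> tell how \<open>b\<close> lies relative
  to \<open>a\<close> and to \<open>c\<close> in the tree. In three of the four cases the braid
  relation closes a hexagon below the peak; the fourth contradicts planarity.\<close>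

lemma local_confluence_adjacent:
  assumes T: "noncrossing n T" "g \<in> carrier G" "1 \<le> k" "Suc k < n"
    and y: "total_len n (move e k T) < total_len n T"
    and z: "total_len n (move f (Suc k) T) < total_len n T"
  shows "(edge_below (total_len n T))\<^sup>*\<^sup>* (move e k T, g \<otimes> signed_gen e k) (move f (Suc k) T, g \<otimes> signed_gen f (Suc k))"
proof -
  define a b c where abc: "a = T k" "b = T (Suc k)" "c = T (Suc (Suc k))"
  have T': "T = upd3 T k a b c" by (simp add: abc upd3_self)
  have kn: "k \<in> {1..<n}" "Suc k \<in> {1..<n}" using T by auto
  have inv: "a * a = 1" "b * b = 1" "c * c = 1"
    using noncrossing_involution[OF T(1)] T by (auto simp: abc)
  have inv': "a * (a * x) = x" "b * (b * x) = x" "c * (c * x) = x" for x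
    using inv by (simp_all add: mult.assoc[symmetric])
  note mv = move_upd3[of k T]
  have len3: "total_len n (upd3 T k x y z) + len a + len b + len c = total_len n T + len x + len y + len z"
    for x y z
    using total_len_upd3[of k n T x y z] T by (simp add: abc)
  have lt: "total_len n (upd3 T k x y z) < total_len n T" if "len x + len y + len z < len a + len b + len c"
    for x y z
    using len3[of x y z] that by linarith
  have br: "s k \<otimes> s (Suc k) \<otimes> s k = s (Suc k) \<otimes> s k \<otimes> s (Suc k)" using s_braid T by simp
  have sc: "s k \<in> carrier G" "s (Suc k) \<in> carrier G" using s_closed kn by auto
  note bri = braid_inv[OF sc br] braid_inv[OF sc(2,1) br[symmetric]]
  have ab: "if e then below b a else below a b"
    using total_len_move_iff(2)[OF T(1) kn(1) y] by (simp add: abc)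
  have bc: "if f then below c b else below b c"
    using total_len_move_iff(2)[OF T(1) kn(2) z] by (simp add: abc)
  have m0: "move True k T = upd3 T k b (b * a * b) c" "move False k T = upd3 T k (a * b * a) a c"
    "move True (Suc k) T = upd3 T k a c (c * b * c)" "move False (Suc k) T = upd3 T k a (b * c * b) b"
    unfolding abc move_upd3[of k T, symmetric] upd3_self by simp_all
  have gd: "noncrossing n (move e k T)" "noncrossing n (move f (Suc k) T)" for e f
    using noncrossing_move[OF T(1)] kn by auto
  obtain j where j: "k = Suc j" using T(3) by (cases k) auto
  have "cyc 1 (a * b) a" using noncrossing_pair[OF T(1), of j] j T(4) by (simp add: abc)
  note p = cyc_pair[OF this inv(1,2)]
  have q: "cyc 1 (a * b * c) (a * b)" using noncrossing_triple[OF T(1), of j] j T(4) by (simp add: abc)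
  consider "\<not> e" "\<not> f" | e f | "\<not> e" f | e "\<not> f" by blast
  then show ?thesis
  proof cases
    case 1
    then have *: "below a b" "below b c" using ab bc by auto
    note l = below_imp_shorter[OF *(1)] below_imp_shorter[OF *(2)]
      below_imp_shorter[OF below_trans[OF *]] below_below_imp_shorter[OF *]
    have gg: "g \<otimes> inv (s k) \<otimes> inv (s (Suc k)) \<otimes> inv (s k) = g \<otimes> inv (s (Suc k)) \<otimes> inv (s k) \<otimes> inv (s (Suc k))"
      using T(2) sc bri br by (simp add: m_assoc)
    have "(edge_below (total_len n T))\<^sup>*\<^sup>* (upd3 T k (a * b * a) a c, g \<otimes> inv (s k)) (upd3 T k a (b * c * b) b, g \<otimes> inv (s (Suc k)))"
    proof (rule join2[of _ _ _ _ "Suc k" k k "Suc k" _ False False False False])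
    qed (use gd(1)[of False, unfolded m0] gd(2)[of False, unfolded m0] T(2) sc gg kn l in \<open>simp_all add: mv mult.assoc inv inv' signed_gen_def lt\<close>)
    then show ?thesis using 1 by (simp add: m0 signed_gen_def)
  next
    case 2
    then have *: "below c b" "below b a" using ab bc by auto
    note l = below_imp_shorter[OF *(1)] below_imp_shorter[OF *(2)]
      below_imp_shorter[OF below_trans[OF *]] below_below_imp_shorter[OF *]
    have gg: "g \<otimes> s k \<otimes> s (Suc k) \<otimes> s k = g \<otimes> s (Suc k) \<otimes> s k \<otimes> s (Suc k)"
      using T(2) sc bri br by (simp add: m_assoc)
    have "(edge_below (total_len n T))\<^sup>*\<^sup>* (upd3 T k b (b * a * b) c, g \<otimes> s k) (upd3 T k a c (c * b * c), g \<otimes> s (Suc k))"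
    proof (rule join2[of _ _ _ _ "Suc k" k k "Suc k" _ True True True True])
    qed (use gd(1)[of True, unfolded m0] gd(2)[of True, unfolded m0] T(2) sc gg kn l in \<open>simp_all add: mv mult.assoc inv inv' signed_gen_def lt\<close>)
    then show ?thesis using 2 by (simp add: m0 signed_gen_def)
  next
    case 3
    then have *: "below a b" "below c b" using ab bc by auto
    \<comment> \<open>For \<open>c = a\<close> the order of the triple and the order of the pair
      would put \<open>a * b\<close> and \<open>a * b * a\<close> in opposite positions. As
      \<open>a\<close> and \<open>c\<close> both lie on the path to \<open>b\<close>, one is below
      the other, and this decides which hexagon closes.\<close>
    have "a \<noteq> c" using q p(4) cyc_asym by blast
    then consider "below a c" | "below c a" using below_comparable[OF *] by blast
    then show ?thesis
    proof cases
    case 1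
    note ** = this
    note l = below_imp_shorter[OF *(1)] below_imp_shorter[OF *(2)] below_imp_shorter[OF **] below_below_imp_shorter[OF ** *(2)]
    have gg: "g \<otimes> inv (s k) \<otimes> inv (s (Suc k)) \<otimes> s k = g \<otimes> s (Suc k) \<otimes> inv (s k) \<otimes> inv (s (Suc k))"
      using T(2) sc bri br by (simp add: m_assoc)
    have "(edge_below (total_len n T))\<^sup>*\<^sup>* (upd3 T k (a * b * a) a c, g \<otimes> inv (s k)) (upd3 T k a c (c * b * c), g \<otimes> s (Suc k))"
    proof (rule join2[of _ _ _ _ "Suc k" k k "Suc k" _ False True False False])
    qed (use gd(1)[of False, unfolded m0] gd(2)[of True, unfolded m0] T(2) sc gg kn l in \<open>simp_all add: mv mult.assoc inv inv' signed_gen_def lt\<close>)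
    then show ?thesis using \<open>\<not> e\<close> \<open>f\<close> by (simp add: m0 signed_gen_def)
    next
    case 2
    note ** = this
    note l = below_imp_shorter[OF *(1)] below_imp_shorter[OF *(2)] below_imp_shorter[OF **] below_below_imp_shorter[OF ** *(1)]
    have gg: "g \<otimes> inv (s k) \<otimes> s (Suc k) \<otimes> s k = g \<otimes> s (Suc k) \<otimes> s k \<otimes> inv (s (Suc k))"
      using T(2) sc bri br by (simp add: m_assoc)
    have "(edge_below (total_len n T))\<^sup>*\<^sup>* (upd3 T k (a * b * a) a c, g \<otimes> inv (s k)) (upd3 T k a c (c * b * c), g \<otimes> s (Suc k))"
    proof (rule join2[of _ _ _ _ "Suc k" k k "Suc k" _ True True True False])
    qed (use gd(1)[of False, unfolded m0] gd(2)[of True, unfolded m0] T(2) sc gg kn l in \<open>simp_all add: mv mult.assoc inv inv' signed_gen_def lt\<close>)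
    then show ?thesis using \<open>\<not> e\<close> \<open>f\<close> by (simp add: m0 signed_gen_def)
    qed
  next
    case 4
    then have "below b a" "below b c" using ab bc by auto
    \<comment> \<open>The translating element \<open>b * a\<close> is the inverse of
      \<open>a * b\<close>; it turns the order of the triple into one of \<open>1\<close>,
      \<open>b * a\<close> and \<open>c\<close>.\<close>
    moreover have "cyc (b * a * 1) (b * a * (a * b * c)) (b * a * (a * b))" using q by (simp only: cyc_times)
    then have "cyc 1 (b * a) c" by (auto simp: mult.assoc inv inv' intro: cyc_rotate)
    ultimately show ?thesis using cyc_imp_not_below_both[of b a c] p(2) by blast
  qed
qed

lemma signed_gen_commute:
  assumes "1 \<le> k" "Suc k < l" "l < n"
  shows "signed_gen e k \<otimes> signed_gen f l = signed_gen f l \<otimes> signed_gen e k"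
proof -
  have c: "s k \<in> carrier G" "s l \<in> carrier G" using s_closed assms by auto
  note h = s_commute[OF assms]
  have 1: "s k \<otimes> inv (s l) = inv (s l) \<otimes> s k" using commute_inv[OF c h] .
  have 2: "inv (s k) \<otimes> s l = s l \<otimes> inv (s k)" using commute_inv[OF c(2,1) h[symmetric]] by simp
  have 3: "inv (s k) \<otimes> inv (s l) = inv (s l) \<otimes> inv (s k)"
    using commute_inv[OF _ c(2) 2] c by simp
  show ?thesis using h 1 2 3 by (simp add: signed_gen_def)
qed

text \<open>Moves at distant places commute, in the tuple and in the group, so a square replaces the
  hexagon.\<close>

lemma local_confluence_less:
  assumes T: "noncrossing n T" "g \<in> carrier G" "k \<in> {1..<n}" "l \<in> {1..<n}" "k < l"
    and y: "total_len n (move e k T) < total_len n T"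
    and z: "total_len n (move f l T) < total_len n T"
  shows "(edge_below (total_len n T))\<^sup>*\<^sup>* (move e k T, g \<otimes> signed_gen e k) (move f l T, g \<otimes> signed_gen f l)"
proof (cases "l = Suc k")
  case True
  then show ?thesis using local_confluence_adjacent[OF T(1,2) _ _ y] T z by simp
next
  case False
  then have kl: "Suc k < l" using T by simp
  let ?Ty = "move e k T" and ?Tz = "move f l T"
  have gd: "noncrossing n ?Ty" "noncrossing n ?Tz" using noncrossing_move[OF T(1)] T by auto
  have c: "signed_gen e k \<in> carrier G" "signed_gen f l \<in> carrier G" using signed_gen_closed T by auto
  have com: "move f l ?Ty = move e k ?Tz" using move_commute[OF kl] by simp
  have gc: "g \<otimes> signed_gen e k \<otimes> signed_gen f l = g \<otimes> signed_gen f l \<otimes> signed_gen e k"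
    using signed_gen_commute[OF _ kl, of e f] T c by (simp add: m_assoc)
  \<comment> \<open>The second move meets the same two entries as in \<open>T\<close>, so it
    shortens by the same amount also after the first.\<close>
  have "?Ty l = T l" "?Ty (Suc l) = T (Suc l)"
    "move f l ?Ty l = ?Tz l" "move f l ?Ty (Suc l) = ?Tz (Suc l)"
    using kl by (auto simp: move_def)
  then have lt: "total_len n (move f l ?Ty) < total_len n T"
    using total_len_move[OF T(4), of f ?Ty] total_len_move[OF T(4), of f T] y z by simp
  have 1: "edge (?Ty, g \<otimes> signed_gen e k) (move f l ?Ty, g \<otimes> signed_gen e k \<otimes> signed_gen f l)"
    using edge_move[OF gd(1), of "g \<otimes> signed_gen e k" l f] T c by simp
  have 2: "edge (move f l ?Ty, g \<otimes> signed_gen e k \<otimes> signed_gen f l) (?Tz, g \<otimes> signed_gen f l)"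
    unfolding com gc using edge_sym[OF edge_move[OF gd(2), of "g \<otimes> signed_gen f l" k e]] T c by simp
  have 3: "edge_below (total_len n T) (?Ty, g \<otimes> signed_gen e k) (move f l ?Ty, g \<otimes> signed_gen e k \<otimes> signed_gen f l)"
    using 1 y lt by simp
  have 4: "edge_below (total_len n T) (move f l ?Ty, g \<otimes> signed_gen e k \<otimes> signed_gen f l) (?Tz, g \<otimes> signed_gen f l)"
    using 2 z lt by simp
  note r = r_into_rtranclp[of "edge_below (total_len n T)"]
  show ?thesis by (rule rtranclp_trans[OF r[OF 3] r[OF 4]])
qed

lemma local_confluence:
  assumes "edge x y" "edge x z" "level y < level x" "level z < level x"
  shows "(edge_below (level x))\<^sup>*\<^sup>* y z"
proof -
  obtain T g where x: "x = (T, g)" by force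
  obtain e k f l where k: "k \<in> {1..<n}" "y = (move e k T, g \<otimes> signed_gen e k)"
    and l: "l \<in> {1..<n}" "z = (move f l T, g \<otimes> signed_gen f l)" and T: "noncrossing n T" "g \<in> carrier G"
    using assms(1,2) by (auto simp: edge_def x)
  have lt: "total_len n (move e k T) < total_len n T" "total_len n (move f l T) < total_len n T"
    using assms(3,4) by (simp_all add: x k l)
  have sym: "(edge_below b)\<^sup>*\<^sup>* v u" if "(edge_below b)\<^sup>*\<^sup>* u v" for b u v
    using that by (induction rule: rtranclp_induct) (auto intro: converse_rtranclp_into_rtranclp edge_sym)
  consider "k < l" | "l < k" | "k = l" by linarith
  then show ?thesis
  proof cases
    case 1
    then show ?thesis using local_confluence_less[OF T k(1) l(1) 1 lt] by (simp add: x k l)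
  next
    case 2
    then show ?thesis using sym[OF local_confluence_less[OF T l(1) k(1) 2 lt(2,1)]] by (simp add: x k l)
  next
    case 3
    \<comment> \<open>If both directions shortened, each of the two reflections would be below the
      other.\<close>
    have "e = f"
    proof (rule ccontr)
      assume "e \<noteq> f"
      then have "below (T k) (T (Suc k))" "below (T (Suc k)) (T k)"
        using total_len_move_iff(2)[OF T(1) k(1) lt(1)] total_len_move_iff(2)[OF T(1) l(1) lt(2)] 3
        by (auto split: if_splits)
      then have "below (T k) (T k)" by (rule below_trans)
      then show False using below_imp_shorter[of "T k" "T k"] noncrossing_involution[OF T(1), of k] k(1)
        by simp
    qed
    then show ?thesis by (simp add: k l 3)
  qed
qed

text \<open>Every reflection has length at least one, so the base tuple has minimal level; the
  inequality is strict because no move keeps the level.\<close>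

lemma edge_level_base:
  assumes "edge (invo, g) z"
  shows "level (invo, g) < level z"
proof -
  have "total_len n invo \<le> total_len n T" if gT: "noncrossing n T" for T
    unfolding total_len_def
  proof (rule sum_mono)
    fix i assume "i \<in> {1..n}"
    then have "is_reflection (T i)" using gT by (simp add: noncrossing_def)
    then obtain h where "h \<noteq> []" "distinct_adj h" "T i = reflection h" by (auto simp: is_reflection_def)
    moreover have "len (invo i) = 1" by (simp add: len_def)
    ultimately show "len (invo i) \<le> len (T i)" by (cases h) (simp_all add: len_reflection)
  qed
  moreover have "noncrossing n (fst z)" using edge_sym[OF assms] by (simp add: edge_def)
  ultimately show ?thesis using edge_level[OF assms] by fastforce
qed

fun braid_val :: "(bool \<times> nat) list \<Rightarrow> 'a" where
  "braid_val [] = \<one>"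
| "braid_val ((e, k) # w) = signed_gen e k \<otimes> braid_val w"

lemma braid_val_closed: "snd ` set w \<subseteq> {1..<n} \<Longrightarrow> braid_val w \<in> carrier G"
  by (induction w rule: braid_val.induct) (auto simp del: One_nat_def intro!: m_closed signed_gen_closed)

text \<open>The word yields a path between two pairs over the base tuple. Both are local minima, so
  peak reduction identifies them, the group components included.\<close>

theorem Hurwitz_action_free:
  assumes "snd ` set w \<subseteq> {1..<n}" "move_along w invo = invo"
  shows "braid_val w = \<one>"
proof -
  have "edge\<^sup>*\<^sup>* (T, g) (move_along w T, g \<otimes> braid_val w)" if "noncrossing n T" "g \<in> carrier G" for T g
    using assms(1) that
  proof (induction w arbitrary: T g rule: braid_val.induct)
    case (2 e k w)
    have k: "k \<in> {1..<n}" "snd ` set w \<subseteq> {1..<n}" using 2 by auto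
    have "edge (T, g) (move e k T, g \<otimes> signed_gen e k)" using 2 k by (intro edge_move)
    also have "edge\<^sup>*\<^sup>* (move e k T, g \<otimes> signed_gen e k) (move_along w (move e k T), g \<otimes> signed_gen e k \<otimes> braid_val w)"
      using 2 k signed_gen_closed by (intro "2.IH") (simp_all add: noncrossing_move)
    finally show ?case using 2 k signed_gen_closed braid_val_closed by (simp add: m_assoc)
  qed simp
  from this[OF noncrossing_invo one_closed] have "edge\<^sup>*\<^sup>* (invo, \<one>) (invo, braid_val w)"
    using assms braid_val_closed by simp
  then have "(invo, \<one>) = (invo, braid_val w)"
    by (rule peak_reduction[where m = level, rotated 3])
      (use edge_level edge_sym edge_level_base local_confluence in blast)+
  then show ?thesis by simp
qed

end

subsection \<open>Homomorphisms from presented groups\<close>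

fun word_val :: "('g, 'm) monoid_scheme \<Rightarrow> ('a \<Rightarrow> 'g) \<Rightarrow> 'a word \<Rightarrow> 'g" where
  "word_val G f [] = \<one>\<^bsub>G\<^esub>"
| "word_val G f ((s, e) # w) = (if e then f s else inv\<^bsub>G\<^esub> f s) \<otimes>\<^bsub>G\<^esub> word_val G f w"

lemma words_simps [simp]:
  "[] \<in> words S" "(s, e) # w \<in> words S \<longleftrightarrow> s \<in> S \<and> w \<in> words S"
  "u @ v \<in> words S \<longleftrightarrow> u \<in> words S \<and> v \<in> words S"
  by (auto simp: words_def)

lemma words_induct [consumes 1, case_names Nil Cons]:
  assumes "w \<in> words S" "P []" "\<And>s e w. s \<in> S \<Longrightarrow> w \<in> words S \<Longrightarrow> P w \<Longrightarrow> P ((s, e) # w)"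
  shows "P w"
  using assms by (induction w) auto

lemma (in group) word_val_closed: "w \<in> words S \<Longrightarrow> f \<in> S \<rightarrow> carrier G \<Longrightarrow> word_val G f w \<in> carrier G"
  by (induction rule: words_induct) (auto intro!: m_closed inv_closed)

lemma (in group) word_val_append:
  assumes "f \<in> S \<rightarrow> carrier G" "u \<in> words S" "v \<in> words S"
  shows "word_val G f (u @ v) = word_val G f u \<otimes> word_val G f v"
  using assms(2)
proof (induction rule: words_induct)
  case (Cons s e u)
  then have "f s \<in> carrier G" using assms by auto
  then show ?case using Cons word_val_closed[OF Cons.hyps(2) assms(1)] word_val_closed[OF assms(3,1)]
    by (auto simp: m_assoc)
qed (use word_val_closed[OF assms(3,1)] in simp)

lemma (in group) word_val_pres_eq:
  assumes f: "f \<in> S \<rightarrow> carrier G" and R: "\<And>u v. (u, v) \<in> R \<Longrightarrow> word_val G f u = word_val G f v"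
    and "pres_eq S R u v"
  shows "word_val G f u = word_val G f v"
  using assms(3)
proof induction
  case (cong u v a b)
  then show ?case using pres_eq_words[OF cong.hyps(1)] by (simp add: word_val_append[OF f])
next
  case (cancel s e)
  then have "f s \<in> carrier G" using f by auto
  then show ?case by simp
qed (use R in auto)

text \<open>The value will turn out independent of the chosen representative. Restricting the domain
  makes the map extensional, as \<open>auto\<close> and \<open>is_iota\<close> demand.\<close>

definition lift_pres ::
  "'a set \<Rightarrow> ('a word \<times> 'a word) set \<Rightarrow> ('g, 'm) monoid_scheme \<Rightarrow> ('a \<Rightarrow> 'g) \<Rightarrow> 'a word set \<Rightarrow> 'g"
  where "lift_pres S R G f =
    (\<lambda>X\<in>carrier (presented_group S R). word_val G f (SOME w. w \<in> words S \<and> word_class S R w = X))"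

lemma carrier_presented_group: "carrier (presented_group S R) = word_class S R ` words S"
  by (simp add: presented_group_def)

lemma (in group) lift_pres_word_class:
  assumes f: "f \<in> S \<rightarrow> carrier G" and R: "\<And>u v. (u, v) \<in> R \<Longrightarrow> word_val G f u = word_val G f v"
    and w: "w \<in> words S"
  shows "lift_pres S R G f (word_class S R w) = word_val G f w"
proof -
  let ?v = "SOME v. v \<in> words S \<and> word_class S R v = word_class S R w"
  have "?v \<in> words S \<and> word_class S R ?v = word_class S R w"
    by (rule someI[of _ w]) (simp add: w)
  then have "pres_eq S R ?v w" using word_class_eq_iff by blast
  then show ?thesis using w word_val_pres_eq[OF f R]
    by (simp add: lift_pres_def carrier_presented_group)
qed

lemma (in group) lift_pres_hom:
  assumes f: "f \<in> S \<rightarrow> carrier G" and R: "\<And>u v. (u, v) \<in> R \<Longrightarrow> word_val G f u = word_val G f v"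
  shows "lift_pres S R G f \<in> hom (presented_group S R) G"
  using lift_pres_word_class[OF f R] word_val_append[OF f] word_val_closed[OF _ f]
  by (auto simp: hom_def carrier_presented_group mult_word_class)

lemma (in group) lift_pres_gen:
  assumes f: "f \<in> S \<rightarrow> carrier G" and R: "\<And>u v. (u, v) \<in> R \<Longrightarrow> word_val G f u = word_val G f v"
    and "s \<in> S"
  shows "lift_pres S R G f (pres_gen S R s) = f s"
proof -
  have "f s \<in> carrier G" using assms by auto
  then show ?thesis using lift_pres_word_class[OF f R, where w = "[(s, True)]"] assms(3) by (simp add: pres_gen_def)
qed

lemma pres_gen_closed: "s \<in> S \<Longrightarrow> pres_gen S R s \<in> carrier (presented_group S R)"
  by (auto simp: pres_gen_def carrier_presented_group)

lemma one_presented_group: "\<one>\<^bsub>presented_group S R\<^esub> = word_class S R []"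
  by (simp add: presented_group_def)

lemma word_class_inverse:
  assumes "s \<in> S"
  shows "word_class S R [(s, False)] = inv\<^bsub>presented_group S R\<^esub> pres_gen S R s"
proof -
  interpret P: group "presented_group S R" by (rule group_presented_group)
  have "word_class S R [(s, False)] \<otimes>\<^bsub>presented_group S R\<^esub> pres_gen S R s = \<one>\<^bsub>presented_group S R\<^esub>"
    using pres_eq.cancel[OF assms, of R False] assms
    by (simp add: pres_gen_def mult_word_class one_presented_group word_class_eq_iff)
  moreover have "word_class S R [(s, False)] \<in> carrier (presented_group S R)"
    using assms by (simp add: carrier_presented_group)
  ultimately show ?thesis using P.inv_equality pres_gen_closed[OF assms, of R] by simp
qed

lemma word_class_word_val:
  "w \<in> words S \<Longrightarrow> word_class S R w = word_val (presented_group S R) (pres_gen S R) w"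
proof (induction rule: words_induct)
  case (Cons s e w)
  have "word_class S R ((s, e) # w)
    = word_class S R [(s, e)] \<otimes>\<^bsub>presented_group S R\<^esub> word_class S R w"
    using Cons mult_word_class[of "[(s, e)]" S w R] by simp
  then show ?case using Cons by (cases e) (simp_all add: pres_gen_def word_class_inverse)
qed (simp add: one_presented_group)

lemma hom_word_val:
  assumes "group P" "group G" "h \<in> hom P G" "f \<in> S \<rightarrow> carrier P" "w \<in> words S"
  shows "h (word_val P f w) = word_val G (\<lambda>s. h (f s)) w"
proof -
  interpret P: group P by fact
  interpret h: group_hom P G h using assms by (simp add: group_hom_def group_hom_axioms_def)
  show ?thesis using assms(5)
  proof (induction rule: words_induct)
    case (Cons s e w)
    then have "f s \<in> carrier P" using assms(4) Cons by auto
    then show ?case using Cons P.word_val_closed[OF _ assms(4)] by simp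
  qed simp
qed

lemma hom_word_class:
  assumes "group G" "h \<in> hom (presented_group S R) G" "w \<in> words S"
  shows "h (word_class S R w) = word_val G (\<lambda>s. h (pres_gen S R s)) w"
  using hom_word_val[OF group_presented_group assms(1,2) _ assms(3)] assms(3)
  by (simp add: word_class_word_val pres_gen_closed)

lemma word_val_cong: "w \<in> words S \<Longrightarrow> (\<And>s. s \<in> S \<Longrightarrow> f s = g s) \<Longrightarrow> word_val G f w = word_val G g w"
  by (induction rule: words_induct) auto

lemma hom_presented_group_eq:
  assumes "group G" "h \<in> hom (presented_group S R) G" "h' \<in> hom (presented_group S R) G"
    and "\<And>s. s \<in> S \<Longrightarrow> h (pres_gen S R s) = h' (pres_gen S R s)"
    and "X \<in> carrier (presented_group S R)"
  shows "h X = h' X"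
proof -
  obtain w where w: "w \<in> words S" "X = word_class S R w"
    using assms(5) by (auto simp: carrier_presented_group)
  show ?thesis
    unfolding w(2) hom_word_class[OF assms(1,2) w(1)] hom_word_class[OF assms(1,3) w(1)]
    using assms(4) by (rule word_val_cong[OF w(1)])
qed


subsection \<open>Automorphisms\<close>

lemma AutoGroup_simps:
  "carrier (AutoGroup G) = auto G" "\<one>\<^bsub>AutoGroup G\<^esub> = (\<lambda>x\<in>carrier G. x)"
  "\<alpha> \<in> auto G \<Longrightarrow> \<beta> \<in> auto G \<Longrightarrow> \<alpha> \<otimes>\<^bsub>AutoGroup G\<^esub> \<beta> = compose (carrier G) \<alpha> \<beta>"
  by (auto simp: AutoGroup_def BijGroup_def auto_def)

lemma auto_closed: "\<alpha> \<in> auto G \<Longrightarrow> x \<in> carrier G \<Longrightarrow> \<alpha> x \<in> carrier G"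
  by (auto simp: auto_def hom_def)

lemma auto_hom: "\<alpha> \<in> auto G \<Longrightarrow> \<alpha> \<in> hom G G"
  by (simp add: auto_def)

lemma (in group) autoI:
  assumes "\<alpha> \<in> hom G G" "\<alpha> \<in> extensional (carrier G)" "\<beta> \<in> hom G G"
    and "\<And>x. x \<in> carrier G \<Longrightarrow> \<beta> (\<alpha> x) = x" "\<And>x. x \<in> carrier G \<Longrightarrow> \<alpha> (\<beta> x) = x"
  shows "\<alpha> \<in> auto G"
proof -
  have "bij_betw \<alpha> (carrier G) (carrier G)"
    using assms by (intro bij_betwI[of _ _ _ \<beta>]) (auto simp: hom_def)
  then show ?thesis using assms by (simp add: auto_def Bij_def)
qed

text \<open>Computes the abstract inverse in the automorphism group by an explicit left
  inverse.\<close>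

lemma auto_inv_apply:
  assumes "group G" "\<alpha> \<in> auto G" "\<beta> \<in> hom G G" "\<And>x. x \<in> carrier G \<Longrightarrow> \<beta> (\<alpha> x) = x" "x \<in> carrier G"
  shows "(inv\<^bsub>AutoGroup G\<^esub> \<alpha>) x = \<beta> x"
proof -
  interpret A: group "AutoGroup G" using group.AutoGroup[OF assms(1)] .
  have i: "inv\<^bsub>AutoGroup G\<^esub> \<alpha> \<in> auto G" using A.inv_closed assms(2) by (simp add: AutoGroup_simps)
  have "\<alpha> ((inv\<^bsub>AutoGroup G\<^esub> \<alpha>) x) = x"
    using fun_cong[OF A.r_inv[of \<alpha>], of x] assms i by (simp add: AutoGroup_simps compose_eq)
  then show ?thesis using assms(4)[of "(inv\<^bsub>AutoGroup G\<^esub> \<alpha>) x"] auto_closed[OF i assms(5)] by simp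
qed

subsection \<open>The representation exists and is unique\<close>

text \<open>Obtained by solving the formulas of \<open>iota_image\<close> for the basis elements, so
  that bijectivity can be checked on the basis.\<close>

definition iota_inv_image :: "nat \<Rightarrow> nat \<Rightarrow> nat \<Rightarrow> nat word set"
  where "iota_inv_image n i j =
    (let F = free_group n; x = free_gen n in
     if i = 1 then
       (if j = 1 then x 1
        else if j = n then inv\<^bsub>F\<^esub> x 1 \<otimes>\<^bsub>F\<^esub> x n \<otimes>\<^bsub>F\<^esub> x 1
        else x j \<otimes>\<^bsub>F\<^esub> x 1)
     else if i = 2 then
       (if j = 1 then x 1
        else if j = n then x n
        else x 1 \<otimes>\<^bsub>F\<^esub> x j)
     else
       (if j = i - 2 then x (i - 2) \<otimes>\<^bsub>F\<^esub> inv\<^bsub>F\<^esub> x (i - 1) \<otimes>\<^bsub>F\<^esub> x (i - 2)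
        else if j = i - 1 then x (i - 2)
        else x j))"

section \<open>The generating automorphisms and their inverses\<close>

locale type_D =
  fixes n :: nat
  assumes n3: "3 \<le> n"
begin

abbreviation "F \<equiv> free_group n"
abbreviation "x \<equiv> free_gen n"

sublocale F: group F
  unfolding free_group_def by (rule group_presented_group)

lemma x_closed [simp]: "j \<in> {1..n} \<Longrightarrow> x j \<in> carrier F"
  unfolding free_gen_def free_group_def by (rule pres_gen_closed)

definition fend :: "(nat \<Rightarrow> nat word set) \<Rightarrow> nat word set \<Rightarrow> nat word set"
  where "fend f = lift_pres {1..n} {} F f"

lemma fend:
  assumes "f \<in> {1..n} \<rightarrow> carrier F"
  shows "fend f \<in> hom F F" "fend f \<in> extensional (carrier F)" "j \<in> {1..n} \<Longrightarrow> fend f (x j) = f j"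
  unfolding fend_def free_gen_def using F.lift_pres_hom[OF assms, of "{}"] F.lift_pres_gen[OF assms, of "{}"]
  by (auto simp: free_group_def lift_pres_def)

lemma F_hom_eq:
  assumes "h \<in> hom F F" "h' \<in> hom F F" "\<And>j. j \<in> {1..n} \<Longrightarrow> h (x j) = h' (x j)" "y \<in> carrier F"
  shows "h y = h' y"
  using hom_presented_group_eq[of F h "{1..n}" "{}" h' y] assms F.is_group
  by (simp add: free_group_def free_gen_def)

lemma index_cases [consumes 1, case_names 1 2 ge_3]:
  assumes "i \<in> {1..n}"
  obtains "i = 1" | "i = 2" | k where "i = Suc (Suc k)" "1 \<le> k" "Suc (Suc k) \<le> n"
proof -
  consider "i = 1" | "i = 2" | "3 \<le> i" using assms by fastforce
  then show thesis
  proof cases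
    case 3
    then have "i = Suc (Suc (i - 2))" "1 \<le> i - 2" by auto
    then show thesis using that(3)[of "i - 2"] assms by simp
  qed (use that in auto)
qed

lemma iota_image_simps:
  "iota_image n 1 j = (if j = 1 then x 1
    else if j = n then x 1 \<otimes>\<^bsub>F\<^esub> x n \<otimes>\<^bsub>F\<^esub> inv\<^bsub>F\<^esub> x 1 else x j \<otimes>\<^bsub>F\<^esub> inv\<^bsub>F\<^esub> x 1)"
  "iota_image n 2 j = (if j = 1 then x 1 else if j = n then x n else inv\<^bsub>F\<^esub> x 1 \<otimes>\<^bsub>F\<^esub> x j)"
  "1 \<le> k \<Longrightarrow> iota_image n (Suc (Suc k)) j = (if j = k then x (Suc k)
    else if j = Suc k then x (Suc k) \<otimes>\<^bsub>F\<^esub> inv\<^bsub>F\<^esub> x k \<otimes>\<^bsub>F\<^esub> x (Suc k) else x j)"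
  "iota_image n 3 j = (if j = 1 then x 2
    else if j = 2 then x 2 \<otimes>\<^bsub>F\<^esub> inv\<^bsub>F\<^esub> x 1 \<otimes>\<^bsub>F\<^esub> x 2 else x j)"
  by (auto simp: iota_image_def Let_def numeral_2_eq_2)

lemma iota_inv_image_simps:
  "iota_inv_image n 1 j = (if j = 1 then x 1
    else if j = n then inv\<^bsub>F\<^esub> x 1 \<otimes>\<^bsub>F\<^esub> x n \<otimes>\<^bsub>F\<^esub> x 1 else x j \<otimes>\<^bsub>F\<^esub> x 1)"
  "iota_inv_image n 2 j = (if j = 1 then x 1 else if j = n then x n else x 1 \<otimes>\<^bsub>F\<^esub> x j)"
  "1 \<le> k \<Longrightarrow> iota_inv_image n (Suc (Suc k)) j =
    (if j = k then x k \<otimes>\<^bsub>F\<^esub> inv\<^bsub>F\<^esub> x (Suc k) \<otimes>\<^bsub>F\<^esub> x k else if j = Suc k then x k else x j)"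
  by (auto simp: iota_inv_image_def Let_def)

lemma iota_image_closed: "i \<in> {1..n} \<Longrightarrow> iota_image n i \<in> {1..n} \<rightarrow> carrier F"
  using n3 by (elim index_cases; intro Pi_I) (simp_all add: iota_image_simps del: One_nat_def)

lemma iota_inv_image_closed: "i \<in> {1..n} \<Longrightarrow> iota_inv_image n i \<in> {1..n} \<rightarrow> carrier F"
  using n3 by (elim index_cases; intro Pi_I) (simp_all add: iota_inv_image_simps del: One_nat_def)

definition D where "D i = fend (iota_image n i)"
definition D_inv where "D_inv i = fend (iota_inv_image n i)"

lemma D_hom: "i \<in> {1..n} \<Longrightarrow> D i \<in> hom F F"
  unfolding D_def by (rule fend(1)[OF iota_image_closed])

lemma D_inv_hom: "i \<in> {1..n} \<Longrightarrow> D_inv i \<in> hom F F"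
  unfolding D_inv_def by (rule fend(1)[OF iota_inv_image_closed])

lemma D_gen: "i \<in> {1..n} \<Longrightarrow> j \<in> {1..n} \<Longrightarrow> D i (x j) = iota_image n i j"
  unfolding D_def by (rule fend(3)[OF iota_image_closed])

lemma D_inv_gen: "i \<in> {1..n} \<Longrightarrow> j \<in> {1..n} \<Longrightarrow> D_inv i (x j) = iota_inv_image n i j"
  unfolding D_inv_def by (rule fend(3)[OF iota_inv_image_closed])

lemma hom_F:
  assumes "h \<in> hom F F" "a \<in> carrier F" 
  shows "h a \<in> carrier F" "b \<in> carrier F \<Longrightarrow> h (a \<otimes>\<^bsub>F\<^esub> b) = h a \<otimes>\<^bsub>F\<^esub> h b" "h (inv\<^bsub>F\<^esub> a) = inv\<^bsub>F\<^esub> h a"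
proof -
  interpret h: group_hom F F h using assms by (simp add: group_hom_def group_hom_axioms_def F.is_group)
  show "h a \<in> carrier F" "b \<in> carrier F \<Longrightarrow> h (a \<otimes>\<^bsub>F\<^esub> b) = h a \<otimes>\<^bsub>F\<^esub> h b" "h (inv\<^bsub>F\<^esub> a) = inv\<^bsub>F\<^esub> h a"
    using assms by auto
qed

lemmas D_simps = hom_F[OF D_hom] D_gen hom_F[OF D_inv_hom] D_inv_gen

lemmas F_simps = F.m_assoc F.inv_mult_group F.inv_cancel

lemma D_D_inv_gen:
  assumes "i \<in> {1..n}" "j \<in> {1..n}"
  shows "D i (D_inv i (x j)) = x j" "D_inv i (D i (x j)) = x j"
proof -
  from assms(1) have "D i (D_inv i (x j)) = x j \<and> D_inv i (D i (x j)) = x j"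
    by (cases rule: index_cases)
      (use assms(2) n3 in \<open>simp_all add: D_simps iota_image_simps iota_inv_image_simps F_simps del: One_nat_def\<close>)
  then show "D i (D_inv i (x j)) = x j" "D_inv i (D i (x j)) = x j" by auto
qed

lemma D_D_inv:
  assumes "i \<in> {1..n}" "y \<in> carrier F"
  shows "D i (D_inv i y) = y" "D_inv i (D i y) = y"
proof -
  have h: "(\<lambda>y. D i (D_inv i y)) \<in> hom F F" "(\<lambda>y. D_inv i (D i y)) \<in> hom F F" "(\<lambda>y. y) \<in> hom F F"
    using hom_F[OF D_hom] hom_F[OF D_inv_hom] assms by (auto simp: hom_def)
  show "D i (D_inv i y) = y"
    using F_hom_eq[OF h(1,3) _ assms(2)] D_D_inv_gen(1)[OF assms(1)] by blast
  show "D_inv i (D i y) = y"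
    using F_hom_eq[OF h(2,3) _ assms(2)] D_D_inv_gen(2)[OF assms(1)] by blast
qed

lemma D_extensional: "i \<in> {1..n} \<Longrightarrow> D i \<in> extensional (carrier F)"
  unfolding D_def by (rule fend(2)[OF iota_image_closed])

lemma D_auto: "i \<in> {1..n} \<Longrightarrow> D i \<in> auto F"
  by (rule F.autoI[OF D_hom D_extensional D_inv_hom]) (assumption | erule (1) D_D_inv)+

lemma auto_F_eqI:
  assumes "\<alpha> \<in> auto F" "\<beta> \<in> auto F" "\<And>j. j \<in> {1..n} \<Longrightarrow> \<alpha> (x j) = \<beta> (x j)"
  shows "\<alpha> = \<beta>"
proof (rule extensionalityI)
  show "\<alpha> \<in> extensional (carrier F)" "\<beta> \<in> extensional (carrier F)"
    using assms by (auto simp: auto_def Bij_def)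
qed (use F_hom_eq[of \<alpha> \<beta>] assms auto_hom in blast)

abbreviation "Aut \<equiv> AutoGroup F"

sublocale Aut: group Aut
  by (rule F.AutoGroup)

lemma Aut_apply:
  "\<alpha> \<in> carrier Aut \<Longrightarrow> \<beta> \<in> carrier Aut \<Longrightarrow> y \<in> carrier F \<Longrightarrow> (\<alpha> \<otimes>\<^bsub>Aut\<^esub> \<beta>) y = \<alpha> (\<beta> y)"
  "y \<in> carrier F \<Longrightarrow> \<one>\<^bsub>Aut\<^esub> y = y"
  by (simp_all add: AutoGroup_simps compose_eq)

lemma D_Aut: "i \<in> {1..n} \<Longrightarrow> D i \<in> carrier Aut"
  by (simp add: AutoGroup_simps D_auto)

section \<open>Artin relations between the automorphisms, checked on the basis\<close>

lemma D_commute_12: "D 1 (D 2 (x j)) = D 2 (D 1 (x j))" if "j \<in> {1..n}"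
proof -
  consider "j = 1" | "j = n" | "j \<noteq> 1" "j \<noteq> n" by blast
  then show ?thesis using that n3
    by cases (simp_all add: D_simps iota_image_simps F_simps del: One_nat_def)
qed

lemma D_commute_less_3:
  assumes "j \<in> {1..n}" "e \<in> {1, 2}" "2 \<le> k" "Suc (Suc k) \<le> n"
  shows "D e (D (Suc (Suc k)) (x j)) = D (Suc (Suc k)) (D e (x j))"
proof -
  have "j = 1 \<or> j = n \<or> j = k \<or> j = Suc k \<or> (j \<noteq> 1 \<and> j \<noteq> n \<and> j \<noteq> k \<and> j \<noteq> Suc k)" by blast
  then show ?thesis using assms
    by (elim disjE insertE emptyE conjE) (simp_all add: D_simps iota_image_simps F_simps del: One_nat_def)
qed

lemma D_commute_ge_3:
  assumes "j \<in> {1..n}" "1 \<le> k" "Suc k < l" "Suc (Suc l) \<le> n"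
  shows "D (Suc (Suc k)) (D (Suc (Suc l)) (x j)) = D (Suc (Suc l)) (D (Suc (Suc k)) (x j))"
proof -
  have "j = k \<or> j = Suc k \<or> j = l \<or> j = Suc l \<or> (j \<noteq> k \<and> j \<noteq> Suc k \<and> j \<noteq> l \<and> j \<noteq> Suc l)" by blast
  then show ?thesis using assms
    by (elim disjE conjE) (simp_all add: D_simps iota_image_simps F_simps del: One_nat_def)
qed

lemma D_braid_ge_3:
  assumes "j \<in> {1..n}" "1 \<le> k" "Suc (Suc (Suc k)) \<le> n"
  shows "D (Suc (Suc k)) (D (Suc (Suc (Suc k))) (D (Suc (Suc k)) (x j)))
    = D (Suc (Suc (Suc k))) (D (Suc (Suc k)) (D (Suc (Suc (Suc k))) (x j)))"
proof -
  have "j = k \<or> j = Suc k \<or> j = Suc (Suc k) \<or> (j \<noteq> k \<and> j \<noteq> Suc k \<and> j \<noteq> Suc (Suc k))" by blast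
  then show ?thesis using assms
    by (elim disjE conjE) (simp_all add: D_simps iota_image_simps F_simps del: One_nat_def)
qed

lemma D_braid_3:
  assumes "j \<in> {1..n}" "e \<in> {1, 2}"
  shows "D e (D 3 (D e (x j))) = D 3 (D e (D 3 (x j)))"
proof -
  have "j = 1 \<or> j = n \<or> j = 2 \<or> (j \<noteq> 1 \<and> j \<noteq> n \<and> j \<noteq> 2)" by blast
  then show ?thesis using assms n3
    by (elim disjE insertE emptyE conjE) (simp_all add: D_simps iota_image_simps F_simps del: One_nat_def)
qed

lemma D_edges_cases:
  assumes "i \<in> {1..n}" "j \<in> {1..n}" "{i, j} \<in> D_edges n"
  obtains "{i, j} = {1, 3}" | "{i, j} = {2, 3}"
    | k where "{i, j} = {Suc (Suc k), Suc (Suc (Suc k))}" "1 \<le> k" "Suc (Suc (Suc k)) \<le> n"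
proof -
  consider "{i, j} = {1, 3}" | "{i, j} = {2, 3}" | l where "{i, j} = {l, l + 1}" "3 \<le> l" "l + 1 \<le> n"
    using assms(3) unfolding D_edges_def by blast
  then show thesis
  proof cases
    case (3 l)
    then have "l = Suc (Suc (l - 2))" "1 \<le> l - 2" by auto
    then show thesis using that(3)[of "l - 2"] 3 by simp
  qed (use that in blast)+
qed

lemma D_braid:
  assumes "i \<in> {1..n}" "j \<in> {1..n}" "{i, j} \<in> D_edges n" "m \<in> {1..n}"
  shows "D i (D j (D i (x m))) = D j (D i (D j (x m)))"
  using assms(1-3)
proof (cases rule: D_edges_cases)
  case 1
  then show ?thesis using D_braid_3[OF assms(4), of 1] by (auto simp: doubleton_eq_iff)
next
  case 2
  then show ?thesis using D_braid_3[OF assms(4), of 2] by (auto simp: doubleton_eq_iff)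
next
  case (3 k)
  then show ?thesis using D_braid_ge_3[OF assms(4), of k] by (auto simp: doubleton_eq_iff)
qed

lemma D_edges_mem:
  "{1, 3} \<in> D_edges n" "{2, 3} \<in> D_edges n"
  "1 \<le> k \<Longrightarrow> Suc (Suc (Suc k)) \<le> n \<Longrightarrow> {Suc (Suc k), Suc (Suc (Suc k))} \<in> D_edges n"
  by (force simp: D_edges_def)+

lemma D_commute:
  assumes "i \<in> {1..n}" "j \<in> {1..n}" "{i, j} \<notin> D_edges n" "m \<in> {1..n}"
  shows "D i (D j (x m)) = D j (D i (x m))"
proof -
  have w: "D i (D j (x m)) = D j (D i (x m))"
    if "i \<in> {1..n}" "j \<in> {1..n}" "{i, j} \<notin> D_edges n" "i < j" for i j
    using that(2)
  proof (cases rule: index_cases)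
    case 1
    then show ?thesis using that by simp
  next
    case 2
    then have "i = 1" using that by simp
    then show ?thesis using 2 D_commute_12[OF assms(4)] by simp
  next
    case (ge_3 l)
    note l = this
    show ?thesis using that(1)
    proof (cases rule: index_cases)
      case 1
      then have "l \<noteq> 1" using that l D_edges_mem(1,2) by (auto simp: numeral_3_eq_3 numeral_2_eq_2)
      then show ?thesis using D_commute_less_3[OF assms(4), of 1 l] 1 l by simp
    next
      case 2
      then have "l \<noteq> 1" using that l D_edges_mem(1,2) by (auto simp: numeral_3_eq_3 numeral_2_eq_2)
      then show ?thesis using D_commute_less_3[OF assms(4), of 2 l] 2 l by simp
    next
      case (ge_3 k)
      then have "Suc k < l" using that l D_edges_mem(3)[of k] by (cases "l = Suc k") auto
      then show ?thesis using D_commute_ge_3[OF assms(4), of k l] ge_3 l by simp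
    qed
  qed
  have "i < j \<or> j < i \<or> i = j" by linarith
  then show ?thesis using w[of i j] w[of j i] assms by (auto simp: insert_commute)
qed

lemma D_relation:
  assumes "(u, v) \<in> artin_D_relations n"
  shows "word_val Aut D u = word_val Aut D v"
proof -
  have aut: "\<alpha> \<in> carrier Aut \<Longrightarrow> \<beta> \<in> carrier Aut \<Longrightarrow> (\<And>m. m \<in> {1..n} \<Longrightarrow> \<alpha> (x m) = \<beta> (x m)) \<Longrightarrow> \<alpha> = \<beta>"
    for \<alpha> \<beta>
    using auto_F_eqI by (simp add: AutoGroup_simps)
  consider i j where "i \<in> {1..n}" "j \<in> {1..n}" "{i, j} \<in> D_edges n"
      "u = [(i, True), (j, True), (i, True)]" "v = [(j, True), (i, True), (j, True)]"
    | i j where "i \<in> {1..n}" "j \<in> {1..n}" "{i, j} \<notin> D_edges n"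
      "u = [(i, True), (j, True)]" "v = [(j, True), (i, True)]"
    using assms unfolding artin_D_relations_def by blast
  then show ?thesis
  proof cases
    case 1
    then show ?thesis
      using D_braid[OF 1(1-3)] D_Aut[OF 1(1)] D_Aut[OF 1(2)] hom_F(1)[OF D_hom]
      by (intro aut) (simp_all add: Aut_apply del: One_nat_def)
  next
    case 2
    then show ?thesis
      using D_commute[OF 2(1-3)] D_Aut[OF 2(1)] D_Aut[OF 2(2)] hom_F(1)[OF D_hom]
      by (intro aut) (simp_all add: Aut_apply del: One_nat_def)
  qed
qed

lemma ex1_iota: "\<exists>!\<iota>. is_iota n \<iota>"
proof (rule ex_ex1I)
  let ?\<iota> = "lift_pres {1..n} (artin_D_relations n) Aut D"
  have f: "D \<in> {1..n} \<rightarrow> carrier Aut" using D_Aut by blast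
  have "is_iota n ?\<iota>"
    unfolding is_iota_def artin_D_def artin_D_gen_def
    using Aut.lift_pres_hom[OF f D_relation] Aut.lift_pres_gen[OF f D_relation] D_gen
    by (simp add: lift_pres_def del: One_nat_def)
  then show "\<exists>\<iota>. is_iota n \<iota>" by blast
next
  fix \<iota> \<iota>'
  assume i: "is_iota n \<iota>" "is_iota n \<iota>'"
  have gen: "\<iota> (artin_D_gen n s) = \<iota>' (artin_D_gen n s)" if "s \<in> {1..n}" for s
  proof (rule auto_F_eqI)
    have "artin_D_gen n s \<in> carrier (artin_D n)"
      using that unfolding artin_D_gen_def artin_D_def by (rule pres_gen_closed)
    then show "\<iota> (artin_D_gen n s) \<in> auto F" "\<iota>' (artin_D_gen n s) \<in> auto F"
      using i by (auto simp: is_iota_def hom_def AutoGroup_simps)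
  qed (use i that in \<open>simp add: is_iota_def\<close>)
  show "\<iota> = \<iota>'"
  proof (rule extensionalityI)
    show "\<iota> \<in> extensional (carrier (artin_D n))" "\<iota>' \<in> extensional (carrier (artin_D n))"
      using i by (auto simp: is_iota_def)
    show "\<iota> X = \<iota>' X" if "X \<in> carrier (artin_D n)" for X
      using hom_presented_group_eq[OF Aut.is_group, of \<iota> "{1..n}" "artin_D_relations n" \<iota>' X] i gen that
      by (simp add: is_iota_def artin_D_def artin_D_gen_def)
  qed
qed

end

lemma (in group) conj_mult:
  assumes "g \<in> carrier G" "y \<in> carrier G" "z \<in> carrier G"
  shows "g \<otimes> (y \<otimes> z) \<otimes> inv g = (g \<otimes> y \<otimes> inv g) \<otimes> (g \<otimes> z \<otimes> inv g)"
  using assms by (simp add: m_assoc inv_cancel)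

lemma (in group) conj_inv:
  assumes "g \<in> carrier G" "y \<in> carrier G"
  shows "g \<otimes> inv y \<otimes> inv g = inv (g \<otimes> y \<otimes> inv g)"
  using assms by (simp add: m_assoc inv_mult_group)

lemma (in group) conj_eqD:
  assumes "g \<in> carrier G" "y \<in> carrier G" "z \<in> carrier G" "g \<otimes> y = z \<otimes> g"
  shows "g \<otimes> y \<otimes> inv g = z"
  using assms by (simp add: m_assoc)

lemma (in group) conj_mult_left:
  assumes "g \<in> carrier G" "h \<in> carrier G" "y \<in> carrier G"
  shows "(g \<otimes> h) \<otimes> y \<otimes> inv (g \<otimes> h) = g \<otimes> (h \<otimes> y \<otimes> inv h) \<otimes> inv g"
  using assms by (simp add: m_assoc inv_mult_group)

lemma (in group) conj_cancel:
  assumes "g \<in> carrier G" "y \<in> carrier G"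
  shows "inv g \<otimes> (g \<otimes> y \<otimes> inv g) \<otimes> g = y" "g \<otimes> (inv g \<otimes> y \<otimes> g) \<otimes> inv g = y"
  using assms by (simp_all add: m_assoc inv_cancel)

context type_D
begin

subsection \<open>A normal free subgroup\<close>

abbreviation "A \<equiv> artin_D n"
abbreviation "d \<equiv> artin_D_gen n"

sublocale A: group A
  unfolding artin_D_def by (rule group_presented_group)

lemma d_closed: "i \<in> {1..n} \<Longrightarrow> d i \<in> carrier A"
  unfolding artin_D_gen_def artin_D_def by (rule pres_gen_closed)

lemma A_relation:
  assumes "(u, v) \<in> artin_D_relations n" "u \<in> words {1..n}" "v \<in> words {1..n}"
  shows "word_val A d u = word_val A d v"
  unfolding artin_D_def artin_D_gen_def
    word_class_word_val[OF assms(2), symmetric] word_class_word_val[OF assms(3), symmetric]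
    word_class_eq_iff[OF assms(2)]
  by (rule pres_eq.relation[OF assms])

lemma d_braid:
  assumes "i \<in> {1..n}" "j \<in> {1..n}" "{i, j} \<in> D_edges n"
  shows "d i \<otimes>\<^bsub>A\<^esub> d j \<otimes>\<^bsub>A\<^esub> d i = d j \<otimes>\<^bsub>A\<^esub> d i \<otimes>\<^bsub>A\<^esub> d j"
proof -
  have "([(i, True), (j, True), (i, True)], [(j, True), (i, True), (j, True)]) \<in> artin_D_relations n"
    using assms unfolding artin_D_relations_def by blast
  from A_relation[OF this] show ?thesis using assms d_closed by (simp add: A.m_assoc)
qed

lemma d_commute:
  assumes "i \<in> {1..n}" "j \<in> {1..n}" "{i, j} \<notin> D_edges n"
  shows "d i \<otimes>\<^bsub>A\<^esub> d j = d j \<otimes>\<^bsub>A\<^esub> d i"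
proof -
  have "([(i, True), (j, True)], [(j, True), (i, True)]) \<in> artin_D_relations n"
    using assms unfolding artin_D_relations_def by blast
  from A_relation[OF this] show ?thesis using assms d_closed by simp
qed

lemma not_D_edges:
  "{1, 2} \<notin> D_edges n"
  "2 \<le> k \<Longrightarrow> {1, Suc (Suc k)} \<notin> D_edges n"
  "2 \<le> k \<Longrightarrow> {2, Suc (Suc k)} \<notin> D_edges n"
  "1 \<le> k \<Longrightarrow> Suc k < l \<Longrightarrow> {Suc (Suc k), Suc (Suc l)} \<notin> D_edges n"
  by (auto simp: D_edges_def doubleton_eq_iff)

abbreviation ee where "ee k \<equiv> d (Suc (Suc k))"

lemma ee_closed: "Suc (Suc k) \<le> n \<Longrightarrow> ee k \<in> carrier A"
  by (rule d_closed) simp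

lemma d1_closed: "d 1 \<in> carrier A" and d2_closed: "d 2 \<in> carrier A"
  using n3 by (auto intro: d_closed)

fun a :: "nat \<Rightarrow> nat word set" where
  "a 0 = \<one>\<^bsub>A\<^esub>"
| "a (Suc 0) = d 1 \<otimes>\<^bsub>A\<^esub> inv\<^bsub>A\<^esub> d 2"
| "a (Suc (Suc k)) = ee (Suc k) \<otimes>\<^bsub>A\<^esub> a (Suc k) \<otimes>\<^bsub>A\<^esub> inv\<^bsub>A\<^esub> ee (Suc k)"

lemma a_closed: "m < n \<Longrightarrow> a m \<in> carrier A"
  by (induction m rule: a.induct) (auto simp: d1_closed d2_closed ee_closed simp del: One_nat_def)

lemma ee_a: "1 \<le> k \<Longrightarrow> Suc k < n \<Longrightarrow> ee k \<otimes>\<^bsub>A\<^esub> a k \<otimes>\<^bsub>A\<^esub> inv\<^bsub>A\<^esub> ee k = a (Suc k)"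
  by (cases k) auto

definition fixes_conj where "fixes_conj g y \<longleftrightarrow> g \<otimes>\<^bsub>A\<^esub> y \<otimes>\<^bsub>A\<^esub> inv\<^bsub>A\<^esub> g = y"

lemma fixes_conjI:
  "g \<in> carrier A \<Longrightarrow> y \<in> carrier A \<Longrightarrow> g \<otimes>\<^bsub>A\<^esub> y = y \<otimes>\<^bsub>A\<^esub> g \<Longrightarrow> fixes_conj g y"
  unfolding fixes_conj_def by (rule A.conj_eqD)

lemma fixes_conj_mult:
  "g \<in> carrier A \<Longrightarrow> y \<in> carrier A \<Longrightarrow> z \<in> carrier A \<Longrightarrow> fixes_conj g y \<Longrightarrow> fixes_conj g z
    \<Longrightarrow> fixes_conj g (y \<otimes>\<^bsub>A\<^esub> z)"
  unfolding fixes_conj_def by (simp only: A.conj_mult)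

lemma fixes_conj_inv:
  "g \<in> carrier A \<Longrightarrow> y \<in> carrier A \<Longrightarrow> fixes_conj g y \<Longrightarrow> fixes_conj g (inv\<^bsub>A\<^esub> y)"
  unfolding fixes_conj_def by (simp only: A.conj_inv)

lemma fixes_conj_d:
  "i \<in> {1..n} \<Longrightarrow> j \<in> {1..n} \<Longrightarrow> {i, j} \<notin> D_edges n \<Longrightarrow> fixes_conj (d i) (d j)"
  by (intro fixes_conjI d_commute d_closed)

text \<open>The element \<open>a m\<close> is a word in \<open>d 1, ..., d (Suc m)\<close>, and all
  of these commute with \<open>ee k\<close>.\<close>

lemma ee_fixes_a_below:
  assumes "1 \<le> m" "m < k" "Suc k < n"
  shows "fixes_conj (ee k) (a m)"
  using assms(1,2)
proof (induction m rule: a.induct)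
  case 2
  have k: "2 \<le> k" using 2 by simp
  have "{Suc (Suc k), 1} \<notin> D_edges n" "{Suc (Suc k), 2} \<notin> D_edges n"
    using not_D_edges(2,3)[OF k] by (simp_all add: insert_commute)
  moreover have "Suc (Suc k) \<in> {1..n}" "1 \<in> {1..n}" "2 \<in> {1..n}" using assms(3) n3 by simp_all
  ultimately have "fixes_conj (ee k) (d 1)" "fixes_conj (ee k) (d 2)"
    using fixes_conj_d by blast+
  then show ?case using d1_closed d2_closed ee_closed[of k] assms(3)
    by (simp add: fixes_conj_mult fixes_conj_inv)
next
  case (3 j)
  have "fixes_conj (ee k) (ee (Suc j))"
    using 3 assms not_D_edges(4)[of "Suc j" k]
    by (intro fixes_conj_d) (auto simp: insert_commute)
  then show ?case using 3 ee_closed[of k] ee_closed[of "Suc j"] a_closed[of "Suc j"] assms(3)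
    by (simp add: fixes_conj_mult fixes_conj_inv)
qed simp

lemma ee_braid:
  assumes "1 \<le> k" "Suc (Suc k) < n"
  shows "ee k \<otimes>\<^bsub>A\<^esub> ee (Suc k) \<otimes>\<^bsub>A\<^esub> ee k = ee (Suc k) \<otimes>\<^bsub>A\<^esub> ee k \<otimes>\<^bsub>A\<^esub> ee (Suc k)"
  using assms D_edges_mem(3)[of k] by (intro d_braid) auto

text \<open>The critical index is \<open>m = k + 2\<close>. There \<open>a m\<close> is the
  conjugate of \<open>a k\<close> by \<open>ee (Suc k)\<close> times \<open>ee k\<close>; the braid
  relation carries \<open>ee k\<close> through this product as \<open>ee (Suc k)\<close>, which
  fixes \<open>a k\<close>.\<close>

lemma ee_fixes_a_above:
  assumes "1 \<le> k" "Suc k < m" "m < n"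
  shows "fixes_conj (ee k) (a m)"
  using assms(2,3)
proof (induction m rule: a.induct)
  case (3 j)
  have c: "ee k \<in> carrier A" "ee (Suc j) \<in> carrier A" "a (Suc j) \<in> carrier A" "a k \<in> carrier A"
    using 3 ee_closed[of k] ee_closed[of "Suc j"] a_closed[of "Suc j"] a_closed[of k] by simp_all
  show ?case
  proof (cases "j = k")
    case True
    have "fixes_conj (ee (Suc k)) (a k)"
      using ee_fixes_a_below[of k "Suc k"] assms(1) 3 True by simp
    then have fx: "ee (Suc k) \<otimes>\<^bsub>A\<^esub> a k \<otimes>\<^bsub>A\<^esub> inv\<^bsub>A\<^esub> ee (Suc k) = a k" by (simp add: fixes_conj_def)
    have e: "a (Suc k) = ee k \<otimes>\<^bsub>A\<^esub> a k \<otimes>\<^bsub>A\<^esub> inv\<^bsub>A\<^esub> ee k" using ee_a assms(1) 3 True by simp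
    have br: "ee k \<otimes>\<^bsub>A\<^esub> (ee (Suc k) \<otimes>\<^bsub>A\<^esub> ee k) = (ee (Suc k) \<otimes>\<^bsub>A\<^esub> ee k) \<otimes>\<^bsub>A\<^esub> ee (Suc k)"
      using ee_braid[of k] assms(1) 3 True c by (simp add: A.m_assoc)
    let ?h = "ee (Suc k) \<otimes>\<^bsub>A\<^esub> ee k"
    have a2: "a (Suc (Suc k)) = ?h \<otimes>\<^bsub>A\<^esub> a k \<otimes>\<^bsub>A\<^esub> inv\<^bsub>A\<^esub> ?h"
      using c True by (simp only: a.simps e A.conj_mult_left)
    have h: "?h \<in> carrier A" "ee (Suc k) \<in> carrier A" using c True by auto
    have "ee k \<otimes>\<^bsub>A\<^esub> a (Suc (Suc k)) \<otimes>\<^bsub>A\<^esub> inv\<^bsub>A\<^esub> ee k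
      = (ee k \<otimes>\<^bsub>A\<^esub> ?h) \<otimes>\<^bsub>A\<^esub> a k \<otimes>\<^bsub>A\<^esub> inv\<^bsub>A\<^esub> (ee k \<otimes>\<^bsub>A\<^esub> ?h)"
      unfolding a2 using c h by (simp only: A.conj_mult_left)
    also have "\<dots> = ?h \<otimes>\<^bsub>A\<^esub> a k \<otimes>\<^bsub>A\<^esub> inv\<^bsub>A\<^esub> ?h"
      unfolding br using c h fx by (simp only: A.conj_mult_left)
    finally show ?thesis unfolding a2[symmetric] fixes_conj_def True .
  next
    case False
    then have "fixes_conj (ee k) (ee (Suc j))"
      using 3 assms(1) not_D_edges(4)[of k "Suc j"] by (intro fixes_conj_d) auto
    then show ?thesis using 3 False c by (simp add: fixes_conj_mult fixes_conj_inv)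
  qed
qed auto

text \<open>The counterpart in the Artin group of the value of \<open>iota_image\<close> at
  \<open>x (Suc k)\<close>. Only the base case computes with \<open>d 1\<close> and
  \<open>d 2\<close>; a conjugation raises all indices in the induction step.\<close>

lemma ee_a_Suc:
  assumes "1 \<le> k" "Suc k < n"
  shows "ee k \<otimes>\<^bsub>A\<^esub> a (Suc k) \<otimes>\<^bsub>A\<^esub> inv\<^bsub>A\<^esub> ee k = a (Suc k) \<otimes>\<^bsub>A\<^esub> inv\<^bsub>A\<^esub> a k \<otimes>\<^bsub>A\<^esub> a (Suc k)"
  using assms
proof (induction k rule: nat_induct_at_least)
  case base
  define p q t where pqt: "p = d 1" "q = d 2" "t = d 3"
  have c: "p \<in> carrier A" "q \<in> carrier A" "t \<in> carrier A" using n3 d_closed by (auto simp: pqt)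
  have pt: "p \<otimes>\<^bsub>A\<^esub> t \<otimes>\<^bsub>A\<^esub> p = t \<otimes>\<^bsub>A\<^esub> p \<otimes>\<^bsub>A\<^esub> t" and qt: "q \<otimes>\<^bsub>A\<^esub> t \<otimes>\<^bsub>A\<^esub> q = t \<otimes>\<^bsub>A\<^esub> q \<otimes>\<^bsub>A\<^esub> t"
    and pq: "p \<otimes>\<^bsub>A\<^esub> q = q \<otimes>\<^bsub>A\<^esub> p"
    unfolding pqt by (rule d_braid d_commute; use n3 D_edges_mem not_D_edges in simp)+
  have a1: "a 1 = p \<otimes>\<^bsub>A\<^esub> inv\<^bsub>A\<^esub> q" and a2: "a (Suc 1) = t \<otimes>\<^bsub>A\<^esub> a 1 \<otimes>\<^bsub>A\<^esub> inv\<^bsub>A\<^esub> t"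
    by (simp_all add: pqt numeral_3_eq_3)
  have e1: "ee 1 = t" by (simp add: pqt numeral_3_eq_3)
  have 1: "inv\<^bsub>A\<^esub> p \<otimes>\<^bsub>A\<^esub> t \<otimes>\<^bsub>A\<^esub> p = t \<otimes>\<^bsub>A\<^esub> p \<otimes>\<^bsub>A\<^esub> inv\<^bsub>A\<^esub> t" using A.braid_inv(2)[OF c(1,3) pt] .
  have 2: "inv\<^bsub>A\<^esub> q \<otimes>\<^bsub>A\<^esub> inv\<^bsub>A\<^esub> t \<otimes>\<^bsub>A\<^esub> q = t \<otimes>\<^bsub>A\<^esub> inv\<^bsub>A\<^esub> q \<otimes>\<^bsub>A\<^esub> inv\<^bsub>A\<^esub> t"
    using A.braid_inv(1)[OF c(2,3) qt] by simp
  have 3: "inv\<^bsub>A\<^esub> q \<otimes>\<^bsub>A\<^esub> inv\<^bsub>A\<^esub> t \<otimes>\<^bsub>A\<^esub> inv\<^bsub>A\<^esub> q = inv\<^bsub>A\<^esub> t \<otimes>\<^bsub>A\<^esub> inv\<^bsub>A\<^esub> q \<otimes>\<^bsub>A\<^esub> inv\<^bsub>A\<^esub> t"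
    using A.braid_inv(3)[OF c(2,3) qt] .
  have 4: "p \<otimes>\<^bsub>A\<^esub> inv\<^bsub>A\<^esub> q = inv\<^bsub>A\<^esub> q \<otimes>\<^bsub>A\<^esub> p" using A.commute_inv[OF c(1,2) pq] .
  let ?a = "p \<otimes>\<^bsub>A\<^esub> inv\<^bsub>A\<^esub> q"
  \<comment> \<open>With \<open>a 2\<close> expanded, both sides of the claim are conjugates by
    \<open>t\<close>; this chain proves the equation inside that conjugation.\<close>
  have "?a \<otimes>\<^bsub>A\<^esub> inv\<^bsub>A\<^esub> t \<otimes>\<^bsub>A\<^esub> inv\<^bsub>A\<^esub> ?a \<otimes>\<^bsub>A\<^esub> t \<otimes>\<^bsub>A\<^esub> ?a
    = p \<otimes>\<^bsub>A\<^esub> (inv\<^bsub>A\<^esub> q \<otimes>\<^bsub>A\<^esub> inv\<^bsub>A\<^esub> t \<otimes>\<^bsub>A\<^esub> q) \<otimes>\<^bsub>A\<^esub> (inv\<^bsub>A\<^esub> p \<otimes>\<^bsub>A\<^esub> t \<otimes>\<^bsub>A\<^esub> p) \<otimes>\<^bsub>A\<^esub> inv\<^bsub>A\<^esub> q"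
    using c by (simp add: A.m_assoc A.inv_mult_group)
  also have "\<dots> = p \<otimes>\<^bsub>A\<^esub> t \<otimes>\<^bsub>A\<^esub> (inv\<^bsub>A\<^esub> q \<otimes>\<^bsub>A\<^esub> p) \<otimes>\<^bsub>A\<^esub> inv\<^bsub>A\<^esub> t \<otimes>\<^bsub>A\<^esub> inv\<^bsub>A\<^esub> q"
    unfolding 1 2 using c by (simp add: A.m_assoc A.inv_cancel)
  also have "\<dots> = (p \<otimes>\<^bsub>A\<^esub> t \<otimes>\<^bsub>A\<^esub> p) \<otimes>\<^bsub>A\<^esub> (inv\<^bsub>A\<^esub> q \<otimes>\<^bsub>A\<^esub> inv\<^bsub>A\<^esub> t \<otimes>\<^bsub>A\<^esub> inv\<^bsub>A\<^esub> q)"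
    unfolding 4[symmetric] using c by (simp add: A.m_assoc)
  also have "\<dots> = t \<otimes>\<^bsub>A\<^esub> ?a \<otimes>\<^bsub>A\<^esub> inv\<^bsub>A\<^esub> t"
    unfolding pt 3 using c by (simp add: A.m_assoc A.inv_cancel)
  finally have k: "t \<otimes>\<^bsub>A\<^esub> ?a \<otimes>\<^bsub>A\<^esub> inv\<^bsub>A\<^esub> t = ?a \<otimes>\<^bsub>A\<^esub> inv\<^bsub>A\<^esub> t \<otimes>\<^bsub>A\<^esub> inv\<^bsub>A\<^esub> ?a \<otimes>\<^bsub>A\<^esub> t \<otimes>\<^bsub>A\<^esub> ?a" ..
  show ?case unfolding a2 e1 a1
    using arg_cong[OF k, of "\<lambda>z. t \<otimes>\<^bsub>A\<^esub> z \<otimes>\<^bsub>A\<^esub> inv\<^bsub>A\<^esub> t"] c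
    by (simp add: A.m_assoc A.inv_mult_group)
next
  case (Suc k)
  have c: "ee k \<in> carrier A" "ee (Suc k) \<in> carrier A" "a k \<in> carrier A" "a (Suc k) \<in> carrier A"
     "a (Suc (Suc k)) \<in> carrier A"
    using Suc.prems Suc.hyps ee_closed[of k] ee_closed[of "Suc k"] a_closed by simp_all
  \<comment> \<open>Conjugation by \<open>?g\<close> takes \<open>a k\<close>,
    \<open>a (Suc k)\<close> and \<open>ee k\<close> to their successors.\<close>
  let ?g = "ee k \<otimes>\<^bsub>A\<^esub> ee (Suc k)"
  have g: "?g \<in> carrier A" using c by simp
  have ga: "?g \<otimes>\<^bsub>A\<^esub> a k \<otimes>\<^bsub>A\<^esub> inv\<^bsub>A\<^esub> ?g = a (Suc k)"
    using ee_fixes_a_below[of k "Suc k"] ee_a[of k] Suc.prems Suc.hyps c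
    by (simp add: A.conj_mult_left fixes_conj_def)
  have ga': "?g \<otimes>\<^bsub>A\<^esub> a (Suc k) \<otimes>\<^bsub>A\<^esub> inv\<^bsub>A\<^esub> ?g = a (Suc (Suc k))"
    using ee_fixes_a_above[of k "Suc (Suc k)"] ee_a[of "Suc k"] Suc.prems Suc.hyps c
    by (simp add: A.conj_mult_left fixes_conj_def del: a.simps)
  have ge: "?g \<otimes>\<^bsub>A\<^esub> ee k = ee (Suc k) \<otimes>\<^bsub>A\<^esub> ?g"
    using ee_braid[of k] Suc.prems Suc.hyps c by (simp add: A.m_assoc)
  have "?g \<otimes>\<^bsub>A\<^esub> (ee k \<otimes>\<^bsub>A\<^esub> a (Suc k) \<otimes>\<^bsub>A\<^esub> inv\<^bsub>A\<^esub> ee k) \<otimes>\<^bsub>A\<^esub> inv\<^bsub>A\<^esub> ?g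
    = (?g \<otimes>\<^bsub>A\<^esub> ee k) \<otimes>\<^bsub>A\<^esub> a (Suc k) \<otimes>\<^bsub>A\<^esub> inv\<^bsub>A\<^esub> (?g \<otimes>\<^bsub>A\<^esub> ee k)"
    using A.conj_mult_left[OF g c(1,4)] by simp
  also have "\<dots> = ee (Suc k) \<otimes>\<^bsub>A\<^esub> a (Suc (Suc k)) \<otimes>\<^bsub>A\<^esub> inv\<^bsub>A\<^esub> ee (Suc k)"
    unfolding ge A.conj_mult_left[OF c(2) g c(4)] ga' ..
  finally have l: "?g \<otimes>\<^bsub>A\<^esub> (ee k \<otimes>\<^bsub>A\<^esub> a (Suc k) \<otimes>\<^bsub>A\<^esub> inv\<^bsub>A\<^esub> ee k) \<otimes>\<^bsub>A\<^esub> inv\<^bsub>A\<^esub> ?g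
    = ee (Suc k) \<otimes>\<^bsub>A\<^esub> a (Suc (Suc k)) \<otimes>\<^bsub>A\<^esub> inv\<^bsub>A\<^esub> ee (Suc k)" .
  have "?g \<otimes>\<^bsub>A\<^esub> (a (Suc k) \<otimes>\<^bsub>A\<^esub> inv\<^bsub>A\<^esub> a k \<otimes>\<^bsub>A\<^esub> a (Suc k)) \<otimes>\<^bsub>A\<^esub> inv\<^bsub>A\<^esub> ?g
    = a (Suc (Suc k)) \<otimes>\<^bsub>A\<^esub> inv\<^bsub>A\<^esub> a (Suc k) \<otimes>\<^bsub>A\<^esub> a (Suc (Suc k))"
    using c g by (simp only: A.conj_mult A.conj_inv ga ga' A.m_closed A.inv_closed)
  then show ?case using l Suc.IH Suc.prems by simp
qed

text \<open>Again the formula of \<open>iota_image\<close>, now for \<open>d 2\<close>. Beyond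
  \<open>m = 2\<close> it is carried upwards by conjugation with \<open>ee m\<close>, which commutes
  with \<open>d 2\<close> and fixes \<open>a 1\<close>.\<close>

lemma d2_a:
  assumes "2 \<le> m" "m < n"
  shows "d 2 \<otimes>\<^bsub>A\<^esub> a m \<otimes>\<^bsub>A\<^esub> inv\<^bsub>A\<^esub> d 2 = inv\<^bsub>A\<^esub> a 1 \<otimes>\<^bsub>A\<^esub> a m"
  using assms
proof (induction m rule: nat_induct_at_least)
  case base
  define p q t where pqt: "p = d 1" "q = d 2" "t = d 3"
  have c: "p \<in> carrier A" "q \<in> carrier A" "t \<in> carrier A" using n3 d_closed by (auto simp: pqt)
  have pt: "p \<otimes>\<^bsub>A\<^esub> t \<otimes>\<^bsub>A\<^esub> p = t \<otimes>\<^bsub>A\<^esub> p \<otimes>\<^bsub>A\<^esub> t" and qt: "q \<otimes>\<^bsub>A\<^esub> t \<otimes>\<^bsub>A\<^esub> q = t \<otimes>\<^bsub>A\<^esub> q \<otimes>\<^bsub>A\<^esub> t"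
    unfolding pqt by (rule d_braid; use n3 D_edges_mem in simp)+
  have a1: "a 1 = p \<otimes>\<^bsub>A\<^esub> inv\<^bsub>A\<^esub> q" and a2: "a 2 = t \<otimes>\<^bsub>A\<^esub> (p \<otimes>\<^bsub>A\<^esub> inv\<^bsub>A\<^esub> q) \<otimes>\<^bsub>A\<^esub> inv\<^bsub>A\<^esub> t"
    by (simp_all add: pqt numeral_3_eq_3 numeral_2_eq_2)
  have 1: "inv\<^bsub>A\<^esub> p \<otimes>\<^bsub>A\<^esub> t \<otimes>\<^bsub>A\<^esub> p = t \<otimes>\<^bsub>A\<^esub> p \<otimes>\<^bsub>A\<^esub> inv\<^bsub>A\<^esub> t" using A.braid_inv(2)[OF c(1,3) pt] .
  have 3: "inv\<^bsub>A\<^esub> q \<otimes>\<^bsub>A\<^esub> inv\<^bsub>A\<^esub> t \<otimes>\<^bsub>A\<^esub> inv\<^bsub>A\<^esub> q = inv\<^bsub>A\<^esub> t \<otimes>\<^bsub>A\<^esub> inv\<^bsub>A\<^esub> q \<otimes>\<^bsub>A\<^esub> inv\<^bsub>A\<^esub> t"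
    using A.braid_inv(3)[OF c(2,3) qt] .
  have "inv\<^bsub>A\<^esub> a 1 \<otimes>\<^bsub>A\<^esub> a 2 = q \<otimes>\<^bsub>A\<^esub> (inv\<^bsub>A\<^esub> p \<otimes>\<^bsub>A\<^esub> t \<otimes>\<^bsub>A\<^esub> p) \<otimes>\<^bsub>A\<^esub> inv\<^bsub>A\<^esub> q \<otimes>\<^bsub>A\<^esub> inv\<^bsub>A\<^esub> t"
    unfolding a1 a2 using c by (simp add: A.m_assoc A.inv_mult_group)
  also have "\<dots> = q \<otimes>\<^bsub>A\<^esub> t \<otimes>\<^bsub>A\<^esub> p \<otimes>\<^bsub>A\<^esub> (inv\<^bsub>A\<^esub> t \<otimes>\<^bsub>A\<^esub> inv\<^bsub>A\<^esub> q \<otimes>\<^bsub>A\<^esub> inv\<^bsub>A\<^esub> t)"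
    unfolding 1 using c by (simp add: A.m_assoc)
  also have "\<dots> = q \<otimes>\<^bsub>A\<^esub> a 2 \<otimes>\<^bsub>A\<^esub> inv\<^bsub>A\<^esub> q"
    unfolding 3[symmetric] a2 using c by (simp add: A.m_assoc)
  finally show ?case by (simp add: pqt)
next
  case (Suc m)
  have c: "ee m \<in> carrier A" "d 2 \<in> carrier A" "a 1 \<in> carrier A" "a m \<in> carrier A"
    using Suc ee_closed[of m] d2_closed a_closed n3 by (simp_all del: One_nat_def)
  have e: "a (Suc m) = ee m \<otimes>\<^bsub>A\<^esub> a m \<otimes>\<^bsub>A\<^esub> inv\<^bsub>A\<^esub> ee m" using ee_a[of m] Suc by simp
  have com: "d 2 \<otimes>\<^bsub>A\<^esub> ee m = ee m \<otimes>\<^bsub>A\<^esub> d 2"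
    using Suc n3 not_D_edges(3)[of m] by (intro d_commute) auto
  have fx: "ee m \<otimes>\<^bsub>A\<^esub> a 1 \<otimes>\<^bsub>A\<^esub> inv\<^bsub>A\<^esub> ee m = a 1"
    using ee_fixes_a_below[of 1 m] Suc by (simp add: fixes_conj_def)
  have "d 2 \<otimes>\<^bsub>A\<^esub> a (Suc m) \<otimes>\<^bsub>A\<^esub> inv\<^bsub>A\<^esub> d 2 = ee m \<otimes>\<^bsub>A\<^esub> (d 2 \<otimes>\<^bsub>A\<^esub> a m \<otimes>\<^bsub>A\<^esub> inv\<^bsub>A\<^esub> d 2) \<otimes>\<^bsub>A\<^esub> inv\<^bsub>A\<^esub> ee m"
    unfolding e A.conj_mult_left[OF c(2,1,4), symmetric] A.conj_mult_left[OF c(1,2,4), symmetric] com ..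
  also have "\<dots> = inv\<^bsub>A\<^esub> a 1 \<otimes>\<^bsub>A\<^esub> a (Suc m)"
    using Suc c by (simp only: Suc_lessD A.conj_mult A.conj_inv fx e A.inv_closed)
  finally show ?case .
qed


declare a.simps [simp del]

section \<open>The subgroup generated by the elements \<open>a m\<close> and its normaliser\<close>

definition N :: "nat word set set" where "N = word_val A a ` words {1..<n}"

lemma a_Pi: "a \<in> {1..<n} \<rightarrow> carrier A"
  using a_closed by auto

lemma N_closed: "y \<in> N \<Longrightarrow> y \<in> carrier A"
  unfolding N_def using A.word_val_closed[OF _ a_Pi] by blast

lemma N_one: "\<one>\<^bsub>A\<^esub> \<in> N"
  unfolding N_def by (rule image_eqI[of _ _ "[]"]) simp_all

lemma N_mult: "y \<in> N \<Longrightarrow> z \<in> N \<Longrightarrow> y \<otimes>\<^bsub>A\<^esub> z \<in> N"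
  unfolding N_def by (auto simp: A.word_val_append[OF a_Pi, symmetric])

lemma N_letter: "m \<in> {1..<n} \<Longrightarrow> (if e then a m else inv\<^bsub>A\<^esub> a m) \<in> N"
  unfolding N_def using a_closed by (intro image_eqI[of _ _ "[(m, e)]"]) auto

lemma N_a: "m \<in> {1..<n} \<Longrightarrow> a m \<in> N" "m \<in> {1..<n} \<Longrightarrow> inv\<^bsub>A\<^esub> a m \<in> N"
  using N_letter[of m True] N_letter[of m False] by auto

lemma N_induct [consumes 1, case_names one mult]:
  assumes "y \<in> N" "P \<one>\<^bsub>A\<^esub>"
    "\<And>m e y. m \<in> {1..<n} \<Longrightarrow> y \<in> N \<Longrightarrow> P y \<Longrightarrow> P ((if e then a m else inv\<^bsub>A\<^esub> a m) \<otimes>\<^bsub>A\<^esub> y)"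
  shows "P y"
proof -
  obtain w where w: "w \<in> words {1..<n}" "y = word_val A a w" using assms(1) by (auto simp: N_def)
  have "P (word_val A a w)" using w(1)
    by (induction rule: words_induct) (use assms(2,3) N_def in auto)
  then show ?thesis using w by simp
qed

lemma N_inv: "y \<in> N \<Longrightarrow> inv\<^bsub>A\<^esub> y \<in> N"
proof (induction rule: N_induct)
  case (mult m e y)
  have "(if \<not> e then a m else inv\<^bsub>A\<^esub> a m) \<in> N" using N_letter[OF mult.hyps(1)] .
  with mult have "inv\<^bsub>A\<^esub> y \<otimes>\<^bsub>A\<^esub> (if \<not> e then a m else inv\<^bsub>A\<^esub> a m) \<in> N" by (intro N_mult)
  then show ?case using mult a_closed N_closed[of y] by (auto simp: A.inv_mult_group)
qed (simp add: N_one)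

lemma N_conj:
  assumes g: "g \<in> carrier A" and "\<And>m. m \<in> {1..<n} \<Longrightarrow> g \<otimes>\<^bsub>A\<^esub> a m \<otimes>\<^bsub>A\<^esub> inv\<^bsub>A\<^esub> g \<in> N" and "y \<in> N"
  shows "g \<otimes>\<^bsub>A\<^esub> y \<otimes>\<^bsub>A\<^esub> inv\<^bsub>A\<^esub> g \<in> N"
  using assms(3)
proof (induction rule: N_induct)
  case (mult m e y)
  have c: "a m \<in> carrier A" "y \<in> carrier A" using mult a_closed N_closed by auto
  have "g \<otimes>\<^bsub>A\<^esub> (if e then a m else inv\<^bsub>A\<^esub> a m) \<otimes>\<^bsub>A\<^esub> inv\<^bsub>A\<^esub> g \<in> N"
    using assms(2)[OF mult.hyps(1)] N_inv A.conj_inv[OF g c(1)] by (cases e) simp_all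
  then show ?case using mult.IH A.conj_mult[OF g _ c(2), of "if e then a m else inv\<^bsub>A\<^esub> a m"] c N_mult
    by (auto split: if_splits)
qed (simp add: g N_one)

text \<open>A subgroup can contain its conjugate properly, so invariance under the inverse needs
  preimages of the generators.\<close>

lemma N_conj_inv:
  assumes g: "g \<in> carrier A" and "\<And>m. m \<in> {1..<n} \<Longrightarrow> \<exists>z\<in>N. a m = g \<otimes>\<^bsub>A\<^esub> z \<otimes>\<^bsub>A\<^esub> inv\<^bsub>A\<^esub> g" and "y \<in> N"
  shows "inv\<^bsub>A\<^esub> g \<otimes>\<^bsub>A\<^esub> y \<otimes>\<^bsub>A\<^esub> g \<in> N"
proof -
  have "inv\<^bsub>A\<^esub> g \<otimes>\<^bsub>A\<^esub> a m \<otimes>\<^bsub>A\<^esub> inv\<^bsub>A\<^esub> (inv\<^bsub>A\<^esub> g) \<in> N" if m: "m \<in> {1..<n}" for m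
  proof -
    obtain z where z: "z \<in> N" "a m = g \<otimes>\<^bsub>A\<^esub> z \<otimes>\<^bsub>A\<^esub> inv\<^bsub>A\<^esub> g" using assms(2)[OF m] by blast
    have "inv\<^bsub>A\<^esub> g \<otimes>\<^bsub>A\<^esub> (g \<otimes>\<^bsub>A\<^esub> z \<otimes>\<^bsub>A\<^esub> inv\<^bsub>A\<^esub> g) \<otimes>\<^bsub>A\<^esub> g = z"
      using A.conj_cancel(1)[OF g N_closed[OF z(1)]] .
    then show ?thesis using z g by simp
  qed
  from N_conj[OF A.inv_closed[OF g] this assms(3)] show ?thesis using g by simp
qed

lemma ee_conj_N:
  assumes k: "1 \<le> k" "Suc k < n" and y: "y \<in> N"
  shows "ee k \<otimes>\<^bsub>A\<^esub> y \<otimes>\<^bsub>A\<^esub> inv\<^bsub>A\<^esub> ee k \<in> N" "inv\<^bsub>A\<^esub> ee k \<otimes>\<^bsub>A\<^esub> y \<otimes>\<^bsub>A\<^esub> ee k \<in> N"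
proof -
  have e: "ee k \<in> carrier A" using ee_closed k by simp
  have c: "a k \<in> carrier A" "a (Suc k) \<in> carrier A" using a_closed k by auto
  have kn: "k \<in> {1..<n}" "Suc k \<in> {1..<n}" using k by auto
  note aN = N_a[OF kn(1)] N_a[OF kn(2)]
  have other: "ee k \<otimes>\<^bsub>A\<^esub> a m \<otimes>\<^bsub>A\<^esub> inv\<^bsub>A\<^esub> ee k = a m" if "m \<in> {1..<n}" "m \<noteq> k" "m \<noteq> Suc k" for m
    using that ee_fixes_a_below[of m k] ee_fixes_a_above[of k m] k
    by (cases "m < k") (auto simp: fixes_conj_def)
  show "ee k \<otimes>\<^bsub>A\<^esub> y \<otimes>\<^bsub>A\<^esub> inv\<^bsub>A\<^esub> ee k \<in> N"
  proof (rule N_conj[OF e _ y])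
    fix m assume m: "m \<in> {1..<n}"
    consider "m = k" | "m = Suc k" | "m \<noteq> k" "m \<noteq> Suc k" by blast
    then show "ee k \<otimes>\<^bsub>A\<^esub> a m \<otimes>\<^bsub>A\<^esub> inv\<^bsub>A\<^esub> ee k \<in> N"
    proof cases
      case 1
      then show ?thesis using ee_a[OF k] aN by simp
    next
      case 2
      then show ?thesis using ee_a_Suc[OF k] aN by (simp add: N_mult)
    next
      case 3
      then show ?thesis using other m N_a(1)[OF m] by simp
    qed
  qed
  show "inv\<^bsub>A\<^esub> ee k \<otimes>\<^bsub>A\<^esub> y \<otimes>\<^bsub>A\<^esub> ee k \<in> N"
  proof (rule N_conj_inv[OF e _ y])
    fix m assume m: "m \<in> {1..<n}"
    consider "m = k" | "m = Suc k" | "m \<noteq> k" "m \<noteq> Suc k" by blast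
    then show "\<exists>z\<in>N. a m = ee k \<otimes>\<^bsub>A\<^esub> z \<otimes>\<^bsub>A\<^esub> inv\<^bsub>A\<^esub> ee k"
    proof cases
      case 1
      \<comment> \<open>The witness copies the value of \<open>iota_inv_image\<close> for
        \<open>ee k\<close> at \<open>x k\<close>.\<close>
      let ?z = "a k \<otimes>\<^bsub>A\<^esub> inv\<^bsub>A\<^esub> a (Suc k) \<otimes>\<^bsub>A\<^esub> a k"
      have "ee k \<otimes>\<^bsub>A\<^esub> ?z \<otimes>\<^bsub>A\<^esub> inv\<^bsub>A\<^esub> ee k
        = a (Suc k) \<otimes>\<^bsub>A\<^esub> inv\<^bsub>A\<^esub> (a (Suc k) \<otimes>\<^bsub>A\<^esub> inv\<^bsub>A\<^esub> a k \<otimes>\<^bsub>A\<^esub> a (Suc k)) \<otimes>\<^bsub>A\<^esub> a (Suc k)"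
        using e c by (simp only: A.conj_mult A.conj_inv ee_a[OF k] ee_a_Suc[OF k] A.m_closed A.inv_closed)
      also have "\<dots> = a k" using c by (simp add: A.m_assoc A.inv_mult_group A.inv_cancel)
      finally show ?thesis using 1 aN by (intro bexI[of _ ?z]) (simp_all add: N_mult)
    next
      case 2
      then show ?thesis using ee_a[OF k] aN by force
    next
      case 3
      then show ?thesis using other m N_a(1)[OF m] by force
    qed
  qed
qed

lemma d2_conj_N:
  assumes y: "y \<in> N"
  shows "d 2 \<otimes>\<^bsub>A\<^esub> y \<otimes>\<^bsub>A\<^esub> inv\<^bsub>A\<^esub> d 2 \<in> N" "inv\<^bsub>A\<^esub> d 2 \<otimes>\<^bsub>A\<^esub> y \<otimes>\<^bsub>A\<^esub> d 2 \<in> N"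
proof -
  have kn: "1 \<in> {1..<n}" using n3 by simp
  note aN = N_a[OF kn]
  have c: "a 1 \<in> carrier A" "a m \<in> carrier A" if "m \<in> {1..<n}" for m using a_closed n3 that by auto
  have pq: "d 1 \<otimes>\<^bsub>A\<^esub> d 2 = d 2 \<otimes>\<^bsub>A\<^esub> d 1" using n3 by (intro d_commute not_D_edges) simp_all
  have one: "d 2 \<otimes>\<^bsub>A\<^esub> a 1 \<otimes>\<^bsub>A\<^esub> inv\<^bsub>A\<^esub> d 2 = a 1"
  proof (rule A.conj_eqD)
    have "d 2 \<otimes>\<^bsub>A\<^esub> (d 1 \<otimes>\<^bsub>A\<^esub> inv\<^bsub>A\<^esub> d 2) = d 1 \<otimes>\<^bsub>A\<^esub> d 2 \<otimes>\<^bsub>A\<^esub> inv\<^bsub>A\<^esub> d 2"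
      unfolding pq using d1_closed d2_closed by (simp add: A.m_assoc del: One_nat_def)
    then show "d 2 \<otimes>\<^bsub>A\<^esub> a 1 = a 1 \<otimes>\<^bsub>A\<^esub> d 2"
      using d1_closed d2_closed by (simp add: a.simps(2) A.m_assoc)
  qed (use c d2_closed kn in blast)+
  have other: "d 2 \<otimes>\<^bsub>A\<^esub> a m \<otimes>\<^bsub>A\<^esub> inv\<^bsub>A\<^esub> d 2 = inv\<^bsub>A\<^esub> a 1 \<otimes>\<^bsub>A\<^esub> a m" if "m \<in> {1..<n}" "m \<noteq> 1" for m
    using d2_a[of m] that by simp
  show "d 2 \<otimes>\<^bsub>A\<^esub> y \<otimes>\<^bsub>A\<^esub> inv\<^bsub>A\<^esub> d 2 \<in> N"
  proof (rule N_conj[OF d2_closed _ y])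
    fix m assume m: "m \<in> {1..<n}"
    show "d 2 \<otimes>\<^bsub>A\<^esub> a m \<otimes>\<^bsub>A\<^esub> inv\<^bsub>A\<^esub> d 2 \<in> N"
      using one other[OF m] aN N_a[OF m] N_mult by (cases "m = 1") (simp_all del: One_nat_def)
  qed
  show "inv\<^bsub>A\<^esub> d 2 \<otimes>\<^bsub>A\<^esub> y \<otimes>\<^bsub>A\<^esub> d 2 \<in> N"
  proof (rule N_conj_inv[OF d2_closed _ y])
    fix m assume m: "m \<in> {1..<n}"
    show "\<exists>z\<in>N. a m = d 2 \<otimes>\<^bsub>A\<^esub> z \<otimes>\<^bsub>A\<^esub> inv\<^bsub>A\<^esub> d 2"
    proof (cases "m = 1")
      case False
      have "d 2 \<otimes>\<^bsub>A\<^esub> (a 1 \<otimes>\<^bsub>A\<^esub> a m) \<otimes>\<^bsub>A\<^esub> inv\<^bsub>A\<^esub> d 2 = a 1 \<otimes>\<^bsub>A\<^esub> (inv\<^bsub>A\<^esub> a 1 \<otimes>\<^bsub>A\<^esub> a m)"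
        unfolding A.conj_mult[OF d2_closed c(1)[OF m] c(2)[OF m]] one other[OF m False] ..
      also have "\<dots> = a m" using c[OF m] by (rule A.inv_cancel)
      finally show ?thesis using N_mult[OF aN(1) N_a(1)[OF m]] by force
    qed (use one aN in force)
  qed
qed

section \<open>Factorisation into a word in the \<open>a m\<close> and a braid\<close>

definition Bs :: "nat word set set" where "Bs = word_val A d ` words {2..n}"

lemma d_Pi: "d \<in> {1..n} \<rightarrow> carrier A" "d \<in> {2..n} \<rightarrow> carrier A"
  using d_closed by auto

lemma Bs_closed: "y \<in> Bs \<Longrightarrow> y \<in> carrier A"
  unfolding Bs_def using A.word_val_closed[OF _ d_Pi(2)] by blast

lemma Bs_letter:
  "i \<in> {2..n} \<Longrightarrow> y \<in> Bs \<Longrightarrow> (if e then d i else inv\<^bsub>A\<^esub> d i) \<otimes>\<^bsub>A\<^esub> y \<in> Bs"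
  unfolding Bs_def by (elim imageE) (rule image_eqI[of _ _ "(i, e) # w" for w], auto)

lemma letter_conj_N:
  assumes "i \<in> {2..n}" "y \<in> N"
  shows "\<exists>z\<in>N. (if e then d i else inv\<^bsub>A\<^esub> d i) \<otimes>\<^bsub>A\<^esub> y = z \<otimes>\<^bsub>A\<^esub> (if e then d i else inv\<^bsub>A\<^esub> d i)"
proof -
  have di: "d i \<in> carrier A" "y \<in> carrier A" using assms d_closed N_closed by auto
  have N: "d i \<otimes>\<^bsub>A\<^esub> y \<otimes>\<^bsub>A\<^esub> inv\<^bsub>A\<^esub> d i \<in> N \<and> inv\<^bsub>A\<^esub> d i \<otimes>\<^bsub>A\<^esub> y \<otimes>\<^bsub>A\<^esub> d i \<in> N"
  proof -
    have "i \<in> {1..n}" "i \<noteq> 1" using assms by auto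
    then show ?thesis
      by (cases rule: index_cases) (use d2_conj_N[OF assms(2)] ee_conj_N[OF _ _ assms(2)] in auto)
  qed
  show ?thesis
  proof (cases e)
    case True
    have "d i \<otimes>\<^bsub>A\<^esub> y = d i \<otimes>\<^bsub>A\<^esub> y \<otimes>\<^bsub>A\<^esub> inv\<^bsub>A\<^esub> d i \<otimes>\<^bsub>A\<^esub> d i" using di by (simp add: A.m_assoc)
    then show ?thesis using N True by force
  next
    case False
    have "inv\<^bsub>A\<^esub> d i \<otimes>\<^bsub>A\<^esub> y = inv\<^bsub>A\<^esub> d i \<otimes>\<^bsub>A\<^esub> y \<otimes>\<^bsub>A\<^esub> d i \<otimes>\<^bsub>A\<^esub> inv\<^bsub>A\<^esub> d i" using di by (simp add: A.m_assoc)
    then show ?thesis using N False by force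
  qed
qed

text \<open>Letters are absorbed from the left; those of \<open>d 2, ..., d n\<close> pass the
  \<open>N\<close> factor by normality. The letter \<open>d 1\<close> is first replaced by
  \<open>a 1\<close> times \<open>d 2\<close>.\<close>

lemma decomposition:
  assumes "g \<in> carrier A"
  shows "\<exists>y\<in>N. \<exists>b\<in>Bs. g = y \<otimes>\<^bsub>A\<^esub> b"
proof -
  obtain w where w: "w \<in> words {1..n}" "g = word_val A d w"
    using assms by (auto simp: artin_D_def carrier_presented_group word_class_word_val artin_D_gen_def)
  have step: "\<exists>y\<in>N. \<exists>b\<in>Bs. (if e then d i else inv\<^bsub>A\<^esub> d i) \<otimes>\<^bsub>A\<^esub> g = y \<otimes>\<^bsub>A\<^esub> b"
    if i: "i \<in> {2..n}" and g: "\<exists>y\<in>N. \<exists>b\<in>Bs. g = y \<otimes>\<^bsub>A\<^esub> b" for i e g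
  proof -
    obtain y b where yb: "y \<in> N" "b \<in> Bs" "g = y \<otimes>\<^bsub>A\<^esub> b" using g by blast
    let ?u = "if e then d i else inv\<^bsub>A\<^esub> d i"
    obtain z where z: "z \<in> N" "?u \<otimes>\<^bsub>A\<^esub> y = z \<otimes>\<^bsub>A\<^esub> ?u" using letter_conj_N[OF i yb(1)] by blast
    have u: "?u \<in> carrier A" using i d_closed[of i] by simp
    have "?u \<otimes>\<^bsub>A\<^esub> g = (?u \<otimes>\<^bsub>A\<^esub> y) \<otimes>\<^bsub>A\<^esub> b"
      unfolding yb(3) using A.m_assoc[OF u N_closed[OF yb(1)] Bs_closed[OF yb(2)]] by simp
    also have "\<dots> = z \<otimes>\<^bsub>A\<^esub> (?u \<otimes>\<^bsub>A\<^esub> b)"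
      unfolding z(2) using A.m_assoc[OF N_closed[OF z(1)] u Bs_closed[OF yb(2)]] by simp
    finally show ?thesis using z(1) Bs_letter[OF i yb(2), of e] by blast
  qed
  have left: "\<exists>y\<in>N. \<exists>b\<in>Bs. z \<otimes>\<^bsub>A\<^esub> g = y \<otimes>\<^bsub>A\<^esub> b" if z: "z \<in> N" and g: "\<exists>y\<in>N. \<exists>b\<in>Bs. g = y \<otimes>\<^bsub>A\<^esub> b" for z g
  proof -
    obtain y b where yb: "y \<in> N" "b \<in> Bs" "g = y \<otimes>\<^bsub>A\<^esub> b" using g by blast
    have "z \<otimes>\<^bsub>A\<^esub> g = (z \<otimes>\<^bsub>A\<^esub> y) \<otimes>\<^bsub>A\<^esub> b"
      unfolding yb(3) using A.m_assoc[OF N_closed[OF z] N_closed[OF yb(1)] Bs_closed[OF yb(2)]] by simp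
    then show ?thesis using N_mult[OF z yb(1)] yb(2) by blast
  qed
  have a1: "a 1 \<in> carrier A" "1 \<in> {1..<n}" "2 \<in> {2..n}" using a_closed n3 by auto
  have d1: "d 1 = a 1 \<otimes>\<^bsub>A\<^esub> d 2" using d1_closed d2_closed by (simp add: a.simps(2) A.m_assoc)
  have "\<exists>y\<in>N. \<exists>b\<in>Bs. word_val A d w = y \<otimes>\<^bsub>A\<^esub> b"
    using w(1)
  proof (induction rule: words_induct)
    case Nil
    have "\<one>\<^bsub>A\<^esub> \<in> Bs" unfolding Bs_def by (rule image_eqI[of _ _ "[]"]) simp_all
    then show ?case using N_one by force
  next
    case (Cons i e w)
    have wc: "word_val A d w \<in> carrier A" using A.word_val_closed[OF Cons.hyps(2) d_Pi(1)] .
    show ?case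
    proof (cases "i = 1")
      case False
      then show ?thesis using step[of i _ e] Cons by simp
    next
      case True
      show ?thesis
      proof (cases e)
        case e: True
        have "word_val A d ((i, e) # w) = a 1 \<otimes>\<^bsub>A\<^esub> (d 2 \<otimes>\<^bsub>A\<^esub> word_val A d w)"
          using True e d1 wc a1 d2_closed by (simp add: A.m_assoc del: One_nat_def)
        then show ?thesis using left[OF N_a(1)[OF a1(2)] step[OF a1(3) Cons.IH, of True]] by simp
      next
        case e: False
        have "word_val A d ((i, e) # w) = inv\<^bsub>A\<^esub> d 2 \<otimes>\<^bsub>A\<^esub> (inv\<^bsub>A\<^esub> a 1 \<otimes>\<^bsub>A\<^esub> word_val A d w)"
          using True e d1 wc a1 d2_closed by (simp add: A.m_assoc A.inv_mult_group del: One_nat_def)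
        then show ?thesis using step[OF a1(3) left[OF N_a(2)[OF a1(2)] Cons.IH], of False] by simp
      qed
    qed
  qed
  then show ?thesis using w by simp
qed

end

subsection \<open>Faithfulness\<close>

definition ucox_group :: "ucox monoid"
  where "ucox_group = \<lparr>carrier = UNIV, mult = (*), one = 1\<rparr>"

lemma ucox_group_simps [simp]:
  "carrier ucox_group = UNIV" "x \<otimes>\<^bsub>ucox_group\<^esub> y = x * y" "\<one>\<^bsub>ucox_group\<^esub> = 1"
  by (simp_all add: ucox_group_def)

interpretation ucox: group ucox_group
proof (rule groupI)
  show "\<exists>y\<in>carrier ucox_group. y \<otimes>\<^bsub>ucox_group\<^esub> x = \<one>\<^bsub>ucox_group\<^esub>" for x
    using elem_rev_elem[of "letters x"] by auto
qed (simp_all add: mult.assoc)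

lemma ucox_inv_eq: "x * y = 1 \<Longrightarrow> inv\<^bsub>ucox_group\<^esub> y = x"
  by (rule ucox.inv_equality) simp_all

lemma set_letters_elem: "set (letters (elem u)) \<subseteq> set u"
proof -
  have "set (push i w) \<subseteq> insert i (set w)" for i w by (cases w) auto
  then show ?thesis by (induction u) (force simp: letters_invo_times)+
qed

locale type_D_rep = type_D +
  fixes \<iota> assumes iota: "is_iota n \<iota>"
begin

section \<open>The action of the two factors on the free group\<close>

lemma iota_hom: "\<iota> \<in> hom A Aut"
  using iota by (simp add: is_iota_def)

lemma iota_closed: "g \<in> carrier A \<Longrightarrow> \<iota> g \<in> carrier Aut"
  using iota_hom by (auto simp: hom_def)

lemma iota_mult:
  "g \<in> carrier A \<Longrightarrow> h \<in> carrier A \<Longrightarrow> y \<in> carrier F \<Longrightarrow> \<iota> (g \<otimes>\<^bsub>A\<^esub> h) y = \<iota> g (\<iota> h y)"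
  using iota_hom iota_closed Aut_apply(1)[of "\<iota> g" "\<iota> h" y] by (simp add: hom_def)

lemma iota_d: "i \<in> {1..n} \<Longrightarrow> \<iota> (d i) = D i"
  using iota_closed[OF d_closed] D_auto D_gen iota
  by (intro auto_F_eqI) (simp_all add: is_iota_def AutoGroup_simps del: One_nat_def)

lemma D_surj:
  assumes "i \<in> {1..n}" "y \<in> carrier F"
  obtains z where "z \<in> carrier F" "y = D i z"
  using D_D_inv(1)[OF assms] hom_F(1)[OF D_inv_hom[OF assms(1)] assms(2)] that by metis

lemma conj_hom:
  assumes "c \<in> carrier F" "h \<in> hom F F"
  shows "(\<lambda>y. c \<otimes>\<^bsub>F\<^esub> h y \<otimes>\<^bsub>F\<^esub> inv\<^bsub>F\<^esub> c) \<in> hom F F"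
proof (rule homI)
  note h = hom_F[OF assms(2)]
  fix y z assume "y \<in> carrier F" "z \<in> carrier F"
  then show "c \<otimes>\<^bsub>F\<^esub> h (y \<otimes>\<^bsub>F\<^esub> z) \<otimes>\<^bsub>F\<^esub> inv\<^bsub>F\<^esub> c
    = c \<otimes>\<^bsub>F\<^esub> h y \<otimes>\<^bsub>F\<^esub> inv\<^bsub>F\<^esub> c \<otimes>\<^bsub>F\<^esub> (c \<otimes>\<^bsub>F\<^esub> h z \<otimes>\<^bsub>F\<^esub> inv\<^bsub>F\<^esub> c)"
    using F.conj_mult[OF assms(1) h(1) h(1)] h(2) by simp
qed (use hom_F(1)[OF assms(2)] assms(1) in simp)

text \<open>The automorphisms of \<open>d 1\<close> and \<open>d 2\<close> differ by conjugation
  with \<open>x 1\<close>. In the induction step an automorphism conjugates an inner automorphism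
  into that of the image element. Writing \<open>y\<close> as an image under \<open>D\<close> avoids
  inverses of automorphisms.\<close>

lemma iota_a:
  assumes "1 \<le> m" "m < n" "y \<in> carrier F"
  shows "\<iota> (a m) y = x m \<otimes>\<^bsub>F\<^esub> y \<otimes>\<^bsub>F\<^esub> inv\<^bsub>F\<^esub> x m"
  using assms
proof (induction m arbitrary: y rule: nat_induct_at_least)
  case base
  have i: "1 \<in> {1..n}" "2 \<in> {1..n}" using n3 by auto
  obtain z where z: "z \<in> carrier F" "y = D 2 z" using D_surj[OF i(2) base.prems(2)] by blast
  have d1: "a 1 \<otimes>\<^bsub>A\<^esub> d 2 = d 1" using d1_closed d2_closed by (simp add: a.simps(2) A.m_assoc)
  have "\<iota> (a 1) (D 2 z) = D 1 z"
    using iota_mult[OF _ d2_closed z(1), of "a 1"] a_closed[of 1] n3 iota_d[OF i(1)] iota_d[OF i(2)]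
    unfolding d1 by simp
  also have "\<dots> = x 1 \<otimes>\<^bsub>F\<^esub> D 2 z \<otimes>\<^bsub>F\<^esub> inv\<^bsub>F\<^esub> x 1"
  proof (rule F_hom_eq[OF D_hom[OF i(1)] conj_hom[OF x_closed[OF i(1)] D_hom[OF i(2)]] _ z(1)])
    fix j assume j: "j \<in> {1..n}"
    have "j = 1 \<or> j = n \<or> (j \<noteq> 1 \<and> j \<noteq> n)" by blast
    then show "D 1 (x j) = x 1 \<otimes>\<^bsub>F\<^esub> D 2 (x j) \<otimes>\<^bsub>F\<^esub> inv\<^bsub>F\<^esub> x 1"
      using j n3 by (elim disjE conjE) (simp_all add: D_simps iota_image_simps F_simps del: One_nat_def)
  qed
  finally show ?case using z by simp
next
  case (Suc m)
  have i: "Suc (Suc m) \<in> {1..n}" using Suc by simp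
  have c: "ee m \<in> carrier A" "a m \<in> carrier A" "a (Suc m) \<in> carrier A"
    using Suc ee_closed[of m] a_closed by simp_all
  have xc: "x m \<in> carrier F" using Suc by simp
  obtain z where z: "z \<in> carrier F" "y = D (Suc (Suc m)) z" using D_surj[OF i Suc.prems(2)] by blast
  have eq: "a (Suc m) \<otimes>\<^bsub>A\<^esub> ee m = ee m \<otimes>\<^bsub>A\<^esub> a m"
    using ee_a[of m] Suc c by (simp add: A.m_assoc flip: ee_a)
  have "\<iota> (a (Suc m)) y = \<iota> (a (Suc m) \<otimes>\<^bsub>A\<^esub> ee m) z"
    using iota_mult[OF c(3,1) z(1)] iota_d[OF i] z by simp
  also have "\<dots> = D (Suc (Suc m)) (x m \<otimes>\<^bsub>F\<^esub> z \<otimes>\<^bsub>F\<^esub> inv\<^bsub>F\<^esub> x m)"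
    unfolding eq using iota_mult[OF c(1,2) z(1)] iota_d[OF i] Suc.IH[of z] Suc.prems z(1) by simp
  also have "\<dots> = x (Suc m) \<otimes>\<^bsub>F\<^esub> y \<otimes>\<^bsub>F\<^esub> inv\<^bsub>F\<^esub> x (Suc m)"
    using hom_F[OF D_hom[OF i]] xc z D_gen[OF i, of m] Suc by (simp add: iota_image_simps)
  finally show ?case .
qed

lemma x_Pi: "x \<in> {1..<n} \<rightarrow> carrier F"
  by auto

lemma iota_word_val_a:
  assumes "w \<in> words {1..<n}" "y \<in> carrier F"
  shows "\<iota> (word_val A a w) y = word_val F x w \<otimes>\<^bsub>F\<^esub> y \<otimes>\<^bsub>F\<^esub> inv\<^bsub>F\<^esub> word_val F x w"
  using assms(1)
proof (induction rule: words_induct)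
  case Nil
  have "\<iota> \<one>\<^bsub>A\<^esub> = \<one>\<^bsub>Aut\<^esub>" using hom_one[OF iota_hom A.is_group Aut.is_group] .
  then show ?case using assms(2) by (simp add: Aut_apply)
next
  case (Cons m e w)
  let ?u = "if e then a m else inv\<^bsub>A\<^esub> a m" and ?v = "if e then x m else inv\<^bsub>F\<^esub> x m" and ?W = "word_val F x w"
  have m: "1 \<le> m" "m < n" using Cons.hyps by auto
  have c: "a m \<in> carrier A" "x m \<in> carrier F" "?W \<in> carrier F" "word_val A a w \<in> carrier A"
    using m a_closed F.word_val_closed[OF Cons.hyps(2) x_Pi] A.word_val_closed[OF Cons.hyps(2) a_Pi] by simp_all
  have z: "?W \<otimes>\<^bsub>F\<^esub> y \<otimes>\<^bsub>F\<^esub> inv\<^bsub>F\<^esub> ?W \<in> carrier F" using c assms(2) by simp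
  have "\<iota> ?u z = ?v \<otimes>\<^bsub>F\<^esub> z \<otimes>\<^bsub>F\<^esub> inv\<^bsub>F\<^esub> ?v" if "z \<in> carrier F" for z
  proof (cases e)
    case True
    then show ?thesis using iota_a[OF m that] by simp
  next
    case False
    have h: "(\<lambda>y. inv\<^bsub>F\<^esub> x m \<otimes>\<^bsub>F\<^esub> y \<otimes>\<^bsub>F\<^esub> inv\<^bsub>F\<^esub> (inv\<^bsub>F\<^esub> x m)) \<in> hom F F"
      using conj_hom[of "inv\<^bsub>F\<^esub> x m" "\<lambda>y. y"] c(2) by (simp add: hom_def)
    have "\<iota> (inv\<^bsub>A\<^esub> a m) = inv\<^bsub>Aut\<^esub> \<iota> (a m)"
      using group_hom.hom_inv[of A Aut \<iota>] iota_hom c(1)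
      by (simp add: group_hom_def group_hom_axioms_def A.is_group Aut.is_group)
    moreover have "\<iota> (a m) \<in> auto F" using iota_closed[OF c(1)] by (simp add: AutoGroup_simps)
    ultimately show ?thesis
      using auto_inv_apply[OF F.is_group _ h _ that, of "\<iota> (a m)"] iota_a[OF m] c(2) False
      by (simp add: F_simps)
  qed
  from this[OF z] show ?case
    using Cons.IH iota_mult[of ?u "word_val A a w" y] c assms(2)
    by (cases e) (simp_all add: F_simps)
qed

lemma D_Pi: "D \<in> {2..n} \<rightarrow> carrier Aut"
  using D_Aut by auto

lemma iota_word_val_d:
  assumes "w \<in> words {2..n}"
  shows "\<iota> (word_val A d w) = word_val Aut D w"
  using hom_word_val[OF A.is_group Aut.is_group iota_hom d_Pi(2) assms] iota_d
    word_val_cong[OF assms, of "\<lambda>s. \<iota> (d s)" D Aut] by simp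

lemma D_letter_apply:
  assumes "i \<in> {1..n}" "y \<in> carrier F"
  shows "(if e then D i else inv\<^bsub>Aut\<^esub> D i) y = (if e then D i y else D_inv i y)"
  using auto_inv_apply[OF F.is_group D_auto D_inv_hom D_D_inv(2) assms(2)] assms by simp

lemma word_val_D_Cons:
  assumes "i \<in> {2..n}" "w \<in> words {2..n}" "y \<in> carrier F"
  shows "word_val Aut D ((i, e) # w) y
    = (if e then D i (word_val Aut D w y) else D_inv i (word_val Aut D w y))"
    and "word_val Aut D w y \<in> carrier F"
proof -
  have i: "i \<in> {1..n}" using assms by simp
  have w: "word_val Aut D w \<in> carrier Aut" using Aut.word_val_closed[OF assms(2) D_Pi] .
  then show c: "word_val Aut D w y \<in> carrier F" using auto_closed[of _ F y] assms(3) by (simp add: AutoGroup_simps)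
  show "word_val Aut D ((i, e) # w) y
    = (if e then D i (word_val Aut D w y) else D_inv i (word_val Aut D w y))"
    using Aut_apply(1)[OF _ w assms(3), of "if e then D i else inv\<^bsub>Aut\<^esub> D i"] D_Aut[OF i]
      D_letter_apply[OF i c, of e] by (cases e) simp_all
qed

lemma word_val_D_x_n:
  assumes "w \<in> words {2..n}"
  shows "word_val Aut D w (x n) = x n"
  using assms
proof (induction rule: words_induct)
  case Nil
  then show ?case using n3 by (simp add: Aut_apply)
next
  case (Cons i e w)
  have "i \<in> {1..n}" "i \<noteq> 1" using Cons.hyps by auto
  then have "D i (x n) = x n \<and> D_inv i (x n) = x n"
    by (cases rule: index_cases)
      (use n3 in \<open>simp_all add: D_gen D_inv_gen iota_image_simps iota_inv_image_simps del: One_nat_def\<close>)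
  then show ?case using word_val_D_Cons(1)[OF Cons.hyps, of "x n" e] Cons.IH n3 by simp
qed


section \<open>From automorphisms to Hurwitz moves\<close>

definition ev :: "(nat \<Rightarrow> ucox) \<Rightarrow> nat word set \<Rightarrow> ucox"
  where "ev f = lift_pres {1..n} {} ucox_group f"

lemma ev_hom: "ev f \<in> hom F ucox_group"
  unfolding ev_def free_group_def by (rule ucox.lift_pres_hom) simp_all

lemma ev_gen: "j \<in> {1..n} \<Longrightarrow> ev f (x j) = f j"
  unfolding ev_def free_gen_def by (rule ucox.lift_pres_gen) simp_all

lemma ev_mult: "y \<in> carrier F \<Longrightarrow> z \<in> carrier F \<Longrightarrow> ev f (y \<otimes>\<^bsub>F\<^esub> z) = ev f y * ev f z"
  using ev_hom[of f] by (simp add: hom_def)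

lemma ev_inv_gen:
  assumes "j \<in> {1..n}" "g * f j = 1"
  shows "ev f (inv\<^bsub>F\<^esub> x j) = g"
proof -
  have "ev f (inv\<^bsub>F\<^esub> x j) = inv\<^bsub>ucox_group\<^esub> ev f (x j)"
    using group_hom.hom_inv[of F ucox_group "ev f" "x j"] ev_hom x_closed[OF assms(1)]
    by (simp add: group_hom_def group_hom_axioms_def F.is_group ucox.is_group)
  then show ?thesis using ucox_inv_eq[OF assms(2)] ev_gen[OF assms(1)] by simp
qed

text \<open>Sending \<open>x\<^sub>n\<close> to \<open>1\<close> makes the intertwining relation hold on all generators: every
  \<open>\<delta>\<^sub>i\<close> with \<open>i \<ge> 2\<close> fixes \<open>x\<^sub>n\<close>.\<close>
definition basis :: "(nat \<Rightarrow> ucox) \<Rightarrow> nat \<Rightarrow> ucox"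
  where "basis T j = (if j < n then T 1 * T (Suc j) else 1)"

text \<open>Precomposition with the automorphism of \<open>d i\<close> becomes the move at place
  \<open>i - 1\<close>, since \<open>d 2\<close> is the first braid generator. On the basis this is
  a calculation with involutions.\<close>

lemma ev_D:
  assumes T: "noncrossing n T" and i: "i \<in> {2..n}" and y: "y \<in> carrier F"
  shows "ev (basis T) (D i y) = ev (basis (move True (i - 1) T)) y"
    "ev (basis T) (D_inv i y) = ev (basis (move False (i - 1) T)) y"
proof -
  have i1: "i \<in> {1..n}" "i \<noteq> 1" using i by auto
  have inv: "T k * T k = 1" "T k * (T k * z) = z" if "1 \<le> k" "k \<le> n" for k z
    using noncrossing_involution[OF T, of k] that by (simp_all add: mult.assoc[symmetric])
  have invx: "ev (basis T) (inv\<^bsub>F\<^esub> x j) = T (Suc j) * T 1" if "1 \<le> j" "j < n" for j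
    using that by (intro ev_inv_gen) (simp_all add: basis_def mult.assoc inv del: One_nat_def)
  have gen: "ev (basis T) (x j) = basis T j" if "1 \<le> j" "j \<le> n" for j
    using ev_gen[of j] that by simp
  have comp: "(\<lambda>y. ev (basis T) (h y)) \<in> hom F ucox_group" if "h \<in> hom F F" for h
    using hom_F[OF that] by (auto simp: hom_def ev_mult)
  have eq: "ev (basis T) (h y) = ev (basis U) y"
    if "h \<in> hom F F" "\<And>j. j \<in> {1..n} \<Longrightarrow> ev (basis T) (h (x j)) = basis U j" for h U
    using hom_presented_group_eq[of ucox_group "\<lambda>y. ev (basis T) (h y)" "{1..n}" "{}" "ev (basis U)" y]
      comp[OF that(1)] ev_hom y that(2) ev_gen ucox.is_group
    by (simp add: free_group_def free_gen_def)
  show "ev (basis T) (D i y) = ev (basis (move True (i - 1) T)) y"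
  proof (rule eq[OF D_hom[OF i1(1)]])
    fix j assume j: "j \<in> {1..n}"
    show "ev (basis T) (D i (x j)) = basis (move True (i - 1) T) j"
      using i1(1)
    proof (cases rule: index_cases)
      case 2
      have "j = 1 \<or> j = n \<or> (j \<noteq> 1 \<and> j < n)" using j by auto
      then show ?thesis using j n3 2
        by (elim disjE conjE) (simp_all add: D_gen iota_image_simps gen invx ev_mult basis_def move_def
             One_nat_def[symmetric] mult.assoc inv del: One_nat_def)
    next
      case (ge_3 k)
      have "j = k \<or> j = Suc k \<or> (j \<noteq> k \<and> j \<noteq> Suc k)" by blast
      then show ?thesis using j n3 ge_3
        by (elim disjE conjE) (simp_all add: D_gen iota_image_simps gen invx ev_mult basis_def move_def
             mult.assoc inv del: One_nat_def)
    qed (use i1 in simp)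
  qed
  show "ev (basis T) (D_inv i y) = ev (basis (move False (i - 1) T)) y"
  proof (rule eq[OF D_inv_hom[OF i1(1)]])
    fix j assume j: "j \<in> {1..n}"
    show "ev (basis T) (D_inv i (x j)) = basis (move False (i - 1) T) j"
      using i1(1)
    proof (cases rule: index_cases)
      case 2
      have "j = 1 \<or> j = n \<or> (j \<noteq> 1 \<and> j < n)" using j by auto
      then show ?thesis using j n3 2
        by (elim disjE conjE) (simp_all add: D_inv_gen iota_inv_image_simps gen invx ev_mult basis_def move_def
             One_nat_def[symmetric] mult.assoc inv del: One_nat_def)
    next
      case (ge_3 k)
      have "j = k \<or> j = Suc k \<or> (j \<noteq> k \<and> j \<noteq> Suc k)" by blast
      then show ?thesis using j n3 ge_3
        by (elim disjE conjE) (simp_all add: D_inv_gen iota_inv_image_simps gen invx ev_mult basis_def move_def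
             mult.assoc inv del: One_nat_def)
    qed (use i1 in simp)
  qed
qed

end

definition hurwitz_word :: "nat word \<Rightarrow> (bool \<times> nat) list"
  where "hurwitz_word w = map (\<lambda>(i, e). (e, i - 1)) w"

lemma hurwitz_word_simps [simp]:
  "hurwitz_word [] = []" "hurwitz_word ((i, e) # w) = (e, i - 1) # hurwitz_word w"
  by (simp_all add: hurwitz_word_def)

context type_D_rep
begin

lemma noncrossing_move_along: "w \<in> words {2..n} \<Longrightarrow> noncrossing n T \<Longrightarrow> noncrossing n (move_along (hurwitz_word w) T)"
proof (induction arbitrary: T rule: words_induct)
  case (Cons i e w)
  have "noncrossing n (move e (i - 1) T)" using Cons by (intro noncrossing_move) auto
  then show ?case using Cons.IH by simp
qed simp

lemma move_along_outside: "w \<in> words {2..n} \<Longrightarrow> i \<notin> {1..n} \<Longrightarrow> move_along (hurwitz_word w) T i = T i"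
  by (induction arbitrary: T rule: words_induct) (auto simp: move_def)

text \<open>The outermost automorphism is the first to be absorbed into the tuple. The letters
  therefore move the tuple in their written order, although automorphisms apply the last letter
  first.\<close>

lemma ev_word_val_D:
  "w \<in> words {2..n} \<Longrightarrow> noncrossing n T \<Longrightarrow> y \<in> carrier F \<Longrightarrow>
    ev (basis T) (word_val Aut D w y) = ev (basis (move_along (hurwitz_word w) T)) y"
proof (induction arbitrary: T rule: words_induct)
  case (Cons i e w)
  have "noncrossing n (move e (i - 1) T)" using Cons by (intro noncrossing_move) auto
  then have "ev (basis (move e (i - 1) T)) (word_val Aut D w y)
    = ev (basis (move_along (hurwitz_word ((i, e) # w)) T)) y"
    using Cons.IH Cons.prems by simp
  then show ?case
    using ev_D[OF Cons.prems(1) Cons.hyps(1) word_val_D_Cons(2)[OF Cons.hyps Cons.prems(2)]]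
      word_val_D_Cons(1)[OF Cons.hyps Cons.prems(2), of e] by (cases e) simp_all
qed (simp add: Aut_apply)

text \<open>The values on the \<open>x j\<close> determine only the products
  \<open>z 1 * z i\<close>, hence the tuple up to a common left factor \<open>c\<close>. Since all
  entries are involutions, \<open>c\<close> must be trivial, and freeness of the Hurwitz action
  applies.\<close>

lemma word_val_D_faithful:
  assumes w: "w \<in> words {2..n}" and fix_x: "\<And>j. j \<in> {1..<n} \<Longrightarrow> word_val Aut D w (x j) = x j"
  shows "word_val A d w = \<one>\<^bsub>A\<^esub>"
proof -
  define z where "z = move_along (hurwitz_word w) invo"
  have z: "noncrossing n z" unfolding z_def by (rule noncrossing_move_along[OF w noncrossing_invo])
  have zz: "z i * z i = 1" if "i \<in> {1..n}" for i using noncrossing_involution[OF z that] .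
  define c where "c = z 1 * invo 1"
  have zc: "z i = c * invo i" if i: "i \<in> {1..n}" for i
  proof (cases "i = 1")
    case False
    then obtain j where j: "i = Suc j" "j \<in> {1..<n}" using i by (cases i) auto
    have "ev (basis invo) (word_val Aut D w (x j)) = ev (basis z) (x j)"
      unfolding z_def using j by (intro ev_word_val_D[OF w noncrossing_invo]) simp
    then have "invo 1 * invo i = z 1 * z i"
      using fix_x[OF j(2)] ev_gen[of j] j by (simp add: basis_def)
    then have "z 1 * (z 1 * z i) = z 1 * (invo 1 * invo i)" by simp
    moreover have "z 1 * (z 1 * z i) = z i" using zz[of 1] n3 by (simp add: mult.assoc[symmetric])
    ultimately show ?thesis by (simp add: c_def mult.assoc)
  qed (simp add: c_def mult.assoc)
  have "letters c = []"
  proof (rule ccontr)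
    assume ne: "letters c \<noteq> []"
    let ?v = "letters c"
    \<comment> \<open>Conjugation by each of the first \<open>n\<close> letters inverts
      \<open>c\<close>. A letter different from both ends of the normal form would make the
      conjugate longer instead, and among three letters there is always one.\<close>
    have "\<exists>i\<in>{1, 2, 3}. i \<noteq> hd ?v \<and> i \<noteq> last ?v" by auto
    moreover have "{1, 2, 3} \<subseteq> {1..n}" using n3 by auto
    ultimately obtain i where i: "i \<in> {1..n}" "i \<noteq> hd ?v" "i \<noteq> last ?v" by blast
    have "elem (rev ?v) * (c * (invo i * (c * invo i))) = elem (rev ?v)"
      using zz[OF i(1)] zc[OF i(1)] by (simp add: mult.assoc)
    then have "invo i * c * invo i = elem (rev ?v)"
      using elem_rev_elem_times[of ?v] by (simp add: mult.assoc)
    moreover have "invo i * c * invo i = elem ([i] @ ?v @ [i])" by (simp add: mult.assoc)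
    moreover have "distinct_adj ([i] @ ?v @ [i])"
      using i ne by (simp add: distinct_adj_append_iff distinct_adj_Cons)
    ultimately have "length ([i] @ ?v @ [i]) = length (rev ?v)"
      by (metis len_elem distinct_adj_letters distinct_adj_rev)
    then show False by simp
  qed
  then have "c = 1" by (metis elem_letters elem_simps(1))
  \<comment> \<open>Tuples are total functions, so equality is also needed outside
    \<open>{1..n}\<close>, where no move changes anything.\<close>
  then have "z i = invo i" for i
    using zc[of i] move_along_outside[OF w, of i invo] by (cases "i \<in> {1..n}") (simp_all add: z_def)
  then have base: "move_along (hurwitz_word w) invo = invo" unfolding z_def by blast
  interpret B: braid_images A n "\<lambda>k. d (Suc k)"
  proof
    show "d (Suc k) \<in> carrier A" if "k \<in> {1..<n}" for k using that by (intro d_closed) auto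
    show "d (Suc k) \<otimes>\<^bsub>A\<^esub> d (Suc (Suc k)) \<otimes>\<^bsub>A\<^esub> d (Suc k) = d (Suc (Suc k)) \<otimes>\<^bsub>A\<^esub> d (Suc k) \<otimes>\<^bsub>A\<^esub> d (Suc (Suc k))"
      if "1 \<le> k" "Suc k < n" for k
    proof (rule d_braid)
      show "{Suc k, Suc (Suc k)} \<in> D_edges n"
        using that D_edges_mem(2) D_edges_mem(3)[of "k - 1"]
        by (cases "k = 1") (auto simp: numeral_2_eq_2 numeral_3_eq_3)
    qed (use that in auto)
    show "d (Suc k) \<otimes>\<^bsub>A\<^esub> d (Suc l) = d (Suc l) \<otimes>\<^bsub>A\<^esub> d (Suc k)" if "1 \<le> k" "Suc k < l" "l < n" for k l
    proof (rule d_commute)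
      show "{Suc k, Suc l} \<notin> D_edges n"
        using that not_D_edges(3)[of "l - 1"] not_D_edges(4)[of "k - 1" "l - 1"]
        by (cases "k = 1") (auto simp: numeral_2_eq_2)
    qed (use that in auto)
  qed
  have "B.braid_val (hurwitz_word w) = word_val A d w"
    using w by (induction rule: words_induct) (auto simp: B.signed_gen_def)
  moreover have "snd ` set (hurwitz_word w) \<subseteq> {1..<n}"
    using w by (induction rule: words_induct) auto
  ultimately show ?thesis using B.Hurwitz_action_free[OF _ base] by simp
qed

text \<open>On words of even length this inverts \<open>x\<^sub>j \<mapsto> y\<^sub>1 y\<^bsub>j+1\<^esub>\<close>, with \<open>a\<^sub>j\<close> in place of
  \<open>x\<^sub>j\<close> and \<open>a\<^sub>0 = 1\<close>.\<close>
fun alternating :: "bool \<Rightarrow> nat list \<Rightarrow> nat word set" where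
  "alternating e [] = \<one>\<^bsub>A\<^esub>"
| "alternating e (i # w) = (if e then a (i - 1) else inv\<^bsub>A\<^esub> a (i - 1)) \<otimes>\<^bsub>A\<^esub> alternating (\<not> e) w"

lemma alternating_closed: "set v \<subseteq> {1..n} \<Longrightarrow> alternating e v \<in> carrier A"
  by (induction v arbitrary: e) (auto intro!: A.m_closed a_closed A.inv_closed)

text \<open>Two equal neighbours stand at positions of opposite parity, so they contribute an
  element and its inverse.\<close>

lemma alternating_push:
  assumes "set v \<subseteq> {1..n}" "i \<in> {1..n}"
  shows "alternating e (push i v) = alternating e (i # v)"
proof (cases "v \<noteq> [] \<and> hd v = i")
  case True
  then obtain v' where v: "v = i # v'" by (cases v) auto
  have "a (i - 1) \<in> carrier A" "alternating e v' \<in> carrier A"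
    using assms alternating_closed[of v' e] a_closed by (auto simp: v)
  then show ?thesis by (cases e) (simp_all add: v A.inv_cancel)
next
  case False
  then show ?thesis by (cases v) auto
qed

text \<open>Here, unlike in \<open>basis\<close>, \<open>x n\<close> goes to a product with the new
  letter \<open>Suc n\<close>. The image \<open>g\<close> of the word has only letters up to
  \<open>n\<close>, so commuting with that product forces \<open>g = 1\<close>. As
  \<open>alternating\<close> recovers the word in the \<open>a m\<close> from \<open>g\<close>, that
  word is trivial as well.\<close>

lemma word_val_a_faithful:
  assumes w: "w \<in> words {1..<n}"
    and com: "word_val F x w \<otimes>\<^bsub>F\<^esub> x n = x n \<otimes>\<^bsub>F\<^esub> word_val F x w"
  shows "word_val A a w = \<one>\<^bsub>A\<^esub>"
proof -
  define f where "f j = invo 1 * invo (Suc j)" for j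
  have fi: "inv\<^bsub>ucox_group\<^esub> f j = invo (Suc j) * invo 1" for j
    by (rule ucox_inv_eq) (simp add: f_def mult.assoc)
  define g where "g = word_val ucox_group f w"
  have evw: "ev f (word_val F x w) = g"
    using hom_word_val[OF F.is_group ucox.is_group ev_hom x_Pi w, of f]
      word_val_cong[OF w, of "\<lambda>s. ev f (x s)" f ucox_group] ev_gen[of _ f] unfolding g_def by simp
  have sub: "set (letters g) \<subseteq> {1..n} \<and> word_val A a w = alternating False (letters g)"
    unfolding g_def using w
  proof (induction rule: words_induct)
    case (Cons m e w)
    let ?h = "word_val ucox_group f w"
    define i k where ik: "i = (if e then 1 else Suc m)" "k = (if e then Suc m else 1)"
    have m: "i \<in> {1..n}" "k \<in> {1..n}" using Cons.hyps n3 by (auto simp: ik)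
    have eq: "word_val ucox_group f ((m, e) # w) = invo i * (invo k * ?h)"
      using fi by (simp add: f_def ik mult.assoc)
    have ps: "set (push j v) \<subseteq> insert j (set v)" for j v by (cases v) auto
    have s: "set (letters ?h) \<subseteq> {1..n}" "set (push k (letters ?h)) \<subseteq> {1..n}"
      using Cons.IH ps[of k "letters ?h"] m by auto
    have "set (push i (push k (letters ?h))) \<subseteq> {1..n}" using ps[of i "push k (letters ?h)"] s m by auto
    moreover have "a m \<in> carrier A" "alternating False (letters ?h) \<in> carrier A"
      using a_closed[of m] Cons.hyps alternating_closed[OF s(1)] by auto
    then have "word_val A a ((m, e) # w) = alternating False (push i (push k (letters ?h)))"
      using alternating_push[OF s(2) m(1)] alternating_push[OF s(1) m(2)] Cons.IH
      by (cases e) (simp_all add: ik a.simps(1))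
    ultimately show ?case unfolding eq letters_invo_times by simp
  qed (simp add: a.simps(1))
  have "letters g = []"
  proof (rule ccontr)
    let ?v = "letters g"
    assume ne: "?v \<noteq> []"
    have nv: "Suc n \<notin> set ?v" using sub by auto
    have "g * f n = f n * g"
      using arg_cong[OF com, of "ev f"] ev_mult[of _ _ f] F.word_val_closed[OF w x_Pi] ev_gen[of n f] evw n3
      by simp
    \<comment> \<open>Once \<open>?v @ [1]\<close> is reduced, both sides are reduced words: the
      left one ends with \<open>Suc n\<close>, the right one with the last letter of
      \<open>g\<close>.\<close>
    then have "elem (?v @ [1]) * invo (Suc n) = elem ([1, Suc n] @ ?v)"
      by (simp add: f_def mult.assoc)
    moreover have "elem (?v @ [1]) = elem (letters (elem (?v @ [1])))" by simp
    ultimately have "elem (letters (elem (?v @ [1])) @ [Suc n]) = elem ([1, Suc n] @ ?v)"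
      by (metis elem_letters elem_simps(1,2,3) mult_1_right)
    moreover have "Suc n \<notin> set (letters (elem (?v @ [1])))"
      using set_letters_elem[of "?v @ [1]"] nv n3 by auto
    then have "letters (elem (?v @ [1])) = [] \<or> last (letters (elem (?v @ [1]))) \<noteq> Suc n"
      by (metis last_in_set)
    then have "distinct_adj (letters (elem (?v @ [1])) @ [Suc n])"
      by (simp only: distinct_adj_append_iff) simp
    moreover have "distinct_adj ([1, Suc n] @ ?v)"
      using nv ne n3 hd_in_set[OF ne] by (auto simp: distinct_adj_Cons)
    ultimately have "letters (elem (?v @ [1])) @ [Suc n] = [1, Suc n] @ ?v" by (metis letters_elem)
    then have "last ([1, Suc n] @ ?v) = Suc n" by (metis last_snoc)
    then show False using ne nv last_in_set[OF ne] by simp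
  qed
  then show ?thesis using sub by simp
qed

theorem iota_inj: "inj_on \<iota> (carrier A)"
proof -
  have "g = \<one>\<^bsub>A\<^esub>" if g: "g \<in> carrier A" "\<iota> g = \<one>\<^bsub>Aut\<^esub>" for g
  proof -
    obtain u v where uv: "u \<in> words {1..<n}" "v \<in> words {2..n}" "g = word_val A a u \<otimes>\<^bsub>A\<^esub> word_val A d v"
      using decomposition[OF g(1)] by (auto simp: N_def Bs_def)
    let ?u = "word_val A a u" and ?v = "word_val A d v" and ?W = "word_val F x u"
    have c: "?u \<in> carrier A" "?v \<in> carrier A" "?W \<in> carrier F"
      using A.word_val_closed[OF uv(1) a_Pi] A.word_val_closed[OF uv(2) d_Pi(2)] F.word_val_closed[OF uv(1) x_Pi] by auto
    have xn: "x n \<in> carrier F" using n3 by simp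
    have "\<iota> g (x n) = ?W \<otimes>\<^bsub>F\<^esub> x n \<otimes>\<^bsub>F\<^esub> inv\<^bsub>F\<^esub> ?W"
      unfolding uv(3) using iota_mult[OF c(1,2) xn] iota_word_val_d[OF uv(2)] word_val_D_x_n[OF uv(2)]
        iota_word_val_a[OF uv(1) xn] by simp
    then have "?W \<otimes>\<^bsub>F\<^esub> x n \<otimes>\<^bsub>F\<^esub> inv\<^bsub>F\<^esub> ?W = x n" using g(2) Aut_apply(2)[OF xn] by simp
    then have "?W \<otimes>\<^bsub>F\<^esub> x n \<otimes>\<^bsub>F\<^esub> inv\<^bsub>F\<^esub> ?W \<otimes>\<^bsub>F\<^esub> ?W = x n \<otimes>\<^bsub>F\<^esub> ?W" by simp
    then have "?W \<otimes>\<^bsub>F\<^esub> x n = x n \<otimes>\<^bsub>F\<^esub> ?W" using c xn by (simp add: F.m_assoc)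
    then have u: "?u = \<one>\<^bsub>A\<^esub>" by (rule word_val_a_faithful[OF uv(1)])
    have "word_val Aut D v = \<one>\<^bsub>Aut\<^esub>"
      using g(2) uv(3) u c iota_word_val_d[OF uv(2)] by simp
    then have "?v = \<one>\<^bsub>A\<^esub>" by (intro word_val_D_faithful[OF uv(2)]) (simp add: Aut_apply)
    then show ?thesis using uv(3) u by simp
  qed
  then show ?thesis using inj_on_one_iff'[OF iota_hom A.is_group Aut.is_group] by blast
qed

end

theorem proposition10:
  fixes n :: nat
  assumes "3 \<le> n"
  shows "(\<exists>!\<iota>. is_iota n \<iota>) \<and> (\<forall>\<iota>. is_iota n \<iota> \<longrightarrow> inj_on \<iota> (carrier (artin_D n)))"
proof -
  interpret type_D n by unfold_locales fact
  have "inj_on \<iota> (carrier (artin_D n))" if "is_iota n \<iota>" for \<iota>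
  proof -
    interpret type_D_rep n \<iota> by unfold_locales fact
    show ?thesis by (rule iota_inj)
  qed
  then show ?thesis using ex1_iota by blast
qed

end
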